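(* Let $M$ be a von Neumann algebra with a fixed faithful normal state $\phi$. Let $\theta=\{\theta_t\}_{t\ge0}$ be the dilation of a pair $(H,\Xi)$ of a $\phi$-spatial product system $H=\{\mathcal{H}_t\}_{t\ge0}$ of W$^*$-$M$-bimodules and a continuous unital unit $\Xi=\{\xi(t)\}_{t\ge0}$, and let $\mathfrak{H}$ be the inductive limit of $(H,\Xi)$ with canonical embeddings $\kappa_t:\mathcal{H}_t\to\mathfrak{H}$. Then there exists a one-to-one correspondence between contractive adapted right cocycles $w=\{w_t\}_{t\ge0}\subset\mathrm{End}(\mathfrak{H}_M)$ for $\theta$ and contractive units $\Lambda=\{\lambda(t)\}_{t\ge0}$ of $H$, given by the relations $$\lambda(t)=\kappa_t^*w_t\kappa_0\phi^{1/2},\qquad w_t=\pi_\phi(\kappa_t\lambda(t))\,\pi_\phi(\kappa_0\phi^{1/2})^*$$ for all $t\ge0$.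
   Context: Inner products are linear in the second variable. $L^2(M)$ is the standard space of $M$ (an $M$-$M$-bimodule), $\phi^{1/2}\in L^2(M)$ the vector representing $\phi$; $M\phi^{1/2}$ and $\phi^{1/2}M$ are dense in $L^2(M)$. A W$^*$-$M$-bimodule is a Hilbert space with commuting normal $*$-representations of $M$ (left action) and of $M^\circ$ (right action); a right W$^*$-$M$-module has only the right action, and $\mathrm{End}(\mathcal{H}_M)$ is the von Neumann algebra of bounded right $M$-linear operators. For a right W$^*$-$M$-module $\mathcal{H}$, $\xi\in\mathcal{H}$ is $\phi$-bounded if $\|\xi x\|\le c\|\phi^{1/2}x\|$ for all $x\in M$ and some $c>0$; $\mathcal{D}(\mathcal{H};\phi)$ is the set of such vectors and $\pi_\phi(\xi):L^2(M)\to\mathcal{H}$ is the bounded operator with $\phi^{1/2}x\mapsto\xi x$. For such $\xi_1,\xi_2$, $\pi_\phi(\xi_1)^*\pi_\phi(\xi_2)\in\mathrm{End}(L^2(M)_M)=M$. The relative tensor product $\mathcal{H}\otimes^M\mathcal{K}$ (for $\mathcal{K}$ with a left $M$-action) is the separation-completion of $\mathcal{D}(\mathcal{H};\phi)\otimes_{\mathrm{alg}}\mathcal{K}$ for $\langle\xi_1\phi^{-1/2}\eta_1,\xi_2\phi^{-1/2}\eta_2\rangle=\langle\eta_1,\pi_\phi(\xi_1)^*\pi_\phi(\xi_2)\eta_2\rangle$, where $\xi\phi^{-1/2}\eta$ denotes the class of $\xi\otimes\eta$; it inherits the outer actions. One identifies $L^2(M)\otimes^M\mathcal{K}\cong\mathcal{K}$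 and $\mathcal{H}\otimes^ML^2(M)\cong\mathcal{H}$ canonically. A product system of W$^*$-$M$-bimodules is a family $H=\{\mathcal{H}_t\}_{t\ge0}$ of W$^*$-$M$-bimodules with $\mathcal{H}_0=L^2(M)$ and bimodule unitaries $U_{s,t}:\mathcal{H}_s\otimes^M\mathcal{H}_t\to\mathcal{H}_{s+t}$ with $U_{r,s+t}(\mathrm{id}_{\mathcal{H}_r}\otimes^MU_{s,t})=U_{r+s,t}(U_{r,s}\otimes^M\mathrm{id}_{\mathcal{H}_t})$ (modulo the associativity isomorphism), $U_{0,t}$, $U_{s,0}$ being the canonical identifications. A unit (with respect to $\phi$) is a family $\Xi=\{\xi(t)\}_{t\ge0}$, $\xi(t)\in\mathcal{D}(\mathcal{H}_t;\phi)$, with $\xi(0)=\phi^{1/2}$ and $U_{s,t}(\xi(s)\phi^{-1/2}\xi(t))=\xi(s+t)$ for all $s,t\ge 0$; it is unital if $\pi_\phi(\xi(t))^*\pi_\phi(\xi(t))=1_M$ for all $t$, and contractive if $\|\pi_\phi(\xi(t))^*\pi_\phi(\xi(t))\|\le1$ for all $t$. $H$ is $\phi$-spatial if it has a unit with respect to $\phi$. Inductive limit and dilation of $(H,\Xi)$ ($\Xi$ a unital unit): for $0\le s\le t$ let $b_{t,s}:\mathcal{H}_s\to\mathcal{H}_t$ be the right $M$-linear isometry $b_{t,s}(\xi)=U_{t-s,s}(\xi(t-s)\phi^{-1/2}\xi)$. $\mathfrak{H}$ is the inductive limit right W$^*$-$M$-module of $(\{\mathcal{H}_t\},\{b_{t,s}\}_{s\le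 t})$, with canonical isometric embeddings $\kappa_t:\mathcal{H}_t\to\mathfrak{H}$, $\kappa_tb_{t,s}=\kappa_s$. $U_t:\mathfrak{H}\otimes^M\mathcal{H}_t\to\mathfrak{H}$ is the right $M$-linear unitary determined by $U_t((\kappa_s\xi_s)\phi^{-1/2}\eta_t)=\kappa_{s+t}U_{s,t}(\xi_s\phi^{-1/2}\eta_t)$ for $s\ge0$, $\xi_s\in\mathcal{D}(\mathcal{H}_s;\phi)$, $\eta_t\in\mathcal{H}_t$. The dilation of $(H,\Xi)$ is the semigroup $\theta_t(a)=U_t(a\otimes^M\mathrm{id}_{\mathcal{H}_t})U_t^*$ of normal unital $*$-endomorphisms of $\mathrm{End}(\mathfrak{H}_M)$. $\Xi$ is continuous if $U_t(\xi\phi^{-1/2}\xi(t))\to\xi$ as $t\to+0$ for all $\xi\in\mathcal{D}(\mathfrak{H};\phi)$. A right cocycle for $\theta$ is a family $w=\{w_t\}_{t\ge0}\subset\mathrm{End}(\mathfrak{H}_M)$ with $w_{s+t}=\theta_t(w_s)w_t$ for all $s,t\ge0$; it is contractive if each $w_t$ is a contraction, and adapted if $\kappa_t\kappa_t^*w_t\kappa_t\kappa_t^*=w_t$ for all $t\ge0$.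
   Formalization: The cocycles are additionally required to satisfy $w_0=\kappa_0\kappa_0^*$; without this the claim fails, since $w=0$ is a contractive adapted right cocycle giving $\lambda(0)=0\neq\phi^{1/2}$. *)

theory Defs
  imports Complex_Main "HOL-Library.FuncSet" "HOL-Library.Poly_Mapping" "HOL-Library.Nonpos_Ints"
begin

section \<open>Hilbert spaces with explicit carriers\<close>

text \<open>
  Families of Hilbert spaces and spaces built from vectors and operators (relative tensor products)
  occur below, so spaces are records with a carrier.  Inner products are linear in the
  second variable.  Operators are functions that are extensional on the carrier of their domain, so
  equality of operators is equality of functions and \<open>compose\<close> is their product.
\<close>

record 'a inner_space =
  vecs :: "'a set"
  vzero :: 'a
  vplus :: "'a \<Rightarrow> 'a \<Rightarrow> 'a"
  vscale :: "complex \<Rightarrow> 'a \<Rightarrow> 'a"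
  vinner :: "'a \<Rightarrow> 'a \<Rightarrow> complex"

definition vdiff :: "('a, 'z) inner_space_scheme \<Rightarrow> 'a \<Rightarrow> 'a \<Rightarrow> 'a" where
  "vdiff V x y = vplus V x (vscale V (- 1) y)"

definition vnorm :: "('a, 'z) inner_space_scheme \<Rightarrow> 'a \<Rightarrow> real" where
  "vnorm V x = sqrt (Re (vinner V x x))"

definition vcauchy :: "('a, 'z) inner_space_scheme \<Rightarrow> (nat \<Rightarrow> 'a) \<Rightarrow> bool" where
  "vcauchy V X \<longleftrightarrow> (\<forall>n. X n \<in> vecs V) \<and>
     (\<forall>e>0. \<exists>N. \<forall>m\<ge>N. \<forall>n\<ge>N. vnorm V (vdiff V (X m) (X n)) < e)"

locale hilbert_space =
  fixes V :: "('a, 'z) inner_space_scheme"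
  assumes zero_closed: "vzero V \<in> vecs V"
    and plus_closed: "\<lbrakk>x \<in> vecs V; y \<in> vecs V\<rbrakk> \<Longrightarrow> vplus V x y \<in> vecs V"
    and scale_closed: "x \<in> vecs V \<Longrightarrow> vscale V c x \<in> vecs V"
    and plus_assoc: "\<lbrakk>x \<in> vecs V; y \<in> vecs V; z \<in> vecs V\<rbrakk>
      \<Longrightarrow> vplus V (vplus V x y) z = vplus V x (vplus V y z)"
    and plus_commute: "\<lbrakk>x \<in> vecs V; y \<in> vecs V\<rbrakk> \<Longrightarrow> vplus V x y = vplus V y x"
    and plus_zero: "x \<in> vecs V \<Longrightarrow> vplus V x (vzero V) = x"
    and diff_self: "x \<in> vecs V \<Longrightarrow> vdiff V x x = vzero V"
    and scale_plus: "\<lbrakk>x \<in> vecs V; y \<in> vecs V\<rbrakk>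
      \<Longrightarrow> vscale V c (vplus V x y) = vplus V (vscale V c x) (vscale V c y)"
    and plus_scale: "x \<in> vecs V \<Longrightarrow> vscale V (c + d) x = vplus V (vscale V c x) (vscale V d x)"
    and scale_scale: "x \<in> vecs V \<Longrightarrow> vscale V c (vscale V d x) = vscale V (c * d) x"
    and scale_one: "x \<in> vecs V \<Longrightarrow> vscale V 1 x = x"
    and inner_plus: "\<lbrakk>x \<in> vecs V; y \<in> vecs V; z \<in> vecs V\<rbrakk>
      \<Longrightarrow> vinner V x (vplus V y z) = vinner V x y + vinner V x z"
    and inner_scale: "\<lbrakk>x \<in> vecs V; y \<in> vecs V\<rbrakk> \<Longrightarrow> vinner V x (vscale V c y) = c * vinner V x y"
    and inner_commute: "\<lbrakk>x \<in> vecs V; y \<in> vecs V\<rbrakk> \<Longrightarrow> vinner V y x = cnj (vinner V x y)"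
    and inner_nonneg: "x \<in> vecs V \<Longrightarrow> vinner V x x \<in> \<real>\<^sub>\<ge>\<^sub>0"
    and inner_definite: "\<lbrakk>x \<in> vecs V; vinner V x x = 0\<rbrakk> \<Longrightarrow> x = vzero V"
    and complete: "vcauchy V X \<Longrightarrow> \<exists>x\<in>vecs V. (\<lambda>n. vnorm V (vdiff V (X n) x)) \<longlonglongrightarrow> 0"

definition linear_op ::
    "('a, 'y) inner_space_scheme \<Rightarrow> ('b, 'z) inner_space_scheme \<Rightarrow> ('a \<Rightarrow> 'b) set" where
  "linear_op V W = {T \<in> vecs V \<rightarrow>\<^sub>E vecs W.
     (\<forall>x\<in>vecs V. \<forall>y\<in>vecs V. T (vplus V x y) = vplus W (T x) (T y)) \<and>
     (\<forall>c. \<forall>x\<in>vecs V. T (vscale V c x) = vscale W c (T x))}"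

definition bounded_op ::
    "('a, 'y) inner_space_scheme \<Rightarrow> ('b, 'z) inner_space_scheme \<Rightarrow> ('a \<Rightarrow> 'b) set" where
  "bounded_op V W = {T \<in> linear_op V W. \<exists>c. \<forall>x\<in>vecs V. vnorm W (T x) \<le> c * vnorm V x}"

definition contraction_op ::
    "('a, 'y) inner_space_scheme \<Rightarrow> ('b, 'z) inner_space_scheme \<Rightarrow> ('a \<Rightarrow> 'b) set" where
  "contraction_op V W = {T \<in> linear_op V W. \<forall>x\<in>vecs V. vnorm W (T x) \<le> vnorm V x}"

definition isometry_op ::
    "('a, 'y) inner_space_scheme \<Rightarrow> ('b, 'z) inner_space_scheme \<Rightarrow> ('a \<Rightarrow> 'b) set" where
  "isometry_op V W = {T \<in> linear_op V W.
     \<forall>x\<in>vecs V. \<forall>y\<in>vecs V. vinner W (T x) (T y) = vinner V x y}"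

definition unitary_op ::
    "('a, 'y) inner_space_scheme \<Rightarrow> ('b, 'z) inner_space_scheme \<Rightarrow> ('a \<Rightarrow> 'b) set" where
  "unitary_op V W = {T \<in> isometry_op V W. T ` vecs V = vecs W}"

definition adj ::
    "('a, 'y) inner_space_scheme \<Rightarrow> ('b, 'z) inner_space_scheme \<Rightarrow> ('a \<Rightarrow> 'b) \<Rightarrow> 'b \<Rightarrow> 'a" where
  "adj V W T = (\<lambda>y\<in>vecs W. THE x. x \<in> vecs V \<and>
     (\<forall>z\<in>vecs V. vinner V z x = vinner W (T z) y))"

definition op_id :: "('a, 'z) inner_space_scheme \<Rightarrow> 'a \<Rightarrow> 'a" where
  "op_id V = (\<lambda>x\<in>vecs V. x)"

definition op_plus ::
    "('a, 'z) inner_space_scheme \<Rightarrow> ('a \<Rightarrow> 'a) \<Rightarrow> ('a \<Rightarrow> 'a) \<Rightarrow> 'a \<Rightarrow> 'a" where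
  "op_plus V S T = (\<lambda>x\<in>vecs V. vplus V (S x) (T x))"

definition op_scale :: "('a, 'z) inner_space_scheme \<Rightarrow> complex \<Rightarrow> ('a \<Rightarrow> 'a) \<Rightarrow> 'a \<Rightarrow> 'a" where
  "op_scale V c T = (\<lambda>x\<in>vecs V. vscale V c (T x))"

text \<open>Separation-completion of a semi-inner product space: Cauchy sequences modulo null sequences.\<close>

definition cauchy_rel ::
    "('a, 'z) inner_space_scheme \<Rightarrow> ((nat \<Rightarrow> 'a) \<times> (nat \<Rightarrow> 'a)) set" where
  "cauchy_rel V = {(X, Y). vcauchy V X \<and> vcauchy V Y \<and> (\<lambda>n. vnorm V (vdiff V (X n) (Y n))) \<longlonglongrightarrow> 0}"

definition cauchy_class :: "('a, 'z) inner_space_scheme \<Rightarrow> (nat \<Rightarrow> 'a) \<Rightarrow> (nat \<Rightarrow> 'a) set" where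
  "cauchy_class V X = cauchy_rel V `` {X}"

definition cauchy_rep :: "(nat \<Rightarrow> 'a) set \<Rightarrow> nat \<Rightarrow> 'a" where
  "cauchy_rep A = (SOME X. X \<in> A)"

definition completion :: "('a, 'z) inner_space_scheme \<Rightarrow> (nat \<Rightarrow> 'a) set inner_space" where
  "completion V = \<lparr>
     vecs = {X. vcauchy V X} // cauchy_rel V,
     vzero = cauchy_class V (\<lambda>n. vzero V),
     vplus = (\<lambda>A B. cauchy_class V (\<lambda>n. vplus V (cauchy_rep A n) (cauchy_rep B n))),
     vscale = (\<lambda>c A. cauchy_class V (\<lambda>n. vscale V c (cauchy_rep A n))),
     vinner = (\<lambda>A B. lim (\<lambda>n. vinner V (cauchy_rep A n) (cauchy_rep B n)))\<rparr>"


section \<open>Von Neumann algebras, modules and the standard space\<close>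

record 'b vn_algebra =
  base :: "'b inner_space"
  elts :: "('b \<Rightarrow> 'b) set"

abbreviation vn_star :: "('b, 'z) vn_algebra_scheme \<Rightarrow> ('b \<Rightarrow> 'b) \<Rightarrow> 'b \<Rightarrow> 'b" where
  "vn_star M a \<equiv> adj (base M) (base M) a"

abbreviation vn_mult ::
    "('b, 'z) vn_algebra_scheme \<Rightarrow> ('b \<Rightarrow> 'b) \<Rightarrow> ('b \<Rightarrow> 'b) \<Rightarrow> 'b \<Rightarrow> 'b" where
  "vn_mult M a b \<equiv> compose (vecs (base M)) a b"

definition commutant :: "('a, 'z) inner_space_scheme \<Rightarrow> ('a \<Rightarrow> 'a) set \<Rightarrow> ('a \<Rightarrow> 'a) set" where
  "commutant V A = {T \<in> bounded_op V V. \<forall>a\<in>A. compose (vecs V) T a = compose (vecs V) a T}"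

definition von_neumann_algebra :: "('b, 'z) vn_algebra_scheme \<Rightarrow> bool" where
  "von_neumann_algebra M \<longleftrightarrow> hilbert_space (base M) \<and> elts M \<subseteq> bounded_op (base M) (base M) \<and>
     (\<forall>a\<in>elts M. vn_star M a \<in> elts M) \<and>
     commutant (base M) (commutant (base M) (elts M)) = elts M"

definition center :: "('b, 'z) vn_algebra_scheme \<Rightarrow> ('b \<Rightarrow> 'b) set" where
  "center M = {a \<in> elts M. \<forall>b\<in>elts M. vn_mult M a b = vn_mult M b a}"

definition linear_functional :: "('b, 'z) vn_algebra_scheme \<Rightarrow> (('b \<Rightarrow> 'b) \<Rightarrow> complex) \<Rightarrow> bool" where
  "linear_functional M f \<longleftrightarrow>
     (\<forall>a\<in>elts M. \<forall>b\<in>elts M. f (op_plus (base M) a b) = f a + f b) \<and>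
     (\<forall>c. \<forall>a\<in>elts M. f (op_scale (base M) c a) = c * f a)"

text \<open>The normal functionals are the \<open>\<sigma>\<close>-weakly continuous ones.\<close>

definition normal_functional :: "('b, 'z) vn_algebra_scheme \<Rightarrow> (('b \<Rightarrow> 'b) \<Rightarrow> complex) \<Rightarrow> bool" where
  "normal_functional M f \<longleftrightarrow> (\<exists>p q.
     (\<forall>n::nat. p n \<in> vecs (base M) \<and> q n \<in> vecs (base M)) \<and>
     summable (\<lambda>n. (vnorm (base M) (p n))\<^sup>2) \<and> summable (\<lambda>n. (vnorm (base M) (q n))\<^sup>2) \<and>
     (\<forall>a\<in>elts M. (\<lambda>n. vinner (base M) (p n) (a (q n))) sums f a))"

definition faithful_normal_state ::
    "('b, 'z) vn_algebra_scheme \<Rightarrow> (('b \<Rightarrow> 'b) \<Rightarrow> complex) \<Rightarrow> bool" where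
  "faithful_normal_state M \<phi> \<longleftrightarrow> linear_functional M \<phi> \<and>
     (\<forall>a\<in>elts M. \<phi> (vn_mult M (vn_star M a) a) \<in> \<real>\<^sub>\<ge>\<^sub>0) \<and>
     \<phi> (op_id (base M)) = 1 \<and>
     (\<forall>a\<in>elts M. \<phi> (vn_mult M (vn_star M a) a) = 0 \<longrightarrow> a = (\<lambda>x\<in>vecs (base M). vzero (base M))) \<and>
     normal_functional M \<phi>"

record ('a, 'm) rmodule = "'a inner_space" +
  ract :: "'a \<Rightarrow> 'm \<Rightarrow> 'a"

record ('a, 'm) bimodule = "('a, 'm) rmodule" +
  lact :: "'m \<Rightarrow> 'a \<Rightarrow> 'a"

definition normal_rep ::
    "('b, 'y) vn_algebra_scheme \<Rightarrow> ('a, 'z) inner_space_scheme \<Rightarrow> (('b \<Rightarrow> 'b) \<Rightarrow> 'a \<Rightarrow> 'a) \<Rightarrow> bool" where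
  "normal_rep M V \<rho> \<longleftrightarrow>
     (\<forall>a\<in>elts M. restrict (\<rho> a) (vecs V) \<in> bounded_op V V) \<and>
     (\<forall>x\<in>vecs V. \<rho> (op_id (base M)) x = x) \<and>
     (\<forall>a\<in>elts M. \<forall>b\<in>elts M. \<forall>x\<in>vecs V. \<rho> (op_plus (base M) a b) x = vplus V (\<rho> a x) (\<rho> b x)) \<and>
     (\<forall>c. \<forall>a\<in>elts M. \<forall>x\<in>vecs V. \<rho> (op_scale (base M) c a) x = vscale V c (\<rho> a x)) \<and>
     (\<forall>a\<in>elts M. \<forall>x\<in>vecs V. \<forall>y\<in>vecs V. vinner V x (\<rho> a y) = vinner V (\<rho> (vn_star M a) x) y) \<and>
     (\<forall>x\<in>vecs V. \<forall>y\<in>vecs V. normal_functional M (\<lambda>a. vinner V x (\<rho> a y)))"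

definition right_module ::
    "('b, 'y) vn_algebra_scheme \<Rightarrow> ('a, 'b \<Rightarrow> 'b, 'z) rmodule_scheme \<Rightarrow> bool" where
  "right_module M V \<longleftrightarrow> hilbert_space V \<and> normal_rep M V (\<lambda>a x. ract V x a) \<and>
     (\<forall>a\<in>elts M. \<forall>b\<in>elts M. \<forall>x\<in>vecs V. ract V x (vn_mult M a b) = ract V (ract V x a) b)"

definition wstar_bimodule ::
    "('b, 'y) vn_algebra_scheme \<Rightarrow> ('a, 'b \<Rightarrow> 'b, 'z) bimodule_scheme \<Rightarrow> bool" where
  "wstar_bimodule M V \<longleftrightarrow> right_module M V \<and> normal_rep M V (lact V) \<and>
     (\<forall>a\<in>elts M. \<forall>b\<in>elts M. \<forall>x\<in>vecs V. lact V (vn_mult M a b) x = lact V a (lact V b x)) \<and>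
     (\<forall>a\<in>elts M. \<forall>b\<in>elts M. \<forall>x\<in>vecs V. ract V (lact V a x) b = lact V a (ract V x b))"

definition right_linear ::
    "('b, 'x) vn_algebra_scheme \<Rightarrow> ('u, 'b \<Rightarrow> 'b, 'y) rmodule_scheme \<Rightarrow>
     ('v, 'b \<Rightarrow> 'b, 'z) rmodule_scheme \<Rightarrow> ('u \<Rightarrow> 'v) \<Rightarrow> bool" where
  "right_linear M V W T \<longleftrightarrow> (\<forall>x\<in>vecs V. \<forall>a\<in>elts M. T (ract V x a) = ract W (T x) a)"

definition left_linear ::
    "('b, 'x) vn_algebra_scheme \<Rightarrow> ('u, 'b \<Rightarrow> 'b, 'y) bimodule_scheme \<Rightarrow>
     ('v, 'b \<Rightarrow> 'b, 'z) bimodule_scheme \<Rightarrow> ('u \<Rightarrow> 'v) \<Rightarrow> bool" where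
  "left_linear M V W T \<longleftrightarrow> (\<forall>x\<in>vecs V. \<forall>a\<in>elts M. T (lact V a x) = lact W a (T x))"

definition End_right ::
    "('b, 'y) vn_algebra_scheme \<Rightarrow> ('a, 'b \<Rightarrow> 'b, 'z) rmodule_scheme \<Rightarrow> ('a \<Rightarrow> 'a) set" where
  "End_right M V = {T \<in> bounded_op V V. right_linear M V V T}"

text \<open>
  \<open>L\<^sup>2(M)\<close> is taken as a standard form \<open>(M, L2, J, P)\<close> in the sense of Haagerup, which is unique up
  to a unique unitary, with the right action \<open>\<xi>a = J a\<^sup>* J \<xi>\<close>.  The vector \<open>\<phi>\<^sup>1\<^sup>/\<^sup>2\<close> is the unique vector
  of the self-dual cone \<open>P\<close> whose vector functional is \<open>\<phi>\<close>.
\<close>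

record ('b, 'h) std_algebra = "'b vn_algebra" +
  L2 :: "('h, 'b \<Rightarrow> 'b) bimodule"
  modconj :: "'h \<Rightarrow> 'h"
  poscone :: "'h set"

definition left_image :: "('b, 'h) std_algebra \<Rightarrow> ('h \<Rightarrow> 'h) set" where
  "left_image M = (\<lambda>a. restrict (lact (L2 M) a) (vecs (L2 M))) ` elts M"

definition standard_form :: "('b, 'h) std_algebra \<Rightarrow> bool" where
  "standard_form M \<longleftrightarrow> von_neumann_algebra M \<and> wstar_bimodule M (L2 M) \<and>
     (let L = L2 M; J = modconj M; P = poscone M in
       inj_on (\<lambda>a. restrict (lact L a) (vecs L)) (elts M) \<and>
       (\<forall>x\<in>vecs L. J x \<in> vecs L \<and> J (J x) = x) \<and>
       (\<forall>x\<in>vecs L. \<forall>y\<in>vecs L. J (vplus L x y) = vplus L (J x) (J y)) \<and>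
       (\<forall>c. \<forall>x\<in>vecs L. J (vscale L c x) = vscale L (cnj c) (J x)) \<and>
       (\<forall>x\<in>vecs L. \<forall>y\<in>vecs L. vinner L (J x) (J y) = vinner L y x) \<and>
       P = {x \<in> vecs L. \<forall>y\<in>P. vinner L x y \<in> \<real>\<^sub>\<ge>\<^sub>0} \<and>
       (\<lambda>T. \<lambda>x\<in>vecs L. J (T (J x))) ` left_image M = commutant L (left_image M) \<and>
       (\<forall>a\<in>center M. \<forall>x\<in>vecs L. J (lact L a (J x)) = lact L (vn_star M a) x) \<and>
       (\<forall>x\<in>P. J x = x) \<and>
       (\<forall>a\<in>elts M. \<forall>x\<in>P. lact L a (J (lact L a (J x))) \<in> P) \<and>
       (\<forall>a\<in>elts M. \<forall>x\<in>vecs L. ract L x a = J (lact L (vn_star M a) (J x))))"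

definition represents_state ::
    "('b, 'h) std_algebra \<Rightarrow> (('b \<Rightarrow> 'b) \<Rightarrow> complex) \<Rightarrow> 'h \<Rightarrow> bool" where
  "represents_state M \<phi> \<Omega> \<longleftrightarrow> \<Omega> \<in> poscone M \<and>
     (\<forall>a\<in>elts M. \<phi> a = vinner (L2 M) \<Omega> (lact (L2 M) a \<Omega>))"


section \<open>Relative tensor products\<close>

text \<open>Throughout, \<open>\<Omega>\<close> stands for the vector \<open>\<phi>\<^sup>1\<^sup>/\<^sup>2\<close>; \<open>\<phi>\<close> enters only through it.\<close>

definition bdd_vecs ::
    "('b, 'h) std_algebra \<Rightarrow> 'h \<Rightarrow> ('a, 'b \<Rightarrow> 'b, 'z) rmodule_scheme \<Rightarrow> 'a set" where
  "bdd_vecs M \<Omega> H = {\<xi> \<in> vecs H.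
     \<exists>c>0. \<forall>a\<in>elts M. vnorm H (ract H \<xi> a) \<le> c * vnorm (L2 M) (ract (L2 M) \<Omega> a)}"

definition pi_op ::
    "('b, 'h) std_algebra \<Rightarrow> 'h \<Rightarrow> ('a, 'b \<Rightarrow> 'b, 'z) rmodule_scheme \<Rightarrow> 'a \<Rightarrow> 'h \<Rightarrow> 'a" where
  "pi_op M \<Omega> H \<xi> = (THE T. T \<in> bounded_op (L2 M) H \<and>
     (\<forall>a\<in>elts M. T (ract (L2 M) \<Omega> a) = ract H \<xi> a))"

definition pi_prod ::
    "('b, 'h) std_algebra \<Rightarrow> 'h \<Rightarrow> ('a, 'b \<Rightarrow> 'b, 'z) rmodule_scheme \<Rightarrow> 'a \<Rightarrow> 'a \<Rightarrow> 'h \<Rightarrow> 'h" where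
  "pi_prod M \<Omega> H \<xi> \<eta> =
     compose (vecs (L2 M)) (adj (L2 M) H (pi_op M \<Omega> H \<xi>)) (pi_op M \<Omega> H \<eta>)"

text \<open>The same operator as an element of \<open>M\<close>, via \<open>End(L\<^sup>2(M)\<^sub>M) = M\<close>.\<close>

definition m_inner ::
    "('b, 'h) std_algebra \<Rightarrow> 'h \<Rightarrow> ('a, 'b \<Rightarrow> 'b, 'z) rmodule_scheme \<Rightarrow> 'a \<Rightarrow> 'a \<Rightarrow> 'b \<Rightarrow> 'b" where
  "m_inner M \<Omega> H \<xi> \<eta> = (THE a. a \<in> elts M \<and>
     restrict (lact (L2 M) a) (vecs (L2 M)) = pi_prod M \<Omega> H \<xi> \<eta>)"

text \<open>
  The semi-inner product is put on the free vector space over \<open>\<D>(H;\<phi>) \<times> K\<close>.  The relations of the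
  algebraic tensor product lie in its null space, so the separation divides them out.
\<close>

definition pre_tensor ::
    "('b, 'h) std_algebra \<Rightarrow> 'h \<Rightarrow> ('u, 'b \<Rightarrow> 'b, 'y) rmodule_scheme \<Rightarrow>
     ('v, 'b \<Rightarrow> 'b, 'z) bimodule_scheme \<Rightarrow> ('u \<times> 'v \<Rightarrow>\<^sub>0 complex) inner_space" where
  "pre_tensor M \<Omega> H K = \<lparr>
     vecs = {f. Poly_Mapping.keys f \<subseteq> bdd_vecs M \<Omega> H \<times> vecs K},
     vzero = 0,
     vplus = (+),
     vscale = (\<lambda>c. Poly_Mapping.map ((*) c)),
     vinner = (\<lambda>f g. \<Sum>(\<xi>1, \<eta>1)\<in>Poly_Mapping.keys f. \<Sum>(\<xi>2, \<eta>2)\<in>Poly_Mapping.keys g.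
       cnj (Poly_Mapping.lookup f (\<xi>1, \<eta>1)) * Poly_Mapping.lookup g (\<xi>2, \<eta>2) *
       vinner K \<eta>1 (lact K (m_inner M \<Omega> H \<xi>1 \<xi>2) \<eta>2))\<rparr>"

type_synonym ('u, 'v) tens = "(nat \<Rightarrow> ('u \<times> 'v \<Rightarrow>\<^sub>0 complex)) set"

definition tensor_space ::
    "('b, 'h) std_algebra \<Rightarrow> 'h \<Rightarrow> ('u, 'b \<Rightarrow> 'b, 'y) rmodule_scheme \<Rightarrow>
     ('v, 'b \<Rightarrow> 'b, 'z) bimodule_scheme \<Rightarrow> ('u, 'v) tens inner_space" where
  "tensor_space M \<Omega> H K = completion (pre_tensor M \<Omega> H K)"

text \<open>The vector \<open>\<xi>\<phi>\<^sup>-\<^sup>1\<^sup>/\<^sup>2\<eta>\<close>.\<close>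

definition tensor_vec ::
    "('b, 'h) std_algebra \<Rightarrow> 'h \<Rightarrow> ('u, 'b \<Rightarrow> 'b, 'y) rmodule_scheme \<Rightarrow>
     ('v, 'b \<Rightarrow> 'b, 'z) bimodule_scheme \<Rightarrow> 'u \<Rightarrow> 'v \<Rightarrow> ('u, 'v) tens" where
  "tensor_vec M \<Omega> H K \<xi> \<eta> =
     cauchy_class (pre_tensor M \<Omega> H K) (\<lambda>n. Poly_Mapping.single (\<xi>, \<eta>) 1)"

text \<open>
  \<open>S \<otimes>\<^sup>M T\<close> on \<open>H \<otimes>\<^sup>M K\<close>, for bounded \<open>S\<close> on \<open>H\<close> (right linear) and \<open>T\<close> on \<open>K\<close> (left linear).
\<close>

definition tensor_op ::
    "('b, 'h) std_algebra \<Rightarrow> 'h \<Rightarrow> ('u, 'b \<Rightarrow> 'b, 'y) rmodule_scheme \<Rightarrow>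
     ('v, 'b \<Rightarrow> 'b, 'z) bimodule_scheme \<Rightarrow> ('u \<Rightarrow> 'u) \<Rightarrow> ('v \<Rightarrow> 'v) \<Rightarrow>
     ('u, 'v) tens \<Rightarrow> ('u, 'v) tens" where
  "tensor_op M \<Omega> H K S T = (THE R.
     R \<in> bounded_op (tensor_space M \<Omega> H K) (tensor_space M \<Omega> H K) \<and>
     (\<forall>\<xi>\<in>bdd_vecs M \<Omega> H. \<forall>\<eta>\<in>vecs K.
        R (tensor_vec M \<Omega> H K \<xi> \<eta>) = tensor_vec M \<Omega> H K (S \<xi>) (T \<eta>)))"

definition tensor_right ::
    "('b, 'h) std_algebra \<Rightarrow> 'h \<Rightarrow> ('u, 'b \<Rightarrow> 'b, 'y) rmodule_scheme \<Rightarrow>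
     ('v, 'b \<Rightarrow> 'b, 'z) bimodule_scheme \<Rightarrow> (('u, 'v) tens, 'b \<Rightarrow> 'b) rmodule" where
  "tensor_right M \<Omega> H K = inner_space.extend (tensor_space M \<Omega> H K)
     (rmodule.fields (\<lambda>v a. tensor_op M \<Omega> H K (op_id H) (\<lambda>\<eta>\<in>vecs K. ract K \<eta> a) v))"

definition tensor_bi ::
    "('b, 'h) std_algebra \<Rightarrow> 'h \<Rightarrow> ('u, 'b \<Rightarrow> 'b, 'y) bimodule_scheme \<Rightarrow>
     ('v, 'b \<Rightarrow> 'b, 'z) bimodule_scheme \<Rightarrow> (('u, 'v) tens, 'b \<Rightarrow> 'b) bimodule" where
  "tensor_bi M \<Omega> H K = rmodule.extend (tensor_right M \<Omega> H K)
     (bimodule.fields (\<lambda>a v. tensor_op M \<Omega> H K (\<lambda>\<xi>\<in>vecs H. lact H a \<xi>) (op_id K) v))"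


section \<open>Product systems and units\<close>

text \<open>
  All spaces \<open>H t\<close> have carriers in one type, which is no restriction up to isomorphism.  Only indices
  \<open>t \<ge> 0\<close> matter.  Identities between operators on (iterated) relative tensor products
  are written out on the vectors \<open>\<xi>\<phi>\<^sup>-\<^sup>1\<^sup>/\<^sup>2\<eta>\<close>: the associativity isomorphism sends
  \<open>(\<xi>\<phi>\<^sup>-\<^sup>1\<^sup>/\<^sup>2\<eta>)\<phi>\<^sup>-\<^sup>1\<^sup>/\<^sup>2\<zeta>\<close> to \<open>\<xi>\<phi>\<^sup>-\<^sup>1\<^sup>/\<^sup>2(\<eta>\<phi>\<^sup>-\<^sup>1\<^sup>/\<^sup>2\<zeta>)\<close> for \<open>\<phi>\<close>-bounded \<open>\<xi>\<close>, \<open>\<eta>\<close>, and the canonical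
  identifications with \<open>L\<^sup>2(M)\<close> are \<open>(a\<phi>\<^sup>1\<^sup>/\<^sup>2)\<phi>\<^sup>-\<^sup>1\<^sup>/\<^sup>2\<eta> \<mapsto> a\<eta>\<close> and \<open>\<xi>\<phi>\<^sup>-\<^sup>1\<^sup>/\<^sup>2\<zeta> \<mapsto> \<pi>\<^sub>\<phi>(\<xi>)\<zeta>\<close>, the
  latter extending \<open>\<xi>\<phi>\<^sup>-\<^sup>1\<^sup>/\<^sup>2(\<phi>\<^sup>1\<^sup>/\<^sup>2a) \<mapsto> \<xi>a\<close>.
\<close>

definition product_system ::
    "('b, 'h) std_algebra \<Rightarrow> 'h \<Rightarrow> (real \<Rightarrow> ('h, 'b \<Rightarrow> 'b) bimodule) \<Rightarrow>
     (real \<Rightarrow> real \<Rightarrow> ('h, 'h) tens \<Rightarrow> 'h) \<Rightarrow> bool" where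
  "product_system M \<Omega> H U \<longleftrightarrow>
     (\<forall>t\<ge>0. wstar_bimodule M (H t)) \<and> H 0 = L2 M \<and>
     (\<forall>s\<ge>0. \<forall>t\<ge>0. U s t \<in> unitary_op (tensor_bi M \<Omega> (H s) (H t)) (H (s + t)) \<and>
        left_linear M (tensor_bi M \<Omega> (H s) (H t)) (H (s + t)) (U s t) \<and>
        right_linear M (tensor_bi M \<Omega> (H s) (H t)) (H (s + t)) (U s t)) \<and>
     (\<forall>r\<ge>0. \<forall>s\<ge>0. \<forall>t\<ge>0.
        \<forall>\<xi>\<in>bdd_vecs M \<Omega> (H r). \<forall>\<eta>\<in>bdd_vecs M \<Omega> (H s). \<forall>\<zeta>\<in>vecs (H t).
          U r (s + t) (tensor_vec M \<Omega> (H r) (H (s + t)) \<xi> (U s t (tensor_vec M \<Omega> (H s) (H t) \<eta> \<zeta>))) =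
          U (r + s) t (tensor_vec M \<Omega> (H (r + s)) (H t) (U r s (tensor_vec M \<Omega> (H r) (H s) \<xi> \<eta>)) \<zeta>)) \<and>
     (\<forall>t\<ge>0. \<forall>a\<in>elts M. \<forall>\<eta>\<in>vecs (H t).
        U 0 t (tensor_vec M \<Omega> (H 0) (H t) (lact (L2 M) a \<Omega>) \<eta>) = lact (H t) a \<eta>) \<and>
     (\<forall>s\<ge>0. \<forall>\<xi>\<in>bdd_vecs M \<Omega> (H s). \<forall>\<zeta>\<in>vecs (L2 M).
        U s 0 (tensor_vec M \<Omega> (H s) (H 0) \<xi> \<zeta>) = pi_op M \<Omega> (H s) \<xi> \<zeta>)"

text \<open>A family indexed by \<open>t \<ge> 0\<close> is a function that is extensional on \<open>{0..}\<close>.\<close>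

definition ps_unit ::
    "('b, 'h) std_algebra \<Rightarrow> 'h \<Rightarrow> (real \<Rightarrow> ('h, 'b \<Rightarrow> 'b) bimodule) \<Rightarrow>
     (real \<Rightarrow> real \<Rightarrow> ('h, 'h) tens \<Rightarrow> 'h) \<Rightarrow> (real \<Rightarrow> 'h) \<Rightarrow> bool" where
  "ps_unit M \<Omega> H U \<Xi> \<longleftrightarrow> \<Xi> \<in> extensional {0..} \<and>
     (\<forall>t\<ge>0. \<Xi> t \<in> bdd_vecs M \<Omega> (H t)) \<and> \<Xi> 0 = \<Omega> \<and>
     (\<forall>s\<ge>0. \<forall>t\<ge>0. U s t (tensor_vec M \<Omega> (H s) (H t) (\<Xi> s) (\<Xi> t)) = \<Xi> (s + t))"

definition unital_unit ::
    "('b, 'h) std_algebra \<Rightarrow> 'h \<Rightarrow> (real \<Rightarrow> ('h, 'b \<Rightarrow> 'b) bimodule) \<Rightarrow>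
     (real \<Rightarrow> real \<Rightarrow> ('h, 'h) tens \<Rightarrow> 'h) \<Rightarrow> (real \<Rightarrow> 'h) \<Rightarrow> bool" where
  "unital_unit M \<Omega> H U \<Xi> \<longleftrightarrow> ps_unit M \<Omega> H U \<Xi> \<and>
     (\<forall>t\<ge>0. pi_prod M \<Omega> (H t) (\<Xi> t) (\<Xi> t) = op_id (L2 M))"

definition contractive_unit ::
    "('b, 'h) std_algebra \<Rightarrow> 'h \<Rightarrow> (real \<Rightarrow> ('h, 'b \<Rightarrow> 'b) bimodule) \<Rightarrow>
     (real \<Rightarrow> real \<Rightarrow> ('h, 'h) tens \<Rightarrow> 'h) \<Rightarrow> (real \<Rightarrow> 'h) \<Rightarrow> bool" where
  "contractive_unit M \<Omega> H U \<Xi> \<longleftrightarrow> ps_unit M \<Omega> H U \<Xi> \<and>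
     (\<forall>t\<ge>0. pi_prod M \<Omega> (H t) (\<Xi> t) (\<Xi> t) \<in> contraction_op (L2 M) (L2 M))"

definition spatial ::
    "('b, 'h) std_algebra \<Rightarrow> 'h \<Rightarrow> (real \<Rightarrow> ('h, 'b \<Rightarrow> 'b) bimodule) \<Rightarrow>
     (real \<Rightarrow> real \<Rightarrow> ('h, 'h) tens \<Rightarrow> 'h) \<Rightarrow> bool" where
  "spatial M \<Omega> H U \<longleftrightarrow> (\<exists>\<Xi>. ps_unit M \<Omega> H U \<Xi>)"


section \<open>Inductive limit, dilation and cocycles\<close>

definition unit_embed ::
    "('b, 'h) std_algebra \<Rightarrow> 'h \<Rightarrow> (real \<Rightarrow> ('h, 'b \<Rightarrow> 'b) bimodule) \<Rightarrow>
     (real \<Rightarrow> real \<Rightarrow> ('h, 'h) tens \<Rightarrow> 'h) \<Rightarrow> (real \<Rightarrow> 'h) \<Rightarrow> real \<Rightarrow> real \<Rightarrow> 'h \<Rightarrow> 'h" where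
  "unit_embed M \<Omega> H U \<Xi> t s =
     (\<lambda>\<xi>\<in>vecs (H s). U (t - s) s (tensor_vec M \<Omega> (H (t - s)) (H s) (\<Xi> (t - s)) \<xi>))"

text \<open>
  The inductive limit is determined up to a unique right linear unitary compatible with the \<open>\<kappa> t\<close>.
  The union of the ranges of the \<open>\<kappa> t\<close> is increasing, so no linear span is needed in the density.
\<close>

definition inductive_limit ::
    "('b, 'h) std_algebra \<Rightarrow> 'h \<Rightarrow> (real \<Rightarrow> ('h, 'b \<Rightarrow> 'b) bimodule) \<Rightarrow>
     (real \<Rightarrow> real \<Rightarrow> ('h, 'h) tens \<Rightarrow> 'h) \<Rightarrow> (real \<Rightarrow> 'h) \<Rightarrow>
     ('k, 'b \<Rightarrow> 'b) rmodule \<Rightarrow> (real \<Rightarrow> 'h \<Rightarrow> 'k) \<Rightarrow> bool" where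
  "inductive_limit M \<Omega> H U \<Xi> E \<kappa> \<longleftrightarrow> right_module M E \<and>
     (\<forall>t\<ge>0. \<kappa> t \<in> isometry_op (H t) E \<and> right_linear M (H t) E (\<kappa> t)) \<and>
     (\<forall>s t. 0 \<le> s \<and> s \<le> t \<longrightarrow>
        compose (vecs (H s)) (\<kappa> t) (unit_embed M \<Omega> H U \<Xi> t s) = \<kappa> s) \<and>
     (\<forall>v\<in>vecs E. \<forall>e>0. \<exists>t\<ge>0. \<exists>\<xi>\<in>vecs (H t). vnorm E (vdiff E v (\<kappa> t \<xi>)) < e)"

definition dilation_unitaries ::
    "('b, 'h) std_algebra \<Rightarrow> 'h \<Rightarrow> (real \<Rightarrow> ('h, 'b \<Rightarrow> 'b) bimodule) \<Rightarrow>
     (real \<Rightarrow> real \<Rightarrow> ('h, 'h) tens \<Rightarrow> 'h) \<Rightarrow>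
     ('k, 'b \<Rightarrow> 'b) rmodule \<Rightarrow> (real \<Rightarrow> 'h \<Rightarrow> 'k) \<Rightarrow> (real \<Rightarrow> ('k, 'h) tens \<Rightarrow> 'k) \<Rightarrow> bool" where
  "dilation_unitaries M \<Omega> H U E \<kappa> V \<longleftrightarrow>
     (\<forall>t\<ge>0. V t \<in> unitary_op (tensor_right M \<Omega> E (H t)) E \<and>
        right_linear M (tensor_right M \<Omega> E (H t)) E (V t) \<and>
        (\<forall>s\<ge>0. \<forall>\<xi>\<in>bdd_vecs M \<Omega> (H s). \<forall>\<eta>\<in>vecs (H t).
           V t (tensor_vec M \<Omega> E (H t) (\<kappa> s \<xi>) \<eta>) =
           \<kappa> (s + t) (U s t (tensor_vec M \<Omega> (H s) (H t) \<xi> \<eta>))))"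

definition dilation ::
    "('b, 'h) std_algebra \<Rightarrow> 'h \<Rightarrow> (real \<Rightarrow> ('h, 'b \<Rightarrow> 'b) bimodule) \<Rightarrow> ('k, 'b \<Rightarrow> 'b) rmodule \<Rightarrow>
     (real \<Rightarrow> ('k, 'h) tens \<Rightarrow> 'k) \<Rightarrow> real \<Rightarrow> ('k \<Rightarrow> 'k) \<Rightarrow> 'k \<Rightarrow> 'k" where
  "dilation M \<Omega> H E V t a =
     compose (vecs E) (V t)
       (compose (vecs E) (tensor_op M \<Omega> E (H t) a (op_id (H t)))
         (adj (tensor_right M \<Omega> E (H t)) E (V t)))"

definition continuous_unit ::
    "('b, 'h) std_algebra \<Rightarrow> 'h \<Rightarrow> (real \<Rightarrow> ('h, 'b \<Rightarrow> 'b) bimodule) \<Rightarrow> ('k, 'b \<Rightarrow> 'b) rmodule \<Rightarrow>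
     (real \<Rightarrow> ('k, 'h) tens \<Rightarrow> 'k) \<Rightarrow> (real \<Rightarrow> 'h) \<Rightarrow> bool" where
  "continuous_unit M \<Omega> H E V \<Xi> \<longleftrightarrow> (\<forall>\<xi>\<in>bdd_vecs M \<Omega> E.
     ((\<lambda>t. vnorm E (vdiff E (V t (tensor_vec M \<Omega> E (H t) \<xi> (\<Xi> t))) \<xi>)) \<longlongrightarrow> 0) (at_right 0))"

definition right_cocycle ::
    "('b, 'h) std_algebra \<Rightarrow> ('k, 'b \<Rightarrow> 'b) rmodule \<Rightarrow> (real \<Rightarrow> ('k \<Rightarrow> 'k) \<Rightarrow> 'k \<Rightarrow> 'k) \<Rightarrow>
     (real \<Rightarrow> 'k \<Rightarrow> 'k) \<Rightarrow> bool" where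
  "right_cocycle M E \<theta> w \<longleftrightarrow> w \<in> extensional {0..} \<and> (\<forall>t\<ge>0. w t \<in> End_right M E) \<and>
     (\<forall>s\<ge>0. \<forall>t\<ge>0. w (s + t) = compose (vecs E) (\<theta> t (w s)) (w t))"

definition contractive_family :: "('k, 'b \<Rightarrow> 'b) rmodule \<Rightarrow> (real \<Rightarrow> 'k \<Rightarrow> 'k) \<Rightarrow> bool" where
  "contractive_family E w \<longleftrightarrow> (\<forall>t\<ge>0. w t \<in> contraction_op E E)"

definition range_proj ::
    "(real \<Rightarrow> ('h, 'b \<Rightarrow> 'b) bimodule) \<Rightarrow> ('k, 'b \<Rightarrow> 'b) rmodule \<Rightarrow> (real \<Rightarrow> 'h \<Rightarrow> 'k) \<Rightarrow>
     real \<Rightarrow> 'k \<Rightarrow> 'k" where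
  "range_proj H E \<kappa> t = compose (vecs E) (\<kappa> t) (adj (H t) E (\<kappa> t))"

definition adapted ::
    "(real \<Rightarrow> ('h, 'b \<Rightarrow> 'b) bimodule) \<Rightarrow> ('k, 'b \<Rightarrow> 'b) rmodule \<Rightarrow> (real \<Rightarrow> 'h \<Rightarrow> 'k) \<Rightarrow>
     (real \<Rightarrow> 'k \<Rightarrow> 'k) \<Rightarrow> bool" where
  "adapted H E \<kappa> w \<longleftrightarrow> (\<forall>t\<ge>0.
     compose (vecs E) (range_proj H E \<kappa> t) (compose (vecs E) (w t) (range_proj H E \<kappa> t)) = w t)"

text \<open>
  Adaptedness and the cocycle identity only force \<open>w 0\<close> to be a projection below \<open>\<kappa>\<^sub>0\<kappa>\<^sub>0\<^sup>*\<close>; for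
  instance \<open>w = 0\<close> is a contractive adapted right cocycle.  The initial condition below is the
  counterpart of \<open>\<xi>(0) = \<phi>\<^sup>1\<^sup>/\<^sup>2\<close> for units.
\<close>

definition normalized_at_0 ::
    "(real \<Rightarrow> ('h, 'b \<Rightarrow> 'b) bimodule) \<Rightarrow> ('k, 'b \<Rightarrow> 'b) rmodule \<Rightarrow> (real \<Rightarrow> 'h \<Rightarrow> 'k) \<Rightarrow>
     (real \<Rightarrow> 'k \<Rightarrow> 'k) \<Rightarrow> bool" where
  "normalized_at_0 H E \<kappa> w \<longleftrightarrow> w 0 = range_proj H E \<kappa> 0"

end

theory Submission
  imports Defs
begin

text \<open>
  The cyclic vector \<open>\<Omega>\<close> gives \<open>\<pi>\<^sub>\<phi>(\<kappa>\<^sub>0\<Omega>) = \<kappa>\<^sub>0\<close>, so the asserted formula reads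
  \<open>w\<^sub>t = \<kappa>\<^sub>t \<pi>\<^sub>\<phi>(\<lambda>(t)) \<kappa>\<^sub>0\<^sup>*\<close>. For a cocycle it holds because adaptedness puts the range of \<open>w\<^sub>t\<close> into that of
  \<open>\<kappa>\<^sub>t\<close>, while \<open>w\<^sub>t = \<theta>\<^sub>0(w\<^sub>t)w\<^sub>0\<close>, \<open>\<theta>\<^sub>0 = id\<close> and \<open>w\<^sub>0 = \<kappa>\<^sub>0\<kappa>\<^sub>0\<^sup>*\<close> give \<open>w\<^sub>t = w\<^sub>t\<kappa>\<^sub>0\<kappa>\<^sub>0\<^sup>*\<close>. The cocycle and unit
  identities correspond through \<open>\<theta>\<^sub>t(a)\<kappa>\<^sub>t\<eta> = U\<^sub>t((a\<kappa>\<^sub>0\<Omega>)\<phi>\<^sup>-\<^sup>1\<^sup>/\<^sup>2\<eta>)\<close>, which comes from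
  \<open>\<kappa>\<^sub>t\<eta> = U\<^sub>t((\<kappa>\<^sub>0\<Omega>)\<phi>\<^sup>-\<^sup>1\<^sup>/\<^sup>2\<eta>)\<close>.

  That the relative tensor product is an inner product space and that \<open>a \<otimes> 1\<close> and \<open>1 \<otimes> b\<close> are
  bounded rests on one fact: a matrix over \<open>M\<close> that is positive on \<open>L\<^sup>2(M)\<close> is positive in every
  bounded \<open>*\<close>-representation. Schur complements reduce it to single elements, where invertibility
  of \<open>a + r\<close> in \<open>M\<close> suffices; square roots and normality are avoided.
\<close>

section \<open>Semi-inner product spaces\<close>

text \<open>Completeness of a relative tensor product is never shown for the completion itself. The
  completion is only known to be an inner product space, and completeness, which the extension of
  operators into it requires, is pulled back along the unitaries \<open>U s t\<close> and
  \<open>V t\<close>. Density of \<Omega>M in L2 is not among the axioms of a standard form. It is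
  derived from faithfulness and from the fact that bounded right linear operators on L2 are left
  multiplications. The identity \<theta>_0 = id on the range of \<open>\<kappa> 0\<close> is not
  immediate, because \<open>V 0\<close> is prescribed only on tensors with a first leg
  \<open>\<kappa> s \<xi>\<close>. Both candidates for its other values are therefore compared
  through inner products with a total set of vectors. For a unit, the cocycle identity has to be
  tested on all vectors \<Omega>a, which are dense, whereas the unit identity covers \<Omega> alone.
  Right linearity of \<open>U s t\<close> bridges this gap, and its use needs the right action on
  the tensor product to be a genuine bounded operator. Adaptedness of the resulting cocycle comes
  from \<open>\<kappa> 0\<close> = \<open>\<kappa> t\<close> b_{t,0}, which puts the range of
  \<open>\<kappa> 0\<close> inside that of \<open>\<kappa> t\<close>.\<close>

lemma null_bound:
  fixes g :: "'i \<Rightarrow> 'c::real_normed_vector"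
  assumes "(f \<longlongrightarrow> 0) F" and "\<And>n. norm (g n) \<le> f n"
  shows "(g \<longlongrightarrow> 0) F"
  using assms(2) by (intro tendsto_0_le[OF assms(1), of _ 1]) (auto intro!: always_eventually order_trans[OF assms(2)])

text \<open>The Hilbert space axioms without definiteness and completeness. This is all that is
  known of the free vector space under a relative tensor product, and positivity is transferred to
  representations on such spaces.\<close>

locale semi_inner =
  fixes V :: "('a, 'z) inner_space_scheme"
  assumes zero_closed [simp]: "vzero V \<in> vecs V"
    and plus_closed [simp]: "\<lbrakk>x \<in> vecs V; y \<in> vecs V\<rbrakk> \<Longrightarrow> vplus V x y \<in> vecs V"
    and scale_closed [simp]: "x \<in> vecs V \<Longrightarrow> vscale V c x \<in> vecs V"
    and plus_assoc: "\<lbrakk>x \<in> vecs V; y \<in> vecs V; z \<in> vecs V\<rbrakk>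
      \<Longrightarrow> vplus V (vplus V x y) z = vplus V x (vplus V y z)"
    and plus_commute: "\<lbrakk>x \<in> vecs V; y \<in> vecs V\<rbrakk> \<Longrightarrow> vplus V x y = vplus V y x"
    and plus_zero: "x \<in> vecs V \<Longrightarrow> vplus V x (vzero V) = x"
    and diff_self: "x \<in> vecs V \<Longrightarrow> vdiff V x x = vzero V"
    and scale_plus: "\<lbrakk>x \<in> vecs V; y \<in> vecs V\<rbrakk>
      \<Longrightarrow> vscale V c (vplus V x y) = vplus V (vscale V c x) (vscale V c y)"
    and plus_scale: "x \<in> vecs V \<Longrightarrow> vscale V (c + d) x = vplus V (vscale V c x) (vscale V d x)"
    and scale_scale: "x \<in> vecs V \<Longrightarrow> vscale V c (vscale V d x) = vscale V (c * d) x"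
    and scale_one: "x \<in> vecs V \<Longrightarrow> vscale V 1 x = x"
    and inner_plus: "\<lbrakk>x \<in> vecs V; y \<in> vecs V; z \<in> vecs V\<rbrakk>
      \<Longrightarrow> vinner V x (vplus V y z) = vinner V x y + vinner V x z"
    and inner_scale: "\<lbrakk>x \<in> vecs V; y \<in> vecs V\<rbrakk> \<Longrightarrow> vinner V x (vscale V c y) = c * vinner V x y"
    and inner_commute: "\<lbrakk>x \<in> vecs V; y \<in> vecs V\<rbrakk> \<Longrightarrow> vinner V y x = cnj (vinner V x y)"
    and inner_nonneg: "x \<in> vecs V \<Longrightarrow> vinner V x x \<in> \<real>\<^sub>\<ge>\<^sub>0"
begin

lemma diff_closed [simp]: "\<lbrakk>x \<in> vecs V; y \<in> vecs V\<rbrakk> \<Longrightarrow> vdiff V x y \<in> vecs V"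
  by (simp add: vdiff_def)

lemma scale_zero: "x \<in> vecs V \<Longrightarrow> vscale V 0 x = vzero V"
  using plus_scale[of x 1 "- 1"] diff_self[of x] by (simp add: vdiff_def scale_one)

lemma inner_diff: "\<lbrakk>x \<in> vecs V; y \<in> vecs V; z \<in> vecs V\<rbrakk>
    \<Longrightarrow> vinner V x (vdiff V y z) = vinner V x y - vinner V x z"
  by (simp add: vdiff_def inner_plus inner_scale)

lemma inner_zero: "x \<in> vecs V \<Longrightarrow> vinner V x (vzero V) = 0"
  using inner_diff[of x x x] by (simp add: diff_self)

lemma inner_plus_left: "\<lbrakk>x \<in> vecs V; y \<in> vecs V; z \<in> vecs V\<rbrakk>
    \<Longrightarrow> vinner V (vplus V y z) x = vinner V y x + vinner V z x"
  using inner_commute[of x "vplus V y z"] inner_commute[of x y] inner_commute[of x z]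
  by (simp add: inner_plus)

lemma inner_scale_left: "\<lbrakk>x \<in> vecs V; y \<in> vecs V\<rbrakk>
    \<Longrightarrow> vinner V (vscale V c y) x = cnj c * vinner V y x"
  using inner_commute[of x "vscale V c y"] inner_commute[of x y] by (simp add: inner_scale)

lemma inner_diff_left: "\<lbrakk>x \<in> vecs V; y \<in> vecs V; z \<in> vecs V\<rbrakk>
    \<Longrightarrow> vinner V (vdiff V y z) x = vinner V y x - vinner V z x"
  by (simp add: vdiff_def inner_plus_left inner_scale_left)

lemma inner_zero_left: "x \<in> vecs V \<Longrightarrow> vinner V (vzero V) x = 0"
  using inner_commute[of x "vzero V"] by (simp add: inner_zero)

lemmas inner_simps = inner_plus inner_scale inner_diff inner_zero
  inner_plus_left inner_scale_left inner_diff_left inner_zero_left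

lemma Re_inner_self: "x \<in> vecs V \<Longrightarrow> 0 \<le> Re (vinner V x x)"
  using inner_nonneg[of x] by (auto simp: nonneg_Reals_def)

lemma norm_nonneg [simp]: "x \<in> vecs V \<Longrightarrow> 0 \<le> vnorm V x"
  by (simp add: vnorm_def Re_inner_self)

lemma norm_sq: "x \<in> vecs V \<Longrightarrow> (vnorm V x)\<^sup>2 = Re (vinner V x x)"
  by (simp add: vnorm_def Re_inner_self)

lemma inner_self: "x \<in> vecs V \<Longrightarrow> vinner V x x = of_real ((vnorm V x)\<^sup>2)"
  using inner_nonneg[of x] by (auto simp: norm_sq nonneg_Reals_def)

lemma norm_zero [simp]: "vnorm V (vzero V) = 0"
  by (simp add: vnorm_def inner_zero)

lemma norm_scale: "x \<in> vecs V \<Longrightarrow> vnorm V (vscale V c x) = cmod c * vnorm V x"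
proof -
  assume x: "x \<in> vecs V"
  have "vinner V (vscale V c x) (vscale V c x) = of_real ((cmod c * vnorm V x)\<^sup>2)"
    using x complex_norm_square[of c] inner_self[OF x]
    by (simp add: inner_simps power_mult_distrib algebra_simps)
  then show ?thesis
    using x by (simp add: vnorm_def Re_inner_self del: of_real_power of_real_mult)
qed

text \<open>With p = \<langle>x, y\<rangle>, the vector t x - s conj(p) y has nonnegative square
  norm for all real s and t, which is a real polynomial inequality in r = |p|^2. In the absence of
  definiteness, a null vector y needs its own choice of s.\<close>

lemma cauchy_schwarz:
  assumes x: "x \<in> vecs V" and y: "y \<in> vecs V"
  shows "cmod (vinner V x y) \<le> vnorm V x * vnorm V y"
proof -
  define p where "p = vinner V x y"
  have p': "vinner V y x = cnj p"
    using inner_commute[OF x y] by (simp add: p_def)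
  have pp: "p * cnj p = of_real ((cmod p)\<^sup>2)"
    using complex_norm_square[of p] by simp
  define r where "r = (cmod p)\<^sup>2"
  define X where "X = (vnorm V x)\<^sup>2"
  define N where "N = (vnorm V y)\<^sup>2"
  have key: "0 \<le> t\<^sup>2 * X - 2 * t * s * r + s\<^sup>2 * r * N" for t s :: real
  proof -
    define z where "z = vdiff V (vscale V (of_real t) x) (vscale V (of_real s * cnj p) y)"
    have "vinner V z z = of_real (t\<^sup>2 * X) - of_real t * of_real s * (p * cnj p)
        - of_real t * of_real s * (p * cnj p) + of_real (s\<^sup>2) * (p * cnj p) * of_real N"
      using x y
      by (simp add: z_def inner_simps inner_self[OF x] inner_self[OF y] p' p_def[symmetric] X_def N_def algebra_simps
          power2_eq_square)
    also have "\<dots> = of_real (t\<^sup>2 * X - 2 * t * s * r + s\<^sup>2 * r * N)"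
      by (simp add: pp r_def)
    finally show ?thesis
      using Re_inner_self[of z] x y by (simp add: z_def)
  qed
  have X0: "X \<ge> 0" and N0: "N \<ge> 0" and r0: "r \<ge> 0"
    by (auto simp: X_def N_def r_def)
  have "r \<le> X * N"
  proof (cases "N = 0")
    case True
    show ?thesis
    proof (cases "r = 0")
      case False
      \<comment> \<open>For N = 0 the polynomial at t = 1 is X - 2 s r, and s = (X + 1) / r makes it
        equal to -X - 2.\<close>
      have "0 \<le> X - 2 * ((X + 1) / r) * r"
        using key[of 1 "(X + 1) / r"] True by simp
      then show ?thesis
        using False X0 by simp
    qed (use X0 N0 in simp)
  next
    case False
    have "0 \<le> N * (N * X - r)"
      using key[of N 1] by (simp add: algebra_simps power2_eq_square)
    then show ?thesis
      using False N0 by (simp add: zero_le_mult_iff mult.commute)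
  qed
  then have "(cmod p)\<^sup>2 \<le> (vnorm V x * vnorm V y)\<^sup>2"
    by (simp add: r_def X_def N_def power_mult_distrib)
  then show ?thesis
    using x y by (simp add: p_def power2_le_iff_abs_le)
qed

lemma norm_triangle:
  assumes x: "x \<in> vecs V" and y: "y \<in> vecs V"
  shows "vnorm V (vplus V x y) \<le> vnorm V x + vnorm V y"
proof -
  have "Re (vinner V x y) \<le> vnorm V x * vnorm V y"
    using cauchy_schwarz[OF x y] complex_Re_le_cmod order_trans by blast
  moreover have "Re (vinner V y x) = Re (vinner V x y)"
    using inner_commute[OF x y] by simp
  ultimately have "(vnorm V (vplus V x y))\<^sup>2 \<le> (vnorm V x + vnorm V y)\<^sup>2"
    using x y by (simp add: norm_sq inner_simps power2_sum)
  then show ?thesis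
    using x y by (simp add: power2_le_iff_abs_le)
qed

text \<open>Only the norms of x - z and (x - y) + (y - z) are compared, by expanding inner products.
  This spares identities between vectors whose operations are fields of a record.\<close>

lemma norm_diff_triangle:
  assumes "x \<in> vecs V" "y \<in> vecs V" "z \<in> vecs V"
  shows "vnorm V (vdiff V x z) \<le> vnorm V (vdiff V x y) + vnorm V (vdiff V y z)"
proof -
  have "vnorm V (vdiff V x z) = vnorm V (vplus V (vdiff V x y) (vdiff V y z))"
    using assms by (simp add: vnorm_def inner_simps)
  then show ?thesis
    using norm_triangle[of "vdiff V x y" "vdiff V y z"] assms by simp
qed

lemma norm_diff_commute:
  assumes "x \<in> vecs V" "y \<in> vecs V"
  shows "vnorm V (vdiff V x y) = vnorm V (vdiff V y x)"
  using assms by (simp add: vnorm_def inner_simps)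

lemma norm_diff_self [simp]: "x \<in> vecs V \<Longrightarrow> vnorm V (vdiff V x x) = 0"
  by (simp add: diff_self)

lemma norm_diff_norm:
  assumes x: "x \<in> vecs V" and y: "y \<in> vecs V"
  shows "\<bar>vnorm V x - vnorm V y\<bar> \<le> vnorm V (vdiff V x y)"
proof -
  have *: "vnorm V a \<le> vnorm V (vdiff V a b) + vnorm V b" if "a \<in> vecs V" "b \<in> vecs V" for a b
  proof -
    have "vnorm V a = vnorm V (vplus V (vdiff V a b) b)"
      using that by (simp add: vnorm_def inner_simps)
    then show ?thesis
      using norm_triangle[of "vdiff V a b" b] that by simp
  qed
  show ?thesis
    using *[OF x y] *[OF y x] norm_diff_commute[OF x y] by linarith
qed

lemma norm_diff_plus:
  assumes "x \<in> vecs V" "y \<in> vecs V" "x' \<in> vecs V" "y' \<in> vecs V"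
  shows "vnorm V (vdiff V (vplus V x y) (vplus V x' y')) \<le> vnorm V (vdiff V x x') + vnorm V (vdiff V y y')"
proof -
  have "vnorm V (vdiff V (vplus V x y) (vplus V x' y')) = vnorm V (vplus V (vdiff V x x') (vdiff V y y'))"
    using assms by (simp add: vnorm_def inner_simps algebra_simps)
  then show ?thesis
    using norm_triangle[of "vdiff V x x'" "vdiff V y y'"] assms by simp
qed

lemma norm_diff_scale:
  assumes "x \<in> vecs V" "y \<in> vecs V"
  shows "vnorm V (vdiff V (vscale V c x) (vscale V c y)) = cmod c * vnorm V (vdiff V x y)"
proof -
  have "vnorm V (vdiff V (vscale V c x) (vscale V c y)) = vnorm V (vscale V c (vdiff V x y))"
    using assms by (simp add: vnorm_def inner_simps algebra_simps)
  then show ?thesis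
    using assms by (simp add: norm_scale)
qed

text \<open>The bound by a sum g m + g n is the form in which terms approximating a common object
  within g arise, both for minimising sequences and for approximations of a vector by a dense
  set.\<close>

lemma cauchyI:
  assumes "\<And>n. X n \<in> vecs V" and "g \<longlonglongrightarrow> 0"
    and "\<And>m n. vnorm V (vdiff V (X m) (X n)) \<le> g m + g n"
  shows "vcauchy V X"
  unfolding vcauchy_def
proof (intro conjI allI impI)
  fix e :: real assume "e > 0"
  then obtain N where N: "\<And>n. n \<ge> N \<Longrightarrow> \<bar>g n\<bar> < e / 2"
    using LIMSEQ_D[OF assms(2), of "e / 2"] by auto
  have "vnorm V (vdiff V (X m) (X n)) < e" if "m \<ge> N" "n \<ge> N" for m n
    using assms(3)[of m n] N[OF that(1)] N[OF that(2)] by linarith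
  then show "\<exists>N. \<forall>m\<ge>N. \<forall>n\<ge>N. vnorm V (vdiff V (X m) (X n)) < e"
    by blast
qed (use assms in auto)

lemma norm_tendsto:
  assumes X: "\<And>n. X n \<in> vecs V" and x: "x \<in> vecs V" and l: "(\<lambda>n. vnorm V (vdiff V (X n) x)) \<longlonglongrightarrow> 0"
  shows "(\<lambda>n. vnorm V (X n)) \<longlonglongrightarrow> vnorm V x"
proof -
  have "(\<lambda>n. vnorm V (X n) - vnorm V x) \<longlonglongrightarrow> 0"
    by (rule null_bound[OF l]) (use norm_diff_norm[OF X x] in simp)
  then show ?thesis
    by (simp add: LIM_zero_iff)
qed

end

locale inner_prod = semi_inner V for V :: "('a, 'z) inner_space_scheme" +
  assumes inner_definite: "\<lbrakk>x \<in> vecs V; vinner V x x = 0\<rbrakk> \<Longrightarrow> x = vzero V"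
begin

lemma diff_zero_imp_eq:
  assumes x: "x \<in> vecs V" and y: "y \<in> vecs V" and "vdiff V x y = vzero V"
  shows "x = y"
proof -
  have "y = vplus V y (vdiff V x y)"
    using assms by (simp add: plus_zero)
  also have "\<dots> = vplus V (vplus V x (vscale V (- 1) y)) y"
    using x y by (simp add: vdiff_def plus_commute)
  also have "\<dots> = vplus V x (vdiff V y y)"
    using x y plus_assoc[of x "vscale V (- 1) y" y] plus_commute[of "vscale V (- 1) y" y]
    by (simp add: vdiff_def)
  also have "\<dots> = x"
    using x y by (simp add: diff_self plus_zero)
  finally show ?thesis ..
qed

lemma norm_diff_eq_0:
  assumes "x \<in> vecs V" "y \<in> vecs V" "vnorm V (vdiff V x y) = 0"
  shows "x = y"
  using assms(3) inner_self[OF diff_closed[OF assms(1,2)]]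
  by (intro diff_zero_imp_eq[OF assms(1,2)] inner_definite diff_closed assms(1,2)) simp

lemma vec_eqI:
  assumes x: "x \<in> vecs V" and y: "y \<in> vecs V" and "\<And>z. z \<in> vecs V \<Longrightarrow> vinner V z x = vinner V z y"
  shows "x = y"
  using assms(3) by (intro diff_zero_imp_eq[OF x y] inner_definite) (simp_all add: inner_diff x y)

lemma norm_le_0_imp: "\<lbrakk>x \<in> vecs V; vnorm V x \<le> 0\<rbrakk> \<Longrightarrow> x = vzero V"
  using inner_self[of x] norm_nonneg[of x] antisym by (intro inner_definite) force+

end

lemma hilbert_space_iff:
  "hilbert_space V \<longleftrightarrow> inner_prod V \<and>
    (\<forall>X. vcauchy V X \<longrightarrow> (\<exists>x\<in>vecs V. (\<lambda>n. vnorm V (vdiff V (X n) x)) \<longlonglongrightarrow> 0))"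
  unfolding inner_prod_def inner_prod_axioms_def semi_inner_def hilbert_space_def
  by (intro iffI; elim conjE; intro conjI; assumption)

sublocale hilbert_space \<subseteq> inner_prod V
  using hilbert_space_axioms by (simp add: hilbert_space_iff)

section \<open>Operators between Hilbert spaces\<close>

lemma le_zero_by_epsilon:
  fixes r K :: real
  assumes "\<And>e. e > 0 \<Longrightarrow> r \<le> K * e"
  shows "r \<le> 0"
proof (rule ccontr)
  assume r: "\<not> r \<le> 0"
  \<comment> \<open>This e makes K e at most r / 2; the summand 1 covers K = 0, and the absolute
    value covers negative K.\<close>
  have "r \<le> K * (r / (2 * (\<bar>K\<bar> + 1)))"
    using r by (intro assms) auto
  also have "\<dots> \<le> (\<bar>K\<bar> + 1) * (r / (2 * (\<bar>K\<bar> + 1)))"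
    using r by (intro mult_right_mono) auto
  also have "\<dots> = r / 2"
    by (simp add: field_simps)
  finally show False
    using r by simp
qed

lemma linear_opI:
  assumes "\<And>x. x \<notin> vecs V \<Longrightarrow> T x = undefined" and "\<And>x. x \<in> vecs V \<Longrightarrow> T x \<in> vecs W"
    and "\<And>x y. \<lbrakk>x \<in> vecs V; y \<in> vecs V\<rbrakk> \<Longrightarrow> T (vplus V x y) = vplus W (T x) (T y)"
    and "\<And>c x. x \<in> vecs V \<Longrightarrow> T (vscale V c x) = vscale W c (T x)"
  shows "T \<in> linear_op V W"
  using assms by (auto simp: linear_op_def PiE_def extensional_def)

lemma linear_opD:
  assumes "T \<in> linear_op V W"
  shows "x \<in> vecs V \<Longrightarrow> T x \<in> vecs W"
    and "\<lbrakk>x \<in> vecs V; y \<in> vecs V\<rbrakk> \<Longrightarrow> T (vplus V x y) = vplus W (T x) (T y)"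
    and "x \<in> vecs V \<Longrightarrow> T (vscale V c x) = vscale W c (T x)"
    and "x \<notin> vecs V \<Longrightarrow> T x = undefined"
  using assms by (auto simp: linear_op_def PiE_def extensional_def)

lemma bounded_op_linear: "T \<in> bounded_op V W \<Longrightarrow> T \<in> linear_op V W"
  by (simp add: bounded_op_def)

lemmas bounded_opD = linear_opD[OF bounded_op_linear]

lemma linear_op_diff:
  assumes "T \<in> linear_op V W" "semi_inner V" "x \<in> vecs V" "y \<in> vecs V"
  shows "T (vdiff V x y) = vdiff W (T x) (T y)"
  using assms(3,4) by (simp add: vdiff_def linear_opD[OF assms(1)] semi_inner.scale_closed[OF assms(2)])

lemma linear_op_ext:
  assumes "S \<in> linear_op V W" "T \<in> linear_op V W" "\<And>x. x \<in> vecs V \<Longrightarrow> S x = T x"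
  shows "S = T"
  using assms by (intro PiE_ext[of S "vecs V" "\<lambda>_. vecs W" T]) (auto simp: linear_op_def)

lemma bounded_opE:
  assumes T: "T \<in> bounded_op V W" and "semi_inner V" and "semi_inner W"
  obtains c where "c > 0" and "\<And>x. x \<in> vecs V \<Longrightarrow> vnorm W (T x) \<le> c * vnorm V x"
proof -
  interpret V: semi_inner V by fact
  obtain c where c: "\<And>x. x \<in> vecs V \<Longrightarrow> vnorm W (T x) \<le> c * vnorm V x"
    using T by (auto simp: bounded_op_def)
  have "vnorm W (T x) \<le> (\<bar>c\<bar> + 1) * vnorm V x" if x: "x \<in> vecs V" for x
    using c[OF x] mult_right_mono[of c "\<bar>c\<bar> + 1" "vnorm V x"] V.norm_nonneg[OF x] by linarith
  then show thesis
    using that[of "\<bar>c\<bar> + 1"] by simp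
qed

lemma contraction_bounded: "T \<in> contraction_op V W \<Longrightarrow> T \<in> bounded_op V W"
  unfolding contraction_op_def bounded_op_def by (auto intro!: exI[of _ 1])

lemma isometry_norm: "\<lbrakk>T \<in> isometry_op V W; x \<in> vecs V\<rbrakk> \<Longrightarrow> vnorm W (T x) = vnorm V x"
  by (simp add: isometry_op_def vnorm_def)

lemma isometry_contraction: "T \<in> isometry_op V W \<Longrightarrow> T \<in> contraction_op V W"
  using isometry_norm[of T V W] by (auto simp: isometry_op_def contraction_op_def)

lemma isometry_bounded: "T \<in> isometry_op V W \<Longrightarrow> T \<in> bounded_op V W"
  by (intro contraction_bounded isometry_contraction)

lemma isometry_inner: "\<lbrakk>T \<in> isometry_op V W; x \<in> vecs V; y \<in> vecs V\<rbrakk> \<Longrightarrow> vinner W (T x) (T y) = vinner V x y"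
  by (simp add: isometry_op_def)

lemma compose_linear:
  assumes S: "S \<in> linear_op V W" and T: "T \<in> linear_op U V" and "semi_inner U"
  shows "compose (vecs U) S T \<in> linear_op U W"
proof -
  interpret U: semi_inner U by fact
  show ?thesis
    by (rule linear_opI) (simp_all add: compose_def linear_opD[OF S] linear_opD[OF T])
qed

lemma compose_bounded:
  assumes S: "S \<in> bounded_op V W" and T: "T \<in> bounded_op U V"
    and "semi_inner U" "semi_inner V" "semi_inner W"
  shows "compose (vecs U) S T \<in> bounded_op U W"
proof -
  interpret U: semi_inner U by fact
  obtain c where c: "c > 0" "\<And>x. x \<in> vecs V \<Longrightarrow> vnorm W (S x) \<le> c * vnorm V x"
    using bounded_opE[OF S] assms by blast
  obtain d where d: "d > 0" "\<And>x. x \<in> vecs U \<Longrightarrow> vnorm V (T x) \<le> d * vnorm U x"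
    using bounded_opE[OF T] assms by blast
  have "compose (vecs U) S T \<in> linear_op U W"
    using assms by (intro compose_linear bounded_op_linear)
  moreover have "vnorm W (compose (vecs U) S T x) \<le> (c * d) * vnorm U x" if x: "x \<in> vecs U" for x
  proof -
    have "vnorm W (S (T x)) \<le> c * vnorm V (T x)"
      using x by (intro c bounded_opD[OF T])
    also have "\<dots> \<le> c * (d * vnorm U x)"
      using c d x by (intro mult_left_mono) auto
    finally show ?thesis
      using x by (simp add: compose_def mult.assoc)
  qed
  ultimately show ?thesis
    by (auto simp: bounded_op_def)
qed

section \<open>The Riesz representation theorem by minimisation\<close>

context hilbert_space
begin

text \<open>If x represents f, then |z|^2 - 2 Re (f z) = |z - x|^2 - |x|^2, so x is the minimiser of
  this functional. Conversely, a minimising sequence converges by the parallelogram law and its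
  limit represents f.\<close>

lemma riesz:
  assumes add: "\<And>x y. \<lbrakk>x \<in> vecs V; y \<in> vecs V\<rbrakk> \<Longrightarrow> f (vplus V x y) = f x + f y"
    and scale: "\<And>c x. x \<in> vecs V \<Longrightarrow> f (vscale V c x) = c * f x"
    and bound: "\<And>x. x \<in> vecs V \<Longrightarrow> cmod (f x) \<le> C * vnorm V x"
  obtains x where "x \<in> vecs V" and "\<And>z. z \<in> vecs V \<Longrightarrow> vinner V x z = f z"
proof -
  define J where "J z = (vnorm V z)\<^sup>2 - 2 * Re (f z)" for z
  have J_lower: "- C\<^sup>2 \<le> J z" if z: "z \<in> vecs V" for z
  proof -
    have "0 \<le> (vnorm V z - C)\<^sup>2"
      by simp
    moreover have "Re (f z) \<le> C * vnorm V z"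
      using bound[OF z] complex_Re_le_cmod[of "f z"] by linarith
    ultimately show ?thesis
      by (simp add: J_def power2_diff algebra_simps)
  qed
  define d where "d = Inf (J ` vecs V)"
  have bdd: "bdd_below (J ` vecs V)"
    using J_lower by (intro bdd_belowI[of _ "- C\<^sup>2"]) auto
  have d_le: "d \<le> J z" if "z \<in> vecs V" for z
    unfolding d_def using that bdd by (intro cInf_lower) auto
  have "\<exists>z\<in>vecs V. J z < d + 1 / real (Suc n)" for n
  proof -
    have "J ` vecs V \<noteq> {}"
      using zero_closed by blast
    then show ?thesis
      using cInf_lessD[of "J ` vecs V" "d + 1 / real (Suc n)"] unfolding d_def by auto
  qed
  then obtain Z where Z: "\<And>n. Z n \<in> vecs V" and JZ: "\<And>n. J (Z n) < d + 1 / real (Suc n)"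
    by metis
  \<comment> \<open>The midpoint of x and y has \<open>J\<close> at least d, so the parallelogram
    identity bounds the distance of x and y by the excess of \<open>J x\<close> and
    \<open>J y\<close> over d.\<close>
  have parallelogram: "(vnorm V (vdiff V x y))\<^sup>2 \<le> 2 * J x + 2 * J y - 4 * d"
    if x: "x \<in> vecs V" and y: "y \<in> vecs V" for x y
  proof -
    let ?m = "vscale V (1 / 2) (vplus V x y)"
    have "4 * (vnorm V ?m)\<^sup>2 = 2 * (vnorm V x)\<^sup>2 + 2 * (vnorm V y)\<^sup>2 - (vnorm V (vdiff V x y))\<^sup>2"
      using x y by (simp add: norm_sq inner_simps) (simp add: field_simps)
    then have "4 * J ?m = 2 * J x + 2 * J y - (vnorm V (vdiff V x y))\<^sup>2"
      using x y by (simp add: J_def add scale) (simp add: field_simps)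
    then show ?thesis
      using d_le[of ?m] x y by simp
  qed
  have "vcauchy V Z"
  proof (rule cauchyI[OF Z])
    show "(\<lambda>n. sqrt (2 * (1 / real (Suc n)))) \<longlonglongrightarrow> 0"
      using tendsto_real_sqrt[OF tendsto_mult_right_zero[OF LIMSEQ_inverse_real_of_nat, of 2]]
      by (simp add: field_simps)
    fix m n
    have "(vnorm V (vdiff V (Z m) (Z n)))\<^sup>2 \<le> 2 * (1 / real (Suc m)) + 2 * (1 / real (Suc n))"
      using parallelogram[OF Z Z, of m n] JZ[of m] JZ[of n] by linarith
    then have "vnorm V (vdiff V (Z m) (Z n)) \<le> sqrt (2 * (1 / real (Suc m)) + 2 * (1 / real (Suc n)))"
      by (rule real_le_rsqrt)
    also have "\<dots> \<le> sqrt (2 * (1 / real (Suc m))) + sqrt (2 * (1 / real (Suc n)))"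
      by (intro sqrt_add_le_add_sqrt) auto
    finally show "vnorm V (vdiff V (Z m) (Z n)) \<le> \<dots>" .
  qed
  then obtain x where x: "x \<in> vecs V" and lim: "(\<lambda>n. vnorm V (vdiff V (Z n) x)) \<longlonglongrightarrow> 0"
    using complete by blast
  have f_diff: "f (vdiff V y z) = f y - f z" if "y \<in> vecs V" "z \<in> vecs V" for y z
    using that by (simp add: vdiff_def add scale)
  have "(\<lambda>n. f (Z n) - f x) \<longlonglongrightarrow> 0"
    using bound[OF diff_closed[OF Z x]]
    by (intro null_bound[OF tendsto_mult_right_zero[OF lim, of C]]) (simp add: f_diff Z x)
  then have "(\<lambda>n. J (Z n)) \<longlonglongrightarrow> J x"
    unfolding J_def by (intro tendsto_intros norm_tendsto[OF Z x lim]) (simp add: LIM_zero_iff)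
  moreover have "(\<lambda>n. d + 1 / real (Suc n)) \<longlonglongrightarrow> d"
    using tendsto_add[OF tendsto_const LIMSEQ_inverse_real_of_nat, of d] by (simp add: inverse_eq_divide)
  ultimately have Jx: "J x \<le> d"
    using JZ by (intro LIMSEQ_le) (auto intro: less_imp_le)
  show thesis
  proof (rule that[OF x])
    fix z assume z: "z \<in> vecs V"
    define g where "g = vinner V x z - f z"
    define N where "N = (vnorm V z)\<^sup>2"
    \<comment> \<open>The minimiser x is moved by -s conj(g) z. The linear part of \<open>J\<close>
      drops by 2 s |g|^2, and s N \<le> 1 keeps the quadratic part at most s |g|^2, so minimality
      forces g = 0.\<close>
    define s where "s = 1 / (N + 1)"
    have N: "N \<ge> 0"
      by (simp add: N_def)
    let ?c = "- (of_real s * cnj g)"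
    let ?y = "vplus V x (vscale V ?c z)"
    have gg: "g * cnj g = of_real ((cmod g)\<^sup>2)"
      using complex_norm_square[of g] by simp
    have "(vnorm V ?y)\<^sup>2 = (vnorm V x)\<^sup>2 + 2 * Re (?c * vinner V x z) + Re (cnj ?c * ?c) * N"
      using x z inner_commute[OF x z] inner_self[OF z]
      by (simp add: norm_sq inner_simps N_def) (simp add: algebra_simps)
    moreover have "Re (f ?y) = Re (f x) + Re (?c * f z)"
      using x z by (simp only: add scale scale_closed plus_complex.sel)
    ultimately have "J ?y = J x + 2 * Re (?c * g) + Re (cnj ?c * ?c) * N"
      unfolding J_def g_def by (simp add: algebra_simps)
    also have "?c * g = of_real (- s * (cmod g)\<^sup>2)"
      using gg by (simp add: mult.assoc mult.commute[of g])
    also have "cnj ?c * ?c = of_real (s\<^sup>2 * (cmod g)\<^sup>2)"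
      using gg by (simp add: power2_eq_square algebra_simps)
    finally have "J ?y = J x - 2 * s * (cmod g)\<^sup>2 + s\<^sup>2 * (cmod g)\<^sup>2 * N"
      by simp
    moreover have "J x \<le> J ?y"
      using Jx d_le[of ?y] x z by simp
    ultimately have "2 * s * (cmod g)\<^sup>2 \<le> s * (cmod g)\<^sup>2 * (s * N)"
      by (simp add: power2_eq_square algebra_simps)
    also have "\<dots> \<le> s * (cmod g)\<^sup>2 * 1"
      using N by (intro mult_left_mono) (auto simp: s_def)
    finally have "s * (cmod g)\<^sup>2 \<le> 0"
      by simp
    then have "g = 0"
      using N by (auto simp: s_def mult_le_0_iff divide_le_0_iff)
    then show "vinner V x z = f z"
      by (simp add: g_def)
  qed
qed

end

section \<open>Closed subspaces, orthogonal projection and extension by density\<close>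

definition vclosure :: "('a, 'z) inner_space_scheme \<Rightarrow> 'a set \<Rightarrow> 'a set" where
  "vclosure V D = {x \<in> vecs V. \<forall>e>0. \<exists>d\<in>D. vnorm V (vdiff V x d) < e}"

definition vsubspace :: "('a, 'z) inner_space_scheme \<Rightarrow> 'a set \<Rightarrow> bool" where
  "vsubspace V D \<longleftrightarrow> D \<subseteq> vecs V \<and> vzero V \<in> D \<and>
     (\<forall>x\<in>D. \<forall>y\<in>D. vplus V x y \<in> D) \<and> (\<forall>c. \<forall>x\<in>D. vscale V c x \<in> D)"

lemma (in semi_inner) subset_vclosure: "D \<subseteq> vecs V \<Longrightarrow> D \<subseteq> vclosure V D"
proof
  fix x assume "D \<subseteq> vecs V" "x \<in> D"
  then show "x \<in> vclosure V D"
    using norm_diff_self[of x] unfolding vclosure_def by (auto intro!: bexI[of _ x])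
qed

context hilbert_space
begin

text \<open>A closed subspace is the same record with a smaller carrier. In this form it is again a
  Hilbert space to which \<open>riesz\<close> applies.\<close>

lemma hilbert_vclosure:
  assumes D: "vsubspace V D"
  shows "hilbert_space (V\<lparr>vecs := vclosure V D\<rparr>)"
proof -
  have sub: "D \<subseteq> vecs V" and zero: "vzero V \<in> D"
    and plus: "\<And>x y. \<lbrakk>x \<in> D; y \<in> D\<rbrakk> \<Longrightarrow> vplus V x y \<in> D" and scale: "\<And>c x. x \<in> D \<Longrightarrow> vscale V c x \<in> D"
    using D by (auto simp: vsubspace_def)
  have cl: "x \<in> vecs V" if "x \<in> vclosure V D" for x
    using that by (simp add: vclosure_def)
  have z: "vzero V \<in> vclosure V D"
    using zero subset_vclosure[OF sub] by blast
  have p: "vplus V x y \<in> vclosure V D" if xy: "x \<in> vclosure V D" "y \<in> vclosure V D" for x y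
    unfolding vclosure_def
  proof (intro CollectI conjI allI impI)
    fix e :: real assume "e > 0"
    then have e: "e / 2 > 0"
      by simp
    obtain a where a: "a \<in> D" "vnorm V (vdiff V x a) < e / 2"
      using xy(1) e unfolding vclosure_def by blast
    obtain b where b: "b \<in> D" "vnorm V (vdiff V y b) < e / 2"
      using xy(2) e unfolding vclosure_def by blast
    note ab = a b
    have "vnorm V (vdiff V (vplus V x y) (vplus V a b)) < e"
      using norm_diff_plus[of x y a b] cl[OF xy(1)] cl[OF xy(2)] subsetD[OF sub a(1)] subsetD[OF sub b(1)] ab
      by simp
    then show "\<exists>d\<in>D. vnorm V (vdiff V (vplus V x y) d) < e"
      using plus ab by blast
  qed (use cl xy in simp)
  have s: "vscale V c x \<in> vclosure V D" if x: "x \<in> vclosure V D" for c x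
    unfolding vclosure_def
  proof (intro CollectI conjI allI impI)
    fix e :: real assume e: "e > 0"
    then have "e / (cmod c + 1) > 0"
      by (simp add: add_nonneg_pos)
    then obtain a where a: "a \<in> D" "vnorm V (vdiff V x a) < e / (cmod c + 1)"
      using x unfolding vclosure_def by blast
    have "cmod c * vnorm V (vdiff V x a) \<le> cmod c * (e / (cmod c + 1))"
      using a by (intro mult_left_mono) auto
    also have "\<dots> < e"
      using e by (simp add: field_simps add_pos_nonneg)
    finally have "vnorm V (vdiff V (vscale V c x) (vscale V c a)) < e"
      using cl[OF x] a sub by (simp add: norm_diff_scale subsetD)
    then show "\<exists>d\<in>D. vnorm V (vdiff V (vscale V c x) d) < e"
      using scale a by blast
  qed (use cl x in simp)
  have d: "vdiff (V\<lparr>vecs := S\<rparr>) x y = vdiff V x y" and n: "vnorm (V\<lparr>vecs := S\<rparr>) x = vnorm V x" for S x y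
    by (simp_all add: vdiff_def vnorm_def)
  show ?thesis
    unfolding hilbert_space_iff
  proof (intro conjI allI impI)
    show "inner_prod (V\<lparr>vecs := vclosure V D\<rparr>)"
      by (unfold_locales;
          (simp add: z p s d cl plus_assoc plus_zero diff_self scale_plus plus_scale
            scale_scale scale_one inner_plus inner_scale inner_nonneg inner_definite; fail)?;
          simp; (rule plus_commute inner_commute; simp add: cl))
  next
    fix X assume X: "vcauchy (V\<lparr>vecs := vclosure V D\<rparr>) X"
    then have Xc: "X n \<in> vclosure V D" for n
      by (simp add: vcauchy_def)
    have "vcauchy V X"
      using X by (auto simp: vcauchy_def d n cl)
    then obtain x where x: "x \<in> vecs V" and lim: "(\<lambda>n. vnorm V (vdiff V (X n) x)) \<longlonglongrightarrow> 0"
      using complete by blast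
    have "x \<in> vclosure V D"
      unfolding vclosure_def
    proof (intro CollectI conjI allI impI x)
      fix e :: real assume e: "e > 0"
      then have e2: "e / 2 > 0"
        by simp
      obtain m where "norm (vnorm V (vdiff V (X m) x) - 0) < e / 2"
        using LIMSEQ_D[OF lim e2] by blast
      then have m: "vnorm V (vdiff V (X m) x) < e / 2"
        by simp
      obtain a where a: "a \<in> D" "vnorm V (vdiff V (X m) a) < e / 2"
        using Xc[of m] e2 unfolding vclosure_def by blast
      have "vnorm V (vdiff V x a) < e"
        using norm_diff_triangle[of x "X m" a] norm_diff_commute[of x "X m"] m a x cl[OF Xc[of m]]
          subsetD[OF sub a(1)] by simp
      then show "\<exists>d\<in>D. vnorm V (vdiff V x d) < e"
        using a by blast
    qed
    then show "\<exists>x\<in>vecs (V\<lparr>vecs := vclosure V D\<rparr>).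
        (\<lambda>n. vnorm (V\<lparr>vecs := vclosure V D\<rparr>) (vdiff (V\<lparr>vecs := vclosure V D\<rparr>) (X n) x)) \<longlonglongrightarrow> 0"
      using lim by (auto simp: d n)
  qed
qed

text \<open>The projection of v is the Riesz vector, inside the closure, of the functional
  \<langle>v, _\<rangle> restricted to the closure.\<close>

lemma projection:
  assumes D: "vsubspace V D" and v: "v \<in> vecs V"
  obtains p where "p \<in> vclosure V D" and "\<And>z. z \<in> vclosure V D \<Longrightarrow> vinner V p z = vinner V v z"
proof -
  let ?W = "V\<lparr>vecs := vclosure V D\<rparr>"
  interpret W: hilbert_space ?W
    by (rule hilbert_vclosure[OF D])
  have cl: "x \<in> vecs V" if "x \<in> vclosure V D" for x
    using that by (simp add: vclosure_def)
  have "cmod (vinner V v x) \<le> vnorm V v * vnorm ?W x" if "x \<in> vecs ?W" for x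
    using cauchy_schwarz[OF v, of x] cl that by (simp add: vnorm_def)
  then show thesis
    using W.riesz[of "vinner V v" "vnorm V v"] that v cl by (auto simp: inner_simps)
qed

end

lemma dense_bounded_ext:
  assumes S: "S \<in> bounded_op V W" and T: "T \<in> bounded_op V W" and "semi_inner V" and "inner_prod W"
    and D: "D \<subseteq> vecs V" and dense: "vecs V \<subseteq> vclosure V D" and eq: "\<And>x. x \<in> D \<Longrightarrow> S x = T x"
  shows "S = T"
proof (rule linear_op_ext[OF bounded_op_linear[OF S] bounded_op_linear[OF T]])
  interpret V: semi_inner V by fact
  interpret W: inner_prod W by fact
  obtain c where c: "c > 0" "\<And>x. x \<in> vecs V \<Longrightarrow> vnorm W (S x) \<le> c * vnorm V x"
    using bounded_opE[OF S V.semi_inner_axioms W.semi_inner_axioms] by blast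
  obtain c' where c': "c' > 0" "\<And>x. x \<in> vecs V \<Longrightarrow> vnorm W (T x) \<le> c' * vnorm V x"
    using bounded_opE[OF T V.semi_inner_axioms W.semi_inner_axioms] by blast
  fix x assume x: "x \<in> vecs V"
  note [simp] = bounded_opD(1)[OF S] bounded_opD(1)[OF T]
  have "vnorm W (vdiff W (S x) (T x)) \<le> (c + c') * e" if "e > 0" for e
  proof -
    obtain a where a: "a \<in> D" "vnorm V (vdiff V x a) < e"
      using dense x \<open>e > 0\<close> unfolding vclosure_def by blast
    then have [simp]: "a \<in> vecs V"
      using D by blast
    have "vnorm W (vdiff W (S x) (T x)) \<le> vnorm W (vdiff W (S x) (S a)) + vnorm W (vdiff W (S a) (T x))"
      using x by (intro W.norm_diff_triangle) auto
    also have "vnorm W (vdiff W (S x) (S a)) \<le> c * vnorm V (vdiff V x a)"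
      using c(2)[of "vdiff V x a"] linear_op_diff[OF bounded_op_linear[OF S] \<open>semi_inner V\<close> x, of a] x by simp
    also have "vnorm W (vdiff W (S a) (T x)) \<le> c' * vnorm V (vdiff V x a)"
      using c'(2)[of "vdiff V x a"] linear_op_diff[OF bounded_op_linear[OF T] \<open>semi_inner V\<close> x, of a]
        W.norm_diff_commute[of "T x" "T a"] x eq[OF a(1)] by simp
    also have "c * vnorm V (vdiff V x a) + c' * vnorm V (vdiff V x a) \<le> c * e + c' * e"
      using a c c' by (intro add_mono mult_left_mono) auto
    finally show ?thesis
      by (simp add: algebra_simps)
  qed
  then have "vnorm W (vdiff W (S x) (T x)) \<le> 0"
    by (rule le_zero_by_epsilon)
  then show "S x = T x"
    using x by (intro W.norm_diff_eq_0) (auto intro: antisym)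
qed

text \<open>The map is given by pairs of values f a and g a over an index set, not on a subspace.
  Joint linearity turns \<open>bound\<close> into a Lipschitz estimate, so indices with equal f have
  equal g and no separate proof of well-definedness arises. The indices will be elements of M for
  \<pi>(\<xi>), and finitely supported functions for operators on tensor products.\<close>

lemma bounded_extension:
  fixes V :: "('u, 'y) inner_space_scheme" and W :: "('v, 'z) inner_space_scheme"
    and f :: "'i \<Rightarrow> 'u" and g :: "'i \<Rightarrow> 'v" and A :: "'i set" and C :: real
  assumes "inner_prod V" and "hilbert_space W"
    and fA: "\<And>a. a \<in> A \<Longrightarrow> f a \<in> vecs V" and gA: "\<And>a. a \<in> A \<Longrightarrow> g a \<in> vecs W"
    and lin: "\<And>a b c. \<lbrakk>a \<in> A; b \<in> A\<rbrakk> \<Longrightarrow> \<exists>e\<in>A. f e = vplus V (f a) (vscale V c (f b)) \<and>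
      g e = vplus W (g a) (vscale W c (g b))"
    and bound: "\<And>a. a \<in> A \<Longrightarrow> vnorm W (g a) \<le> C * vnorm V (f a)" and C: "C \<ge> 0"
    and dense: "vecs V \<subseteq> vclosure V (f ` A)"
  obtains T where "T \<in> bounded_op V W" and "\<And>a. a \<in> A \<Longrightarrow> T (f a) = g a"
    and "\<And>x. x \<in> vecs V \<Longrightarrow> vnorm W (T x) \<le> C * vnorm V x"
proof -
  interpret V: inner_prod V by fact
  interpret W: hilbert_space W by fact
  note [simp] = fA gA
  have lip: "vnorm W (vdiff W (g a) (g b)) \<le> C * vnorm V (vdiff V (f a) (f b))" if "a \<in> A" "b \<in> A" for a b
  proof -
    have "\<exists>e\<in>A. f e = vdiff V (f a) (f b) \<and> g e = vdiff W (g a) (g b)"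
      using lin[OF that, of "- 1"] unfolding vdiff_def .
    then obtain e where "e \<in> A" "f e = vdiff V (f a) (f b)" "g e = vdiff W (g a) (g b)"
      by blast
    then show ?thesis
      using bound[of e] by simp
  qed
  have approx: "\<exists>a\<in>A. vnorm V (vdiff V x (f a)) < e" if "x \<in> vecs V" "e > 0" for x and e :: real
    using dense that unfolding vclosure_def by blast
  \<comment> \<open>The value at x is characterised by its distance to every g b. This one estimate
    yields the extension property, linearity and the norm bound, without returning to the
    approximating sequence.\<close>
  have "\<exists>y\<in>vecs W. \<forall>b\<in>A. vnorm W (vdiff W y (g b)) \<le> C * vnorm V (vdiff V x (f b))" if x: "x \<in> vecs V" for x
  proof -
    have "\<exists>a\<in>A. vnorm V (vdiff V x (f a)) < inverse (real (Suc n))" for n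
      using approx[OF x] by simp
    then obtain a where aA [simp]: "\<And>n. a n \<in> A" and a: "\<And>n. vnorm V (vdiff V x (f (a n))) < inverse (real (Suc n))"
      by metis
    have "vnorm W (vdiff W (g (a m)) (g (a n))) \<le> C * inverse (real (Suc m)) + C * inverse (real (Suc n))" for m n
    proof -
      have "vnorm V (vdiff V (f (a m)) (f (a n))) \<le> inverse (real (Suc m)) + inverse (real (Suc n))"
        using V.norm_diff_triangle[of "f (a m)" x "f (a n)"] V.norm_diff_commute[of "f (a m)" x] a[of m] a[of n] x
        by simp
      from mult_left_mono[OF this C] show ?thesis
        using lip[of "a m" "a n"] by (simp add: algebra_simps)
    qed
    moreover have "(\<lambda>n. C * inverse (real (Suc n))) \<longlonglongrightarrow> 0"
      by (rule tendsto_mult_right_zero[OF LIMSEQ_inverse_real_of_nat])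
    ultimately have "vcauchy W (\<lambda>n. g (a n))"
      by (intro W.cauchyI) auto
    then obtain y where y: "y \<in> vecs W" and lim: "(\<lambda>n. vnorm W (vdiff W (g (a n)) y)) \<longlonglongrightarrow> 0"
      using W.complete by blast
    have "vnorm W (vdiff W y (g b)) \<le> C * vnorm V (vdiff V x (f b))" if b: "b \<in> A" for b
    proof -
      have "vnorm W (vdiff W y (g b)) \<le> vnorm W (vdiff W (g (a n)) y)
          + (C * inverse (real (Suc n)) + C * vnorm V (vdiff V x (f b)))" for n
      proof -
        have "vnorm V (vdiff V (f (a n)) (f b)) \<le> inverse (real (Suc n)) + vnorm V (vdiff V x (f b))"
          using V.norm_diff_triangle[of "f (a n)" x "f b"] V.norm_diff_commute[of "f (a n)" x] a[of n] x b
          by simp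
        from mult_left_mono[OF this C] have "vnorm W (vdiff W (g (a n)) (g b)) \<le>
            C * inverse (real (Suc n)) + C * vnorm V (vdiff V x (f b))"
          using lip[of "a n" b] b by (simp add: algebra_simps)
        then show ?thesis
          using W.norm_diff_triangle[of y "g (a n)" "g b"] W.norm_diff_commute[of y "g (a n)"] y b by simp
      qed
      moreover have "(\<lambda>n. vnorm W (vdiff W (g (a n)) y)
          + (C * inverse (real (Suc n)) + C * vnorm V (vdiff V x (f b)))) \<longlonglongrightarrow> 0 + (0 + C * vnorm V (vdiff V x (f b)))"
        by (intro tendsto_add lim tendsto_const tendsto_mult_right_zero[OF LIMSEQ_inverse_real_of_nat])
      ultimately show ?thesis
        by (intro LIMSEQ_le_const[where X = "\<lambda>n. vnorm W (vdiff W (g (a n)) y)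
          + (C * inverse (real (Suc n)) + C * vnorm V (vdiff V x (f b)))"]) auto
    qed
    then show ?thesis
      using y by blast
  qed
  then obtain T0 where T0c: "\<And>x. x \<in> vecs V \<Longrightarrow> T0 x \<in> vecs W"
    and T0: "\<And>x b. \<lbrakk>x \<in> vecs V; b \<in> A\<rbrakk> \<Longrightarrow> vnorm W (vdiff W (T0 x) (g b)) \<le> C * vnorm V (vdiff V x (f b))"
    by metis
  define T where "T = restrict T0 (vecs V)"
  have Tc [simp]: "T x \<in> vecs W" if "x \<in> vecs V" for x
    using that T0c by (simp add: T_def)
  have T: "vnorm W (vdiff W (T x) (g b)) \<le> C * vnorm V (vdiff V x (f b))" if "x \<in> vecs V" "b \<in> A" for x b
    using that T0 by (simp add: T_def)
  have ext: "T (f a) = g a" if "a \<in> A" for a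
    using T[of "f a" a] that by (intro W.norm_diff_eq_0) (auto intro: antisym)
  have comb: "T (vplus V x (vscale V c y)) = vplus W (T x) (vscale W c (T y))" (is "?l = ?r")
    if x: "x \<in> vecs V" and y: "y \<in> vecs V" for x y c
  proof -
    have "vnorm W (vdiff W ?l ?r) \<le> (2 * C * (1 + cmod c)) * e" if e: "e > 0" for e
    proof -
      obtain a where a: "a \<in> A" "vnorm V (vdiff V x (f a)) < e"
        using approx[OF x e] by blast
      obtain b where b: "b \<in> A" "vnorm V (vdiff V y (f b)) < e"
        using approx[OF y e] by blast
      obtain h where h: "h \<in> A" "f h = vplus V (f a) (vscale V c (f b))" "g h = vplus W (g a) (vscale W c (g b))"
        using lin[OF a(1) b(1)] by blast
      have e': "vnorm V (vdiff V x (f a)) + cmod c * vnorm V (vdiff V y (f b)) \<le> (1 + cmod c) * e"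
        using a b mult_left_mono[of "vnorm V (vdiff V y (f b))" e "cmod c"] by (simp add: algebra_simps)
      have "vnorm V (vdiff V (vplus V x (vscale V c y)) (f h)) \<le> vnorm V (vdiff V x (f a)) + cmod c * vnorm V (vdiff V y (f b))"
        using V.norm_diff_plus[of x "vscale V c y" "f a" "vscale V c (f b)"] x y a b h by (simp add: V.norm_diff_scale)
      then have 1: "vnorm W (vdiff W ?l (g h)) \<le> C * ((1 + cmod c) * e)"
        using T[of "vplus V x (vscale V c y)" h] mult_left_mono[OF order_trans[OF _ e'] C] h x y by fastforce
      have "vnorm W (vdiff W (g h) ?r) \<le> vnorm W (vdiff W (T x) (g a)) + cmod c * vnorm W (vdiff W (T y) (g b))"
        using W.norm_diff_plus[of "g a" "vscale W c (g b)" "T x" "vscale W c (T y)"] x y a b h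
          W.norm_diff_commute[of "g a" "T x"] W.norm_diff_commute[of "g b" "T y"]
        by (simp add: W.norm_diff_scale)
      also have "\<dots> \<le> C * vnorm V (vdiff V x (f a)) + cmod c * (C * vnorm V (vdiff V y (f b)))"
        using x y a b by (intro add_mono mult_left_mono T) auto
      also have "\<dots> \<le> C * ((1 + cmod c) * e)"
        using mult_left_mono[OF e' C] by (simp add: algebra_simps)
      finally show ?thesis
        using 1 W.norm_diff_triangle[of ?l "g h" ?r] x y h(1) by (simp add: algebra_simps)
    qed
    then have "vnorm W (vdiff W ?l ?r) \<le> 0"
      by (rule le_zero_by_epsilon)
    then show ?thesis
      using x y by (intro W.norm_diff_eq_0) (auto intro: antisym)
  qed
  have Tplus: "T (vplus V x y) = vplus W (T x) (T y)" if "x \<in> vecs V" "y \<in> vecs V" for x y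
    using comb[of x y 1] that by (simp add: V.scale_one W.scale_one)
  have Tz: "vinner W z (T (vzero V)) = 0" if "z \<in> vecs W" for z
    using arg_cong[OF Tplus[of "vzero V" "vzero V"], of "vinner W z"] that
    by (simp add: W.inner_plus V.plus_zero)
  have Tscale: "T (vscale V c x) = vscale W c (T x)" if "x \<in> vecs V" for x c
  proof (rule W.vec_eqI)
    have eq: "vplus V (vzero V) (vscale V c x) = vscale V c x"
      using that by (simp add: V.plus_commute[of "vzero V"] V.plus_zero)
    show "vinner W z (T (vscale V c x)) = vinner W z (vscale W c (T x))" if "z \<in> vecs W" for z
      using arg_cong[OF comb[of "vzero V" x c], of "vinner W z"] that \<open>x \<in> vecs V\<close> Tz[OF that]
      by (simp add: eq W.inner_plus)
  qed (use that in auto)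
  have Tlin: "T \<in> linear_op V W"
    by (rule linear_opI) (simp_all add: Tplus Tscale, simp add: T_def)
  have norm: "vnorm W (T x) \<le> C * vnorm V x" if x: "x \<in> vecs V" for x
  proof -
    have "vnorm W (T x) - C * vnorm V x \<le> (2 * C) * e" if e: "e > 0" for e
    proof -
      obtain a where a: "a \<in> A" "vnorm V (vdiff V x (f a)) < e"
        using approx[OF x e] by blast
      have "vnorm W (T x) \<le> vnorm W (g a) + vnorm W (vdiff W (T x) (g a))"
        using W.norm_diff_norm[of "T x" "g a"] a x by simp
      also have "\<dots> \<le> C * vnorm V (f a) + C * vnorm V (vdiff V x (f a))"
        using a x by (intro add_mono bound T) auto
      also have "\<dots> \<le> C * (vnorm V x + 2 * e)"
        using V.norm_diff_norm[of x "f a"] a x mult_left_mono[OF _ C, of "vnorm V (f a) + vnorm V (vdiff V x (f a))" "vnorm V x + 2 * e"]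
        by (simp add: algebra_simps)
      finally show ?thesis
        by (simp add: algebra_simps)
    qed
    then have "vnorm W (T x) - C * vnorm V x \<le> 0"
      by (rule le_zero_by_epsilon)
    then show ?thesis by simp
  qed
  have "T \<in> bounded_op V W"
    using Tlin norm by (auto simp: bounded_op_def)
  then show thesis
    using that ext norm by blast
qed

section \<open>Adjoints, contractions and unitaries\<close>

lemma adj_eqI:
  assumes "inner_prod V" and "y \<in> vecs W" and "x \<in> vecs V"
    and "\<And>z. z \<in> vecs V \<Longrightarrow> vinner V z x = vinner W (T z) y"
  shows "adj V W T y = x"
proof -
  interpret V: inner_prod V by fact
  have "(THE x. x \<in> vecs V \<and> (\<forall>z\<in>vecs V. vinner V z x = vinner W (T z) y)) = x"
    using assms by (intro the_equality) (auto intro: V.vec_eqI)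
  then show ?thesis
    using assms by (simp add: adj_def)
qed

text \<open>The functional \<langle>y, T _\<rangle> is bounded, and its Riesz vector satisfies the
  description by which \<open>adj\<close> is defined. Every later use of an adjoint rests on
  this.\<close>

lemma adj_char:
  assumes "hilbert_space V" and "semi_inner W" and T: "T \<in> bounded_op V W" and y: "y \<in> vecs W"
  shows adj_closed: "adj V W T y \<in> vecs V"
    and adj_inner: "z \<in> vecs V \<Longrightarrow> vinner V z (adj V W T y) = vinner W (T z) y"
    and adj_inner_left: "z \<in> vecs V \<Longrightarrow> vinner V (adj V W T y) z = vinner W y (T z)"
proof -
  interpret V: hilbert_space V by fact
  interpret W: semi_inner W by fact
  note [simp] = bounded_opD[OF T]
  obtain c where c: "c > 0" "\<And>x. x \<in> vecs V \<Longrightarrow> vnorm W (T x) \<le> c * vnorm V x"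
    using bounded_opE[OF T V.semi_inner_axioms W.semi_inner_axioms] by blast
  have "cmod (vinner W y (T x)) \<le> (vnorm W y * c) * vnorm V x" if x: "x \<in> vecs V" for x
    using W.cauchy_schwarz[OF y, of "T x"] mult_left_mono[OF c(2)[OF x] W.norm_nonneg[OF y]] x
    by (simp add: mult.assoc)
  then obtain x where x: "x \<in> vecs V" and xz: "\<And>z. z \<in> vecs V \<Longrightarrow> vinner V x z = vinner W y (T z)"
    using V.riesz[of "\<lambda>z. vinner W y (T z)" "vnorm W y * c"] y by (auto simp: W.inner_simps)
  have zx: "vinner V z x = vinner W (T z) y" if "z \<in> vecs V" for z
    using V.inner_commute[OF x that] W.inner_commute[OF y, of "T z"] xz[OF that] that by simp
  have "adj V W T y = x"
    by (rule adj_eqI[OF V.inner_prod_axioms y x zx])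
  then show "adj V W T y \<in> vecs V" "z \<in> vecs V \<Longrightarrow> vinner V z (adj V W T y) = vinner W (T z) y"
    "z \<in> vecs V \<Longrightarrow> vinner V (adj V W T y) z = vinner W y (T z)"
    using x xz zx by auto
qed

text \<open>For x = \<open>adj V W T y\<close>, the square norm of x is Re \<langle>T x, y\<rangle>
  \<le> c |x| |y|, and one factor |x| cancels.\<close>

lemma adj_norm_le:
  assumes "hilbert_space V" and "semi_inner W" and T: "T \<in> bounded_op V W" and y: "y \<in> vecs W"
    and c: "\<And>x. x \<in> vecs V \<Longrightarrow> vnorm W (T x) \<le> c * vnorm V x" and "c \<ge> 0"
  shows "vnorm V (adj V W T y) \<le> c * vnorm W y"
proof -
  interpret V: hilbert_space V by fact
  interpret W: semi_inner W by fact
  let ?x = "adj V W T y"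
  have x: "?x \<in> vecs V"
    by (rule adj_closed[OF assms(1-4)])
  have "(vnorm V ?x)\<^sup>2 = Re (vinner W (T ?x) y)"
    using x by (simp add: V.norm_sq adj_inner[OF assms(1-4)])
  also have "\<dots> \<le> vnorm W (T ?x) * vnorm W y"
    using W.cauchy_schwarz[OF bounded_opD(1)[OF T x] y] complex_Re_le_cmod order_trans by blast
  also have "\<dots> \<le> c * vnorm V ?x * vnorm W y"
    using c[OF x] y by (intro mult_right_mono) auto
  finally have "vnorm V ?x * vnorm V ?x \<le> (c * vnorm W y) * vnorm V ?x"
    by (simp add: power2_eq_square algebra_simps)
  then show ?thesis
    using V.norm_nonneg[OF x] y \<open>c \<ge> 0\<close> by (cases "vnorm V ?x = 0") auto
qed

lemma adj_linear:
  assumes "hilbert_space V" and "semi_inner W" and T: "T \<in> bounded_op V W"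
  shows "adj V W T \<in> linear_op W V"
proof (rule linear_opI)
  interpret V: hilbert_space V by fact
  interpret W: semi_inner W by fact
  note [simp] = adj_closed[OF assms] bounded_opD(1)[OF T]
  show "adj V W T (vplus W x y) = vplus V (adj V W T x) (adj V W T y)" if "x \<in> vecs W" "y \<in> vecs W" for x y
    using that by (intro adj_eqI V.inner_prod_axioms) (auto simp: V.inner_simps W.inner_simps adj_inner[OF assms])
  show "adj V W T (vscale W c x) = vscale V c (adj V W T x)" if "x \<in> vecs W" for c x
    using that by (intro adj_eqI V.inner_prod_axioms) (auto simp: V.inner_simps W.inner_simps adj_inner[OF assms])
qed (simp_all add: adj_closed[OF assms], simp add: adj_def)

lemma adj_bounded:
  assumes "hilbert_space V" and "semi_inner W" and T: "T \<in> bounded_op V W"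
  shows "adj V W T \<in> bounded_op W V"
proof -
  interpret V: hilbert_space V by fact
  obtain c where "c > 0" "\<And>x. x \<in> vecs V \<Longrightarrow> vnorm W (T x) \<le> c * vnorm V x"
    using bounded_opE[OF T V.semi_inner_axioms assms(2)] by blast
  then have "\<forall>y\<in>vecs W. vnorm V (adj V W T y) \<le> c * vnorm W y"
    using adj_norm_le[OF assms] by simp
  then show ?thesis
    using adj_linear[OF assms] unfolding bounded_op_def by blast
qed

lemma adj_contraction:
  assumes "hilbert_space V" and "semi_inner W" and T: "T \<in> contraction_op V W"
  shows "adj V W T \<in> contraction_op W V"
  using adj_norm_le[OF assms(1,2) contraction_bounded[OF T], of _ 1]
    adj_linear[OF assms(1,2) contraction_bounded[OF T]] T
  by (auto simp: contraction_op_def)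

lemma adj_isometry:
  assumes "inner_prod V" and T: "T \<in> isometry_op V W" and x: "x \<in> vecs V"
  shows "adj V W T (T x) = x"
  using assms bounded_opD(1)[OF isometry_bounded[OF T]]
  by (intro adj_eqI) (auto simp: isometry_inner)

lemma compose_contraction:
  assumes S: "S \<in> contraction_op V W" and T: "T \<in> contraction_op U V" and "semi_inner U"
  shows "compose (vecs U) S T \<in> contraction_op U W"
  unfolding contraction_op_def
proof (intro CollectI conjI ballI)
  show "compose (vecs U) S T \<in> linear_op U W"
    using assms by (intro compose_linear) (auto simp: contraction_op_def)
  fix x assume x: "x \<in> vecs U"
  then have "T x \<in> vecs V"
    using linear_opD(1)[of T U V] T by (simp add: contraction_op_def)
  then have "vnorm W (S (T x)) \<le> vnorm V (T x)" "vnorm V (T x) \<le> vnorm U x"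
    using S T x by (auto simp: contraction_op_def)
  then show "vnorm W (compose (vecs U) S T x) \<le> vnorm U x"
    using x by (simp add: compose_def)
qed

text \<open>The source of completeness for relative tensor products: a Cauchy sequence is mapped
  into the complete space W, and surjectivity brings its limit back.\<close>

lemma hilbert_unitary:
  assumes "inner_prod V" and "hilbert_space W" and T: "T \<in> unitary_op V W"
  shows "hilbert_space V"
  unfolding hilbert_space_iff
proof (intro conjI allI impI \<open>inner_prod V\<close>)
  interpret V: inner_prod V by fact
  interpret W: hilbert_space W by fact
  have iso: "T \<in> isometry_op V W" and surj: "T ` vecs V = vecs W"
    using T by (auto simp: unitary_op_def)
  note lin = bounded_op_linear[OF isometry_bounded[OF iso]]
  have d: "vnorm W (vdiff W (T x) (T y)) = vnorm V (vdiff V x y)" if "x \<in> vecs V" "y \<in> vecs V" for x y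
    using isometry_norm[OF iso, of "vdiff V x y"] linear_op_diff[OF lin V.semi_inner_axioms] that by simp
  fix X assume X: "vcauchy V X"
  then have Xc: "X n \<in> vecs V" for n
    by (simp add: vcauchy_def)
  have "vcauchy W (\<lambda>n. T (X n))"
    using X by (simp add: vcauchy_def d linear_opD(1)[OF lin])
  then obtain y where y: "y \<in> vecs W" "(\<lambda>n. vnorm W (vdiff W (T (X n)) y)) \<longlonglongrightarrow> 0"
    using W.complete by blast
  then have "y \<in> T ` vecs V"
    by (simp add: surj)
  then obtain x where "x \<in> vecs V" "y = T x"
    by blast
  with y have x: "x \<in> vecs V" "(\<lambda>n. vnorm W (vdiff W (T (X n)) (T x))) \<longlonglongrightarrow> 0"
    by auto
  then show "\<exists>x\<in>vecs V. (\<lambda>n. vnorm V (vdiff V (X n) x)) \<longlonglongrightarrow> 0"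
    using Xc by (auto simp: d)
qed

section \<open>Separation-completion\<close>

context semi_inner
begin

lemma vcauchy_closed: "vcauchy V X \<Longrightarrow> X n \<in> vecs V"
  by (simp add: vcauchy_def)

lemma vcauchy_const: "x \<in> vecs V \<Longrightarrow> vcauchy V (\<lambda>n. x)"
  by (simp add: vcauchy_def)

lemma vcauchy_plus:
  assumes X: "vcauchy V X" and Y: "vcauchy V Y"
  shows "vcauchy V (\<lambda>n. vplus V (X n) (Y n))"
  unfolding vcauchy_def
proof (intro conjI allI impI)
  fix e :: real assume "e > 0"
  then have e: "e / 2 > 0"
    by simp
  obtain N where N: "\<And>m n. \<lbrakk>m \<ge> N; n \<ge> N\<rbrakk> \<Longrightarrow> vnorm V (vdiff V (X m) (X n)) < e / 2"
    using X e unfolding vcauchy_def by blast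
  obtain N' where N': "\<And>m n. \<lbrakk>m \<ge> N'; n \<ge> N'\<rbrakk> \<Longrightarrow> vnorm V (vdiff V (Y m) (Y n)) < e / 2"
    using Y e unfolding vcauchy_def by blast
  have "vnorm V (vdiff V (vplus V (X m) (Y m)) (vplus V (X n) (Y n))) < e" if "m \<ge> max N N'" "n \<ge> max N N'" for m n
    using norm_diff_plus[of "X m" "Y m" "X n" "Y n"] N[of m n] N'[of m n] that
      vcauchy_closed[OF X] vcauchy_closed[OF Y] by simp
  then show "\<exists>N. \<forall>m\<ge>N. \<forall>n\<ge>N. vnorm V (vdiff V (vplus V (X m) (Y m)) (vplus V (X n) (Y n))) < e"
    by blast
qed (simp add: vcauchy_closed[OF X] vcauchy_closed[OF Y])

lemma vcauchy_scale:
  assumes X: "vcauchy V X"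
  shows "vcauchy V (\<lambda>n. vscale V c (X n))"
  unfolding vcauchy_def
proof (intro conjI allI impI)
  fix e :: real assume e: "e > 0"
  then have "e / (cmod c + 1) > 0"
    by (simp add: add_nonneg_pos)
  then obtain N where N: "\<And>m n. \<lbrakk>m \<ge> N; n \<ge> N\<rbrakk> \<Longrightarrow> vnorm V (vdiff V (X m) (X n)) < e / (cmod c + 1)"
    using X unfolding vcauchy_def by blast
  have "vnorm V (vdiff V (vscale V c (X m)) (vscale V c (X n))) < e" if "m \<ge> N" "n \<ge> N" for m n
  proof -
    have "cmod c * vnorm V (vdiff V (X m) (X n)) \<le> cmod c * (e / (cmod c + 1))"
      using N[OF that] by (intro mult_left_mono) auto
    also have "\<dots> < e"
      using e by (simp add: field_simps add_pos_nonneg)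
    finally show ?thesis
      by (simp add: norm_diff_scale vcauchy_closed[OF X])
  qed
  then show "\<exists>N. \<forall>m\<ge>N. \<forall>n\<ge>N. vnorm V (vdiff V (vscale V c (X m)) (vscale V c (X n))) < e"
    by blast
qed (simp add: vcauchy_closed[OF X])

lemma vcauchy_diff: "\<lbrakk>vcauchy V X; vcauchy V Y\<rbrakk> \<Longrightarrow> vcauchy V (\<lambda>n. vdiff V (X n) (Y n))"
  unfolding vdiff_def by (intro vcauchy_plus vcauchy_scale)

lemma vcauchy_norm_bounded:
  assumes X: "vcauchy V X"
  obtains B where "B > 0" and "\<And>n. vnorm V (X n) \<le> B"
proof -
  note Xc [simp] = vcauchy_closed[OF X]
  have "Cauchy (\<lambda>n. vnorm V (X n))"
  proof (rule CauchyI)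
    fix e :: real assume "e > 0"
    then obtain N where N: "\<And>m n. \<lbrakk>m \<ge> N; n \<ge> N\<rbrakk> \<Longrightarrow> vnorm V (vdiff V (X m) (X n)) < e"
      using X unfolding vcauchy_def by blast
    have "norm (vnorm V (X m) - vnorm V (X n)) < e" if "m \<ge> N" "n \<ge> N" for m n
      using norm_diff_norm[OF Xc Xc, of m n] N[OF that] by simp
    then show "\<exists>M. \<forall>m\<ge>M. \<forall>n\<ge>M. norm (vnorm V (X m) - vnorm V (X n)) < e"
      by blast
  qed
  then obtain B where "B > 0" "\<And>n. norm (vnorm V (X n)) \<le> B"
    using Cauchy_Bseq BseqE by metis
  then show thesis
    using that by (simp add: abs_le_iff)
qed

lemma inner_diff_bound:
  assumes x: "x \<in> vecs V" and y: "y \<in> vecs V" and x': "x' \<in> vecs V" and y': "y' \<in> vecs V"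
  shows "cmod (vinner V x y - vinner V x' y') \<le>
    vnorm V (vdiff V x x') * vnorm V y + vnorm V x' * vnorm V (vdiff V y y')"
proof -
  have "vinner V x y - vinner V x' y' = vinner V (vdiff V x x') y + vinner V x' (vdiff V y y')"
    using assms by (simp add: inner_simps)
  also have "cmod \<dots> \<le> cmod (vinner V (vdiff V x x') y) + cmod (vinner V x' (vdiff V y y'))"
    by (rule norm_triangle_ineq)
  also have "\<dots> \<le> vnorm V (vdiff V x x') * vnorm V y + vnorm V x' * vnorm V (vdiff V y y')"
    using assms by (intro add_mono cauchy_schwarz) auto
  finally show ?thesis .
qed

text \<open>Makes the \<open>lim\<close> in the inner product of \<open>completion\<close> an actual
  limit.\<close>

lemma vcauchy_inner:
  assumes X: "vcauchy V X" and Y: "vcauchy V Y"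
  shows "convergent (\<lambda>n. vinner V (X n) (Y n))"
proof -
  note [simp] = vcauchy_closed[OF X] vcauchy_closed[OF Y]
  obtain B where B: "B > 0" "\<And>n. vnorm V (X n) \<le> B"
    using vcauchy_norm_bounded[OF X] by blast
  obtain B' where B': "B' > 0" "\<And>n. vnorm V (Y n) \<le> B'"
    using vcauchy_norm_bounded[OF Y] by blast
  have "Cauchy (\<lambda>n. vinner V (X n) (Y n))"
  proof (rule CauchyI)
    fix e :: real assume "e > 0"
    then have "e / (2 * B') > 0" "e / (2 * B) > 0"
      using B B' by auto
    then obtain N N' where N: "\<And>m n. \<lbrakk>m \<ge> N; n \<ge> N\<rbrakk> \<Longrightarrow> vnorm V (vdiff V (X m) (X n)) < e / (2 * B')"
      and N': "\<And>m n. \<lbrakk>m \<ge> N'; n \<ge> N'\<rbrakk> \<Longrightarrow> vnorm V (vdiff V (Y m) (Y n)) < e / (2 * B)"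
      using X Y unfolding vcauchy_def by metis
    have "norm (vinner V (X m) (Y m) - vinner V (X n) (Y n)) < e" if "m \<ge> max N N'" "n \<ge> max N N'" for m n
    proof -
      have "norm (vinner V (X m) (Y m) - vinner V (X n) (Y n))
          \<le> vnorm V (vdiff V (X m) (X n)) * vnorm V (Y m) + vnorm V (X n) * vnorm V (vdiff V (Y m) (Y n))"
        by (intro inner_diff_bound) auto
      also have "\<dots> \<le> vnorm V (vdiff V (X m) (X n)) * B' + B * vnorm V (vdiff V (Y m) (Y n))"
        using B(2) B'(2) by (intro add_mono mult_left_mono mult_right_mono) auto
      also have "\<dots> < e / (2 * B') * B' + B * (e / (2 * B))"
        using N[of m n] N'[of m n] that B(1) B'(1)
        by (intro add_strict_mono mult_strict_left_mono mult_strict_right_mono) auto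
      also have "\<dots> = e"
        using B(1) B'(1) by simp
      finally show ?thesis .
    qed
    then show "\<exists>M. \<forall>m\<ge>M. \<forall>n\<ge>M. norm (vinner V (X m) (Y m) - vinner V (X n) (Y n)) < e"
      by blast
  qed
  then show ?thesis
    by (simp add: Cauchy_convergent_iff)
qed

lemma cauchy_rel_iff: "(X, Y) \<in> cauchy_rel V \<longleftrightarrow>
    vcauchy V X \<and> vcauchy V Y \<and> (\<lambda>n. vnorm V (vdiff V (X n) (Y n))) \<longlonglongrightarrow> 0"
  by (simp add: cauchy_rel_def)

lemma equiv_cauchy_rel: "equiv {X. vcauchy V X} (cauchy_rel V)"
proof (rule equivI)
  show "cauchy_rel V \<subseteq> {X. vcauchy V X} \<times> {X. vcauchy V X}"
    by (auto simp: cauchy_rel_def)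
  show "refl_on {X. vcauchy V X} (cauchy_rel V)"
    by (rule refl_onI) (auto simp: cauchy_rel_iff vcauchy_closed)
  show "sym (cauchy_rel V)"
  proof (rule symI)
    fix X Y assume XY: "(X, Y) \<in> cauchy_rel V"
    then have "vnorm V (vdiff V (Y n) (X n)) = vnorm V (vdiff V (X n) (Y n))" for n
      by (intro norm_diff_commute vcauchy_closed) (auto simp: cauchy_rel_iff)
    then show "(Y, X) \<in> cauchy_rel V"
      using XY by (simp add: cauchy_rel_iff)
  qed
  show "trans (cauchy_rel V)"
  proof (rule transI)
    fix X Y Z assume XY: "(X, Y) \<in> cauchy_rel V" and YZ: "(Y, Z) \<in> cauchy_rel V"
    then have c: "vcauchy V X" "vcauchy V Y" "vcauchy V Z"
      by (auto simp: cauchy_rel_iff)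
    have "(\<lambda>n. vnorm V (vdiff V (X n) (Y n)) + vnorm V (vdiff V (Y n) (Z n))) \<longlonglongrightarrow> 0"
      using tendsto_add[of _ 0 _ _ 0] XY YZ by (auto simp: cauchy_rel_iff)
    then have "(\<lambda>n. vnorm V (vdiff V (X n) (Z n))) \<longlonglongrightarrow> 0"
      by (rule null_bound) (use norm_diff_triangle c in \<open>auto simp: vcauchy_closed\<close>)
    then show "(X, Z) \<in> cauchy_rel V"
      using c by (simp add: cauchy_rel_iff)
  qed
qed

lemma cauchy_class_eq_iff:
  assumes "vcauchy V X" "vcauchy V Y"
  shows "cauchy_class V X = cauchy_class V Y \<longleftrightarrow> (\<lambda>n. vnorm V (vdiff V (X n) (Y n))) \<longlonglongrightarrow> 0"
  using eq_equiv_class_iff[OF equiv_cauchy_rel, of X Y] assms by (simp add: cauchy_class_def cauchy_rel_iff)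

lemma cauchy_class_closed: "vcauchy V X \<Longrightarrow> cauchy_class V X \<in> vecs (completion V)"
  by (simp add: completion_def cauchy_class_def quotientI)

lemma completion_cases:
  assumes "A \<in> vecs (completion V)"
  obtains X where "vcauchy V X" and "A = cauchy_class V X"
  using assms by (auto simp: completion_def cauchy_class_def elim!: quotientE)

text \<open>The operations of \<open>completion\<close> are computed on chosen representatives. A
  chosen representative differs from any given one by a null sequence, and this is what makes the
  operations independent of the choice.\<close>

lemma cauchy_rep_class:
  assumes X: "vcauchy V X"
  shows "(X, cauchy_rep (cauchy_class V X)) \<in> cauchy_rel V"
proof -
  have "X \<in> cauchy_class V X"
    using equiv_class_self[OF equiv_cauchy_rel, of X] X by (simp add: cauchy_class_def)
  then have "cauchy_rep (cauchy_class V X) \<in> cauchy_class V X"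
    unfolding cauchy_rep_def by (rule someI[of "\<lambda>Y. Y \<in> cauchy_class V X"])
  then show ?thesis
    by (simp add: cauchy_class_def)
qed

lemma completion_plus:
  assumes X: "vcauchy V X" and Y: "vcauchy V Y"
  shows "vplus (completion V) (cauchy_class V X) (cauchy_class V Y) = cauchy_class V (\<lambda>n. vplus V (X n) (Y n))"
proof -
  let ?X = "cauchy_rep (cauchy_class V X)" and ?Y = "cauchy_rep (cauchy_class V Y)"
  have r: "vcauchy V ?X" "vcauchy V ?Y" "(\<lambda>n. vnorm V (vdiff V (X n) (?X n))) \<longlonglongrightarrow> 0"
    "(\<lambda>n. vnorm V (vdiff V (Y n) (?Y n))) \<longlonglongrightarrow> 0"
    using cauchy_rep_class[OF X] cauchy_rep_class[OF Y] by (auto simp: cauchy_rel_iff)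
  have "(\<lambda>n. vnorm V (vdiff V (X n) (?X n)) + vnorm V (vdiff V (Y n) (?Y n))) \<longlonglongrightarrow> 0"
    using tendsto_add[OF r(3,4)] by simp
  then have "(\<lambda>n. vnorm V (vdiff V (vplus V (X n) (Y n)) (vplus V (?X n) (?Y n)))) \<longlonglongrightarrow> 0"
    by (rule null_bound) (use X Y r norm_diff_plus in \<open>simp add: vcauchy_closed\<close>)
  then have "cauchy_class V (\<lambda>n. vplus V (X n) (Y n)) = cauchy_class V (\<lambda>n. vplus V (?X n) (?Y n))"
    using X Y r by (simp add: cauchy_class_eq_iff vcauchy_plus)
  then show ?thesis
    by (simp add: completion_def)
qed

lemma completion_scale:
  assumes X: "vcauchy V X"
  shows "vscale (completion V) c (cauchy_class V X) = cauchy_class V (\<lambda>n. vscale V c (X n))"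
proof -
  let ?X = "cauchy_rep (cauchy_class V X)"
  have r: "vcauchy V ?X" "(\<lambda>n. vnorm V (vdiff V (X n) (?X n))) \<longlonglongrightarrow> 0"
    using cauchy_rep_class[OF X] by (auto simp: cauchy_rel_iff)
  have "(\<lambda>n. vnorm V (vdiff V (vscale V c (X n)) (vscale V c (?X n)))) \<longlonglongrightarrow> 0"
    using tendsto_mult_right_zero[OF r(2), of "cmod c"] X r(1) by (simp add: vcauchy_closed norm_diff_scale)
  then have "cauchy_class V (\<lambda>n. vscale V c (X n)) = cauchy_class V (\<lambda>n. vscale V c (?X n))"
    using X r by (simp add: cauchy_class_eq_iff vcauchy_scale)
  then show ?thesis
    by (simp add: completion_def)
qed

lemma completion_diff:
  assumes X: "vcauchy V X" and Y: "vcauchy V Y"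
  shows "vdiff (completion V) (cauchy_class V X) (cauchy_class V Y) = cauchy_class V (\<lambda>n. vdiff V (X n) (Y n))"
  using X Y by (simp add: vdiff_def completion_scale completion_plus vcauchy_scale)

lemma completion_zero: "vzero (completion V) = cauchy_class V (\<lambda>n. vzero V)"
  by (simp add: completion_def)

lemma completion_inner:
  assumes X: "vcauchy V X" and Y: "vcauchy V Y"
  shows "(\<lambda>n. vinner V (X n) (Y n)) \<longlonglongrightarrow> vinner (completion V) (cauchy_class V X) (cauchy_class V Y)"
proof -
  let ?X = "cauchy_rep (cauchy_class V X)" and ?Y = "cauchy_rep (cauchy_class V Y)"
  have r: "vcauchy V ?X" "vcauchy V ?Y" "(\<lambda>n. vnorm V (vdiff V (X n) (?X n))) \<longlonglongrightarrow> 0"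
    "(\<lambda>n. vnorm V (vdiff V (Y n) (?Y n))) \<longlonglongrightarrow> 0"
    using cauchy_rep_class[OF X] cauchy_rep_class[OF Y] by (auto simp: cauchy_rel_iff)
  note [simp] = vcauchy_closed[OF X] vcauchy_closed[OF Y] vcauchy_closed[OF r(1)] vcauchy_closed[OF r(2)]
  obtain B where B: "B > 0" "\<And>n. vnorm V (Y n) \<le> B"
    using vcauchy_norm_bounded[OF Y] by blast
  obtain B' where B': "B' > 0" "\<And>n. vnorm V (?X n) \<le> B'"
    using vcauchy_norm_bounded[OF r(1)] by blast
  have "(\<lambda>n. vinner V (?X n) (?Y n)) \<longlonglongrightarrow> vinner (completion V) (cauchy_class V X) (cauchy_class V Y)"
    using vcauchy_inner[OF r(1,2)] by (simp add: completion_def convergent_LIMSEQ_iff)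
  moreover have "(\<lambda>n. vinner V (X n) (Y n) - vinner V (?X n) (?Y n)) \<longlonglongrightarrow> 0"
  proof (rule null_bound)
    show "(\<lambda>n. vnorm V (vdiff V (X n) (?X n)) * B + B' * vnorm V (vdiff V (Y n) (?Y n))) \<longlonglongrightarrow> 0"
      using tendsto_add[OF tendsto_mult_left_zero[OF r(3)] tendsto_mult_right_zero[OF r(4)]] by simp
    fix n
    have "norm (vinner V (X n) (Y n) - vinner V (?X n) (?Y n))
        \<le> vnorm V (vdiff V (X n) (?X n)) * vnorm V (Y n) + vnorm V (?X n) * vnorm V (vdiff V (Y n) (?Y n))"
      by (intro inner_diff_bound) auto
    also have "\<dots> \<le> vnorm V (vdiff V (X n) (?X n)) * B + B' * vnorm V (vdiff V (Y n) (?Y n))"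
      using B(2) B'(2) by (intro add_mono mult_left_mono mult_right_mono) auto
    finally show "norm (vinner V (X n) (Y n) - vinner V (?X n) (?Y n)) \<le> \<dots>" .
  qed
  ultimately show ?thesis
    using tendsto_add by fastforce
qed

lemma inner_prod_completion: "inner_prod (completion V)"
proof -
  let ?C = "completion V"
  note cs = completion_plus completion_scale completion_zero vcauchy_plus vcauchy_scale vcauchy_const
    cauchy_class_closed
  note cl = vcauchy_closed
  have [simp]: "vzero ?C \<in> vecs ?C"
    by (simp add: cs)
  show ?thesis
  proof
    fix x y assume "x \<in> vecs ?C" "y \<in> vecs ?C"
    then obtain X Y where X: "vcauchy V X" "x = cauchy_class V X" and Y: "vcauchy V Y" "y = cauchy_class V Y"
      by (metis completion_cases)
    show "vplus ?C x y \<in> vecs ?C"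
      using X Y by (simp add: cs)
    have "vplus V (X n) (Y n) = vplus V (Y n) (X n)" for n
      using X Y by (intro plus_commute cl)
    then show "vplus ?C x y = vplus ?C y x"
      using X Y by (simp add: cs)
    show "vscale ?C c (vplus ?C x y) = vplus ?C (vscale ?C c x) (vscale ?C c y)" for c
      using X Y by (simp add: cs scale_plus cl)
    show "vinner ?C x (vscale ?C c y) = c * vinner ?C x y" for c
    proof (rule LIMSEQ_unique)
      show "(\<lambda>n. vinner V (X n) (vscale V c (Y n))) \<longlonglongrightarrow> vinner ?C x (vscale ?C c y)"
        using completion_inner[of X "\<lambda>n. vscale V c (Y n)"] X Y by (simp add: cs)
      show "(\<lambda>n. vinner V (X n) (vscale V c (Y n))) \<longlonglongrightarrow> c * vinner ?C x y"
        using tendsto_mult_left[OF completion_inner[OF X(1) Y(1)], of c] X Y by (simp add: cl inner_scale)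
    qed
    show "vinner ?C y x = cnj (vinner ?C x y)"
    proof (rule LIMSEQ_unique)
      show "(\<lambda>n. vinner V (Y n) (X n)) \<longlonglongrightarrow> vinner ?C y x"
        using completion_inner[of Y X] X Y by simp
      have "vinner V (Y n) (X n) = cnj (vinner V (X n) (Y n))" for n
        using X Y by (intro inner_commute cl)
      then show "(\<lambda>n. vinner V (Y n) (X n)) \<longlonglongrightarrow> cnj (vinner ?C x y)"
        using tendsto_cnj[OF completion_inner[OF X(1) Y(1)]] X Y by simp
    qed
  next
    fix x y z assume "x \<in> vecs ?C" "y \<in> vecs ?C" "z \<in> vecs ?C"
    then obtain X Y Z where X: "vcauchy V X" "x = cauchy_class V X" and Y: "vcauchy V Y" "y = cauchy_class V Y"
      and Z: "vcauchy V Z" "z = cauchy_class V Z"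
      by (metis completion_cases)
    show "vplus ?C (vplus ?C x y) z = vplus ?C x (vplus ?C y z)"
      using X Y Z by (simp add: cs plus_assoc cl)
    show "vinner ?C x (vplus ?C y z) = vinner ?C x y + vinner ?C x z"
    proof (rule LIMSEQ_unique)
      show "(\<lambda>n. vinner V (X n) (vplus V (Y n) (Z n))) \<longlonglongrightarrow> vinner ?C x (vplus ?C y z)"
        using completion_inner[of X "\<lambda>n. vplus V (Y n) (Z n)"] X Y Z by (simp add: cs)
      show "(\<lambda>n. vinner V (X n) (vplus V (Y n) (Z n))) \<longlonglongrightarrow> vinner ?C x y + vinner ?C x z"
        using tendsto_add[OF completion_inner[OF X(1) Y(1)] completion_inner[OF X(1) Z(1)]] X Y Z
        by (simp add: cl inner_plus)
    qed
  next
    fix x assume "x \<in> vecs ?C"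
    then obtain X where X: "vcauchy V X" "x = cauchy_class V X"
      by (metis completion_cases)
    have lim: "(\<lambda>n. complex_of_real ((vnorm V (X n))\<^sup>2)) \<longlonglongrightarrow> vinner ?C x x"
      using completion_inner[of X X] X by (simp add: cl inner_self[symmetric] del: of_real_power)
    show "vscale ?C c x \<in> vecs ?C" for c
      using X by (simp add: cs)
    show "vplus ?C x (vzero ?C) = x"
      using X by (simp add: cs plus_zero cl)
    show "vdiff ?C x x = vzero ?C"
      using X by (simp add: completion_diff completion_zero diff_self cl)
    show "vscale ?C (c + d) x = vplus ?C (vscale ?C c x) (vscale ?C d x)" for c d
      using X by (simp add: cs plus_scale cl)
    show "vscale ?C c (vscale ?C d x) = vscale ?C (c * d) x" for c d
      using X by (simp add: cs scale_scale cl)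
    show "vscale ?C 1 x = x"
      using X by (simp add: cs scale_one cl)
    have "0 \<le> Re (vinner ?C x x)"
      using tendsto_Re[OF lim] by (intro LIMSEQ_le_const) auto
    moreover have "Im (vinner ?C x x) = 0"
      using LIMSEQ_unique[OF tendsto_Im[OF lim]] by simp
    ultimately show "vinner ?C x x \<in> \<real>\<^sub>\<ge>\<^sub>0"
      by (simp add: complex_nonneg_Reals_iff)
    assume "vinner ?C x x = 0"
    then have "(\<lambda>n. (vnorm V (X n))\<^sup>2) \<longlonglongrightarrow> 0"
      using tendsto_Re[OF lim] by simp
    from tendsto_real_sqrt[OF this] have "(\<lambda>n. vnorm V (X n)) \<longlonglongrightarrow> 0"
      using X by (simp add: cl)
    moreover have "vnorm V (vdiff V (X n) (vzero V)) = vnorm V (X n)" for n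
      using X(1) by (simp add: vnorm_def inner_simps cl)
    ultimately show "x = vzero ?C"
      using X by (simp add: completion_zero cauchy_class_eq_iff vcauchy_const)
  qed simp
qed

lemma completion_dense:
  "vecs (completion V) \<subseteq> vclosure (completion V) ((\<lambda>x. cauchy_class V (\<lambda>n. x)) ` vecs V)"
proof
  let ?C = "completion V"
  interpret C: inner_prod ?C
    by (rule inner_prod_completion)
  fix a assume a: "a \<in> vecs ?C"
  then obtain X where X: "vcauchy V X" "a = cauchy_class V X"
    by (metis completion_cases)
  show "a \<in> vclosure ?C ((\<lambda>x. cauchy_class V (\<lambda>n. x)) ` vecs V)"
    unfolding vclosure_def
  proof (intro CollectI conjI allI impI a)
    fix e :: real assume "e > 0"
    then have "e / 2 > 0"
      by simp
    then obtain N where N: "\<And>m n. \<lbrakk>m \<ge> N; n \<ge> N\<rbrakk> \<Longrightarrow> vnorm V (vdiff V (X m) (X n)) < e / 2"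
      using X(1) unfolding vcauchy_def by blast
    have XN: "X N \<in> vecs V"
      using X vcauchy_closed by blast
    let ?Y = "\<lambda>n. vdiff V (X n) (X N)"
    have Y: "vcauchy V ?Y"
      using X XN by (intro vcauchy_diff vcauchy_const)
    have d: "vdiff ?C a (cauchy_class V (\<lambda>n. X N)) = cauchy_class V ?Y"
      using X XN by (simp add: completion_diff vcauchy_const)
    \<comment> \<open>Passing to the limit keeps only a weak inequality, so the tail is estimated by
      e / 2 to end strictly below e.\<close>
    have "Re (vinner ?C (cauchy_class V ?Y) (cauchy_class V ?Y)) \<le> (e / 2)\<^sup>2"
    proof (rule LIMSEQ_le_const2[OF tendsto_Re[OF completion_inner[OF Y Y]]], intro exI allI impI)
      fix n assume "n \<ge> N"
      then show "Re (vinner V (?Y n) (?Y n)) \<le> (e / 2)\<^sup>2"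
        using N[of n N] power_mono[of "vnorm V (?Y n)" "e / 2" 2] vcauchy_closed[OF X(1)]
        by (simp add: norm_sq[symmetric])
    qed
    from real_sqrt_le_mono[OF this] have "vnorm ?C (cauchy_class V ?Y) \<le> e / 2"
      using \<open>e > 0\<close> by (simp only: vnorm_def real_sqrt_abs)
    then show "\<exists>d\<in>(\<lambda>x. cauchy_class V (\<lambda>n. x)) ` vecs V. vnorm ?C (vdiff ?C a d) < e"
      using d XN \<open>e > 0\<close> by (intro bexI[of _ "cauchy_class V (\<lambda>n. X N)"]) auto
  qed
qed

lemma completion_const:
  assumes x: "x \<in> vecs V" and y: "y \<in> vecs V"
  shows "cauchy_class V (\<lambda>n. x) \<in> vecs (completion V)"
    and "vinner (completion V) (cauchy_class V (\<lambda>n. x)) (cauchy_class V (\<lambda>n. y)) = vinner V x y"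
    and "vplus (completion V) (cauchy_class V (\<lambda>n. x)) (cauchy_class V (\<lambda>n. y)) = cauchy_class V (\<lambda>n. vplus V x y)"
    and "vscale (completion V) c (cauchy_class V (\<lambda>n. x)) = cauchy_class V (\<lambda>n. vscale V c x)"
  using LIMSEQ_unique[OF completion_inner[OF vcauchy_const[OF x] vcauchy_const[OF y]] tendsto_const] x y
  by (simp_all add: completion_plus completion_scale vcauchy_const cauchy_class_closed)

end

section \<open>The standard space of a state\<close>

text \<open>Compared with \<open>normal_rep\<close>, normality is dropped and multiplicativity
  added. \<open>normal_rep\<close> says nothing about products because it serves left and right
  actions alike. The weaker notion also covers the left action on a bimodule whose inner product has
  been changed.\<close>

definition star_rep ::
    "('b, 'y) vn_algebra_scheme \<Rightarrow> ('a, 'z) inner_space_scheme \<Rightarrow> (('b \<Rightarrow> 'b) \<Rightarrow> 'a \<Rightarrow> 'a) \<Rightarrow> bool" where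
  "star_rep M V \<rho> \<longleftrightarrow>
     (\<forall>a\<in>elts M. restrict (\<rho> a) (vecs V) \<in> bounded_op V V) \<and>
     (\<forall>x\<in>vecs V. \<rho> (op_id (base M)) x = x) \<and>
     (\<forall>a\<in>elts M. \<forall>b\<in>elts M. \<forall>x\<in>vecs V. \<rho> (op_plus (base M) a b) x = vplus V (\<rho> a x) (\<rho> b x)) \<and>
     (\<forall>c. \<forall>a\<in>elts M. \<forall>x\<in>vecs V. \<rho> (op_scale (base M) c a) x = vscale V c (\<rho> a x)) \<and>
     (\<forall>a\<in>elts M. \<forall>x\<in>vecs V. \<forall>y\<in>vecs V. vinner V x (\<rho> a y) = vinner V (\<rho> (vn_star M a) x) y) \<and>
     (\<forall>a\<in>elts M. \<forall>b\<in>elts M. \<forall>x\<in>vecs V. \<rho> (vn_mult M a b) x = \<rho> a (\<rho> b x))"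

lemma wstar_bimodule_star_rep: "wstar_bimodule M V \<Longrightarrow> star_rep M V (lact V)"
  by (simp add: wstar_bimodule_def star_rep_def normal_rep_def)

lemma wstar_bimodule_right: "wstar_bimodule M V \<Longrightarrow> right_module M V"
  by (simp add: wstar_bimodule_def)

lemma right_module_hilbert: "right_module M V \<Longrightarrow> hilbert_space V"
  by (simp add: right_module_def)

lemma star_repD:
  assumes "star_rep M V \<rho>"
  shows "a \<in> elts M \<Longrightarrow> restrict (\<rho> a) (vecs V) \<in> bounded_op V V"
    and "x \<in> vecs V \<Longrightarrow> \<rho> (op_id (base M)) x = x"
    and "\<lbrakk>a \<in> elts M; b \<in> elts M; x \<in> vecs V\<rbrakk> \<Longrightarrow> \<rho> (op_plus (base M) a b) x = vplus V (\<rho> a x) (\<rho> b x)"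
    and "\<lbrakk>a \<in> elts M; x \<in> vecs V\<rbrakk> \<Longrightarrow> \<rho> (op_scale (base M) c a) x = vscale V c (\<rho> a x)"
    and "\<lbrakk>a \<in> elts M; x \<in> vecs V; y \<in> vecs V\<rbrakk> \<Longrightarrow> vinner V x (\<rho> a y) = vinner V (\<rho> (vn_star M a) x) y"
    and "\<lbrakk>a \<in> elts M; b \<in> elts M; x \<in> vecs V\<rbrakk> \<Longrightarrow> \<rho> (vn_mult M a b) x = \<rho> a (\<rho> b x)"
  using assms unfolding star_rep_def by blast+

lemma star_rep_lin:
  assumes "star_rep M V \<rho>" and a: "a \<in> elts M" and "semi_inner V"
  shows "x \<in> vecs V \<Longrightarrow> \<rho> a x \<in> vecs V"
    and "\<lbrakk>x \<in> vecs V; y \<in> vecs V\<rbrakk> \<Longrightarrow> \<rho> a (vplus V x y) = vplus V (\<rho> a x) (\<rho> a y)"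
    and "x \<in> vecs V \<Longrightarrow> \<rho> a (vscale V c x) = vscale V c (\<rho> a x)"
proof -
  interpret V: semi_inner V by fact
  note T = bounded_opD[OF star_repD(1)[OF assms(1) a]]
  show "x \<in> vecs V \<Longrightarrow> \<rho> a x \<in> vecs V"
    using T(1)[of x] by simp
  show "\<lbrakk>x \<in> vecs V; y \<in> vecs V\<rbrakk> \<Longrightarrow> \<rho> a (vplus V x y) = vplus V (\<rho> a x) (\<rho> a y)"
    using T(2)[of x y] by simp
  show "x \<in> vecs V \<Longrightarrow> \<rho> a (vscale V c x) = vscale V c (\<rho> a x)"
    using T(3)[of x c] by simp
qed

lemma right_moduleD:
  assumes "right_module M V"
  shows ract_bounded: "a \<in> elts M \<Longrightarrow> (\<lambda>x\<in>vecs V. ract V x a) \<in> bounded_op V V"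
    and ract_id: "x \<in> vecs V \<Longrightarrow> ract V x (op_id (base M)) = x"
    and ract_op_plus: "\<lbrakk>a \<in> elts M; b \<in> elts M; x \<in> vecs V\<rbrakk>
      \<Longrightarrow> ract V x (op_plus (base M) a b) = vplus V (ract V x a) (ract V x b)"
    and ract_op_scale: "\<lbrakk>a \<in> elts M; x \<in> vecs V\<rbrakk> \<Longrightarrow> ract V x (op_scale (base M) c a) = vscale V c (ract V x a)"
    and ract_inner: "\<lbrakk>a \<in> elts M; x \<in> vecs V; y \<in> vecs V\<rbrakk>
      \<Longrightarrow> vinner V x (ract V y a) = vinner V (ract V x (vn_star M a)) y"
    and ract_mult: "\<lbrakk>a \<in> elts M; b \<in> elts M; x \<in> vecs V\<rbrakk>
      \<Longrightarrow> ract V x (vn_mult M a b) = ract V (ract V x a) b"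
  using assms unfolding right_module_def normal_rep_def by blast+

lemma ract_lin:
  assumes "right_module M V" and a: "a \<in> elts M"
  shows ract_closed: "x \<in> vecs V \<Longrightarrow> ract V x a \<in> vecs V"
    and ract_plus: "\<lbrakk>x \<in> vecs V; y \<in> vecs V\<rbrakk> \<Longrightarrow> ract V (vplus V x y) a = vplus V (ract V x a) (ract V y a)"
    and ract_scale: "x \<in> vecs V \<Longrightarrow> ract V (vscale V c x) a = vscale V c (ract V x a)"
proof -
  interpret V: hilbert_space V
    using assms(1) by (rule right_module_hilbert)
  note T = bounded_opD[OF ract_bounded[OF assms]]
  show "x \<in> vecs V \<Longrightarrow> ract V x a \<in> vecs V"
    using T(1)[of x] by simp
  show "\<lbrakk>x \<in> vecs V; y \<in> vecs V\<rbrakk> \<Longrightarrow> ract V (vplus V x y) a = vplus V (ract V x a) (ract V y a)"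
    using T(2)[of x y] by simp
  show "x \<in> vecs V \<Longrightarrow> ract V (vscale V c x) a = vscale V c (ract V x a)"
    using T(3)[of x c] by simp
qed

lemma op_plus_bounded:
  assumes "semi_inner V" and S: "S \<in> bounded_op V V" and T: "T \<in> bounded_op V V"
  shows "op_plus V S T \<in> bounded_op V V"
proof -
  interpret V: semi_inner V by fact
  note [simp] = bounded_opD[OF S] bounded_opD[OF T]
  obtain c where c: "\<And>x. x \<in> vecs V \<Longrightarrow> vnorm V (S x) \<le> c * vnorm V x"
    using bounded_opE[OF S assms(1,1)] by blast
  obtain d where d: "\<And>x. x \<in> vecs V \<Longrightarrow> vnorm V (T x) \<le> d * vnorm V x"
    using bounded_opE[OF T assms(1,1)] by blast
  have swap: "vplus V (vplus V u v) (vplus V x y) = vplus V (vplus V u x) (vplus V v y)"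
    if [simp]: "u \<in> vecs V" "v \<in> vecs V" "x \<in> vecs V" "y \<in> vecs V" for u v x y
    using V.plus_assoc[of v x y] V.plus_assoc[of x v y] V.plus_commute[of v x]
    by (simp add: V.plus_assoc)
  have "op_plus V S T \<in> linear_op V V"
    by (rule linear_opI) (simp_all add: op_plus_def swap V.scale_plus)
  moreover have "vnorm V (op_plus V S T x) \<le> (c + d) * vnorm V x" if x: "x \<in> vecs V" for x
    using V.norm_triangle[of "S x" "T x"] c[OF x] d[OF x] x by (simp add: op_plus_def algebra_simps)
  ultimately show ?thesis
    by (auto simp: bounded_op_def)
qed

lemma op_scale_bounded:
  assumes "semi_inner V" and T: "T \<in> bounded_op V V"
  shows "op_scale V k T \<in> bounded_op V V"
proof -
  interpret V: semi_inner V by fact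
  note [simp] = bounded_opD[OF T]
  obtain c where c: "\<And>x. x \<in> vecs V \<Longrightarrow> vnorm V (T x) \<le> c * vnorm V x"
    using bounded_opE[OF T assms(1,1)] by blast
  have "op_scale V k T \<in> linear_op V V"
    by (rule linear_opI) (simp_all add: op_scale_def V.scale_plus V.scale_scale mult.commute)
  moreover have "vnorm V (op_scale V k T x) \<le> (cmod k * c) * vnorm V x" if x: "x \<in> vecs V" for x
    using mult_left_mono[OF c[OF x], of "cmod k"] x by (simp add: op_scale_def V.norm_scale mult.assoc)
  ultimately show ?thesis
    by (auto simp: bounded_op_def)
qed

lemma op_id_isometry: "semi_inner V \<Longrightarrow> op_id V \<in> isometry_op V V"
  unfolding isometry_op_def
  by (intro CollectI conjI linear_opI)
    (auto simp: op_id_def semi_inner.plus_closed semi_inner.scale_closed)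

text \<open>A von Neumann algebra equals its bicommutant, so the closure properties of a commutant
  give \<open>elts M\<close> its unit, sums, scalar multiples and products.\<close>

lemma commutant_closed:
  assumes "semi_inner V" and A: "A \<subseteq> bounded_op V V"
  shows "op_id V \<in> commutant V A"
    and "\<lbrakk>S \<in> commutant V A; T \<in> commutant V A\<rbrakk> \<Longrightarrow> op_plus V S T \<in> commutant V A"
    and "T \<in> commutant V A \<Longrightarrow> op_scale V c T \<in> commutant V A"
    and "\<lbrakk>S \<in> commutant V A; T \<in> commutant V A\<rbrakk> \<Longrightarrow> compose (vecs V) S T \<in> commutant V A"
proof -
  have Ab: "a \<in> bounded_op V V" if "a \<in> A" for a
    using A that by blast
  have mem: "T \<in> commutant V A \<longleftrightarrow> T \<in> bounded_op V V \<and> (\<forall>a\<in>A. \<forall>x\<in>vecs V. T (a x) = a (T x))" for T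
  proof -
    have "compose (vecs V) T a = compose (vecs V) a T \<longleftrightarrow> (\<forall>x\<in>vecs V. T (a x) = a (T x))" for a
      unfolding compose_def by (auto simp: restrict_def fun_eq_iff)
    then show ?thesis
      by (auto simp: commutant_def)
  qed
  have comm: "T (a x) = a (T x)" if "T \<in> commutant V A" "a \<in> A" "x \<in> vecs V" for T a x
    using that mem by blast
  have bd: "T \<in> bounded_op V V" if "T \<in> commutant V A" for T
    using that mem by blast
  show "op_id V \<in> commutant V A"
    unfolding mem using isometry_bounded[OF op_id_isometry[OF assms(1)]] bounded_opD(1)[OF Ab]
    by (auto simp: op_id_def)
  show "op_plus V S T \<in> commutant V A" if "S \<in> commutant V A" "T \<in> commutant V A"
    unfolding mem using op_plus_bounded[OF assms(1) bd bd] comm that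
    by (auto simp: op_plus_def bounded_opD(1,2)[OF Ab] bounded_opD(1)[OF bd])
  show "op_scale V c T \<in> commutant V A" if "T \<in> commutant V A"
    unfolding mem using op_scale_bounded[OF assms(1) bd] comm that
    by (auto simp: op_scale_def bounded_opD(1,3)[OF Ab] bounded_opD(1)[OF bd])
  show "compose (vecs V) S T \<in> commutant V A" if "S \<in> commutant V A" "T \<in> commutant V A"
    unfolding mem using compose_bounded[OF bd bd assms(1,1,1)] comm that
    by (auto simp: compose_def bounded_opD(1)[OF Ab] bounded_opD(1)[OF bd])
qed

lemma von_neumann_algebra_closed:
  assumes M: "von_neumann_algebra M"
  shows vn_id: "op_id (base M) \<in> elts M"
    and vn_plus: "\<lbrakk>a \<in> elts M; b \<in> elts M\<rbrakk> \<Longrightarrow> op_plus (base M) a b \<in> elts M"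
    and vn_scale: "a \<in> elts M \<Longrightarrow> op_scale (base M) c a \<in> elts M"
    and vn_mult: "\<lbrakk>a \<in> elts M; b \<in> elts M\<rbrakk> \<Longrightarrow> vn_mult M a b \<in> elts M"
    and vn_star: "a \<in> elts M \<Longrightarrow> vn_star M a \<in> elts M"
proof -
  interpret B: hilbert_space "base M"
    using M by (simp add: von_neumann_algebra_def)
  have eq: "commutant (base M) (commutant (base M) (elts M)) = elts M"
    using M by (simp add: von_neumann_algebra_def)
  have "commutant (base M) (elts M) \<subseteq> bounded_op (base M) (base M)"
    by (auto simp: commutant_def)
  note c = commutant_closed[OF B.semi_inner_axioms this, unfolded eq]
  show "op_id (base M) \<in> elts M"
    and "\<lbrakk>a \<in> elts M; b \<in> elts M\<rbrakk> \<Longrightarrow> op_plus (base M) a b \<in> elts M"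
    and "a \<in> elts M \<Longrightarrow> op_scale (base M) c a \<in> elts M"
    and "\<lbrakk>a \<in> elts M; b \<in> elts M\<rbrakk> \<Longrightarrow> vn_mult M a b \<in> elts M"
    by (fact c)+
  show "a \<in> elts M \<Longrightarrow> vn_star M a \<in> elts M"
    using M by (simp add: von_neumann_algebra_def)
qed

text \<open>Addition is a field of the record, so a finite sum of vectors is described by its inner
  products. The matrix computations below use sums only in this way.\<close>

lemma (in semi_inner) sum_vec_exists:
  assumes "finite I" and "\<And>i. i \<in> I \<Longrightarrow> f i \<in> vecs V"
  shows "\<exists>v\<in>vecs V. \<forall>y\<in>vecs V. vinner V y v = (\<Sum>i\<in>I. vinner V y (f i))"
  using assms
proof (induction I)
  case empty
  show ?case
    by (intro bexI[of _ "vzero V"]) (simp_all add: inner_zero)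
next
  case (insert i I)
  then obtain v where v: "v \<in> vecs V" "\<forall>y\<in>vecs V. vinner V y v = (\<Sum>i\<in>I. vinner V y (f i))"
    by auto
  with insert show ?case
    by (intro bexI[of _ "vplus V (f i) v"]) (simp_all add: inner_plus)
qed

section \<open>The standard space of M with its cyclic and separating vector \<Omega>\<close>

locale standard_state =
  fixes M :: "('b, 'h) std_algebra" and \<phi> :: "('b \<Rightarrow> 'b) \<Rightarrow> complex" and \<Omega> :: 'h
  assumes std: "standard_form M" and state: "faithful_normal_state M \<phi>" and rep: "represents_state M \<phi> \<Omega>"
begin

abbreviation L :: "('h, 'b \<Rightarrow> 'b) bimodule" where "L \<equiv> L2 M"

lemma vn: "von_neumann_algebra M" and L_bimodule: "wstar_bimodule M L"
  using std by (simp_all add: standard_form_def)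

lemma L_right: "right_module M L"
  by (rule wstar_bimodule_right[OF L_bimodule])

sublocale B: hilbert_space "base M"
  using vn by (simp add: von_neumann_algebra_def)

sublocale L: hilbert_space "L2 M"
  by (rule right_module_hilbert[OF L_right])

lemmas elts_closed [simp] = vn_id[OF vn] vn_plus[OF vn] vn_scale[OF vn] vn_mult[OF vn] vn_star[OF vn]

lemmas L_rep = wstar_bimodule_star_rep[OF L_bimodule]
lemmas lact_L_simps = star_repD(2,3,4,6)[OF L_rep]
lemmas lact_L [simp] = star_rep_lin(1)[OF L_rep _ L.semi_inner_axioms]
lemmas lact_L_lin = star_rep_lin(2,3)[OF L_rep _ L.semi_inner_axioms]
lemmas ract_L [simp] = ract_closed[OF L_right]

lemma elts_ext:
  assumes a: "a \<in> elts M" and b: "b \<in> elts M" and "\<And>x. x \<in> vecs L \<Longrightarrow> lact L a x = lact L b x"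
  shows "a = b"
proof -
  have "inj_on (\<lambda>a. restrict (lact L a) (vecs L)) (elts M)"
    using std by (simp add: standard_form_def Let_def)
  moreover have "restrict (lact L a) (vecs L) = restrict (lact L b) (vecs L)"
    using assms(3) by (rule restrict_ext)
  ultimately show ?thesis
    using a b by (auto dest: inj_onD)
qed

lemma elts_extI:
  assumes "a \<in> elts M" and "b \<in> elts M"
    and "\<And>x y. \<lbrakk>x \<in> vecs L; y \<in> vecs L\<rbrakk> \<Longrightarrow> vinner L y (lact L a x) = vinner L y (lact L b x)"
  shows "a = b"
  using assms by (intro elts_ext L.vec_eqI) auto

lemma star_rep_inner:
  assumes "star_rep M V \<rho>" and "semi_inner V" and a: "a \<in> elts M" and x: "x \<in> vecs V" and y: "y \<in> vecs V"
  shows "vinner V (\<rho> a x) y = vinner V x (\<rho> (vn_star M a) y)"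
proof -
  interpret V: semi_inner V by fact
  note [simp] = star_rep_lin(1)[OF assms(1) _ V.semi_inner_axioms]
  show ?thesis
    using V.inner_commute[of y "\<rho> a x"] V.inner_commute[of "\<rho> (vn_star M a) y" x] a x y
      star_repD(5)[OF assms(1), of a y x] by simp
qed

lemma star_star:
  assumes a: "a \<in> elts M"
  shows "vn_star M (vn_star M a) = a"
proof (rule elts_extI)
  fix x y assume x: "x \<in> vecs L" and y: "y \<in> vecs L"
  have "vinner L y (lact L (vn_star M (vn_star M a)) x) = vinner L (lact L (vn_star M a) y) x"
    using star_rep_inner[OF L_rep L.semi_inner_axioms _ y x] a by simp
  then show "vinner L y (lact L (vn_star M (vn_star M a)) x) = vinner L y (lact L a x)"
    using star_repD(5)[OF L_rep a y x] by simp
qed (use a in auto)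

text \<open>The right action by a is x \<mapsto> J a\<acute>J x for the adjoint a\<acute> of a, so
  right linearity of T says that J T J commutes with the left action. The standard form identifies
  the commutant of the left action with J M J, whence J T J = J a J for some a in M.\<close>

lemma End_L:
  assumes T: "T \<in> bounded_op L L" and lin: "right_linear M L L T"
  obtains a where "a \<in> elts M" and "\<And>x. x \<in> vecs L \<Longrightarrow> T x = lact L a x"
proof -
  define J where "J = modconj M"
  have Jc [simp]: "J x \<in> vecs L" "J (J x) = x" if "x \<in> vecs L" for x
    using std that by (simp_all add: standard_form_def Let_def J_def)
  have Jplus: "J (vplus L x y) = vplus L (J x) (J y)" if "x \<in> vecs L" "y \<in> vecs L" for x y
    using std that by (simp add: standard_form_def Let_def J_def)
  have Jscale: "J (vscale L c x) = vscale L (cnj c) (J x)" if "x \<in> vecs L" for c x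
    using std that by (simp add: standard_form_def Let_def J_def)
  have "vinner L (J x) (J y) = vinner L y x" if "x \<in> vecs L" "y \<in> vecs L" for x y
    using std that by (simp add: standard_form_def Let_def J_def)
  then have Jnorm: "vnorm L (J x) = vnorm L x" if "x \<in> vecs L" for x
    using that by (simp add: vnorm_def)
  have Jract: "ract L x a = J (lact L (vn_star M a) (J x))" if "a \<in> elts M" "x \<in> vecs L" for a x
    using std that by (simp add: standard_form_def Let_def J_def)
  have comm: "(\<lambda>T. \<lambda>x\<in>vecs L. J (T (J x))) ` left_image M = commutant L (left_image M)"
    using std by (simp add: standard_form_def Let_def J_def)
  note [simp] = bounded_opD[OF T]
  obtain c where c: "\<And>x. x \<in> vecs L \<Longrightarrow> vnorm L (T x) \<le> c * vnorm L x"
    using bounded_opE[OF T L.semi_inner_axioms L.semi_inner_axioms] by blast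
  let ?T = "\<lambda>x\<in>vecs L. J (T (J x))"
  have "?T \<in> linear_op L L"
    by (rule linear_opI) (simp_all add: Jplus Jscale)
  moreover have "vnorm L (?T x) \<le> c * vnorm L x" if "x \<in> vecs L" for x
    using c[of "J x"] that by (simp add: Jnorm)
  ultimately have Tb: "?T \<in> bounded_op L L"
    by (auto simp: bounded_op_def)
  have "?T (lact L a x) = lact L a (?T x)" if a: "a \<in> elts M" and x: "x \<in> vecs L" for a x
  proof -
    have "J (lact L a x) = ract L (J x) (vn_star M a)"
      using a x by (simp add: Jract star_star)
    then have "T (J (lact L a x)) = ract L (T (J x)) (vn_star M a)"
      using lin a x by (simp add: right_linear_def)
    then show ?thesis
      using a x by (simp add: Jract star_star)
  qed
  then have "?T \<in> commutant L (left_image M)"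
    using Tb by (auto simp: commutant_def left_image_def compose_def intro!: restrict_ext)
  then obtain S where S: "S \<in> left_image M" "?T = (\<lambda>x\<in>vecs L. J (S (J x)))"
    using comm by blast
  then obtain a where a: "a \<in> elts M" "S = restrict (lact L a) (vecs L)"
    by (auto simp: left_image_def)
  have "T x = lact L a x" if x: "x \<in> vecs L" for x
  proof -
    have "?T (J x) = J (S x)"
      using S x by simp
    then have "J (J (T x)) = J (J (lact L a x))"
      using a x by simp
    then show ?thesis
      using a x by simp
  qed
  with a show thesis
    using that by blast
qed

lemma \<Omega>_closed [simp]: "\<Omega> \<in> vecs L"
proof -
  have "poscone M = {x \<in> vecs L. \<forall>y\<in>poscone M. vinner L x y \<in> \<real>\<^sub>\<ge>\<^sub>0}"
    using std by (simp add: standard_form_def Let_def)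
  then show ?thesis
    using rep by (auto simp: represents_state_def)
qed

text \<open>For d = a - b, the state \<phi> takes the value |d \<Omega>|^2 on the product of the
  adjoint of d with d. This is 0, so faithfulness of \<phi> gives d = 0.\<close>

lemma \<Omega>_separating:
  assumes a: "a \<in> elts M" and b: "b \<in> elts M" and eq: "lact L a \<Omega> = lact L b \<Omega>"
  shows "a = b"
proof -
  let ?d = "op_plus (base M) a (op_scale (base M) (- 1) b)"
  have d: "?d \<in> elts M"
    using a b by simp
  have "lact L ?d \<Omega> = vdiff L (lact L a \<Omega>) (lact L b \<Omega>)"
    using a b by (simp add: lact_L_simps vdiff_def)
  then have "lact L ?d \<Omega> = vzero L"
    using a b eq by (simp add: L.diff_self)
  then have "vinner L \<Omega> (lact L (vn_star M ?d) (lact L ?d \<Omega>)) = 0"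
    using star_rep_inner[OF L_rep L.semi_inner_axioms d \<Omega>_closed, of "lact L ?d \<Omega>"] d by (simp add: L.inner_zero)
  moreover have "\<phi> (vn_mult M (vn_star M ?d) ?d) = vinner L \<Omega> (lact L (vn_mult M (vn_star M ?d) ?d) \<Omega>)"
    using rep d by (simp add: represents_state_def)
  ultimately have "\<phi> (vn_mult M (vn_star M ?d) ?d) = 0"
    using star_repD(6)[OF L_rep _ d \<Omega>_closed, of "vn_star M ?d"] d by simp
  then have z: "?d = (\<lambda>x\<in>vecs (base M). vzero (base M))"
    using state d by (simp add: faithful_normal_state_def)
  have bd: "a \<in> bounded_op (base M) (base M)" "b \<in> bounded_op (base M) (base M)"
    using vn a b by (auto simp: von_neumann_algebra_def)
  show ?thesis
  proof (rule linear_op_ext)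
    show "a \<in> linear_op (base M) (base M)" "b \<in> linear_op (base M) (base M)"
      using bd by (simp_all add: bounded_op_linear)
    fix x assume x: "x \<in> vecs (base M)"
    have "vdiff (base M) (a x) (b x) = ?d x"
      using x by (simp add: op_plus_def op_scale_def vdiff_def)
    also have "\<dots> = vzero (base M)"
      by (simp only: z restrict_apply' x)
    finally show "a x = b x"
      by (rule B.diff_zero_imp_eq[OF bounded_opD(1)[OF bd(1) x] bounded_opD(1)[OF bd(2) x]])
  qed
qed

text \<open>The projection onto the closure of \<Omega>M is right linear, hence left multiplication
  by some a in M. It fixes \<Omega>, so a = 1 because \<Omega> is separating, and the closure is the
  whole space.\<close>

lemma ract_\<Omega>_dense: "vecs L \<subseteq> vclosure L (ract L \<Omega> ` elts M)"
proof -
  let ?D = "ract L \<Omega> ` elts M"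
  have mem: "ract L \<Omega> a \<in> ?D" if "a \<in> elts M" for a
    using that by (rule imageI)
  have "ract L \<Omega> (op_scale (base M) 0 (op_id (base M))) = vzero L"
    by (simp add: ract_op_scale[OF L_right] ract_id[OF L_right] L.scale_zero)
  then have "vzero L \<in> ?D"
    using mem[of "op_scale (base M) 0 (op_id (base M))"] by simp
  moreover have "vplus L (ract L \<Omega> a) (ract L \<Omega> b) \<in> ?D" if "a \<in> elts M" "b \<in> elts M" for a b
    using mem[of "op_plus (base M) a b"] that by (simp add: ract_op_plus[OF L_right])
  moreover have "vscale L c (ract L \<Omega> a) \<in> ?D" if "a \<in> elts M" for a c
    using mem[of "op_scale (base M) c a"] that by (simp add: ract_op_scale[OF L_right])
  ultimately have D: "vsubspace L ?D"
    unfolding vsubspace_def by auto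
  let ?cl = "vclosure L ?D"
  interpret C: hilbert_space "L\<lparr>vecs := ?cl\<rparr>"
    by (rule L.hilbert_vclosure[OF D])
  have cl [simp]: "x \<in> vecs L" if "x \<in> ?cl" for x
    using that by (simp add: vclosure_def)
  have clp [simp]: "vplus L x y \<in> ?cl" if "x \<in> ?cl" "y \<in> ?cl" for x y
    using C.plus_closed[of x y] that by simp
  have cls [simp]: "vscale L c x \<in> ?cl" if "x \<in> ?cl" for c x
    using C.scale_closed[of x c] that by simp
  have cl_eqI: "x = y" if "x \<in> ?cl" "y \<in> ?cl" "\<And>z. z \<in> ?cl \<Longrightarrow> vinner L x z = vinner L y z" for x y
    using C.vec_eqI[of x y] that L.inner_commute[of x] L.inner_commute[of y] by simp
  have clr [simp]: "ract L x a \<in> ?cl" if x: "x \<in> ?cl" and a: "a \<in> elts M" for x a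
    unfolding vclosure_def
  proof (intro CollectI conjI allI impI)
    fix e :: real assume e: "e > 0"
    obtain c where c: "c > 0" "\<And>x. x \<in> vecs L \<Longrightarrow> vnorm L ((\<lambda>x\<in>vecs L. ract L x a) x) \<le> c * vnorm L x"
      using bounded_opE[OF ract_bounded[OF L_right a] L.semi_inner_axioms L.semi_inner_axioms] by blast
    have "e / c > 0"
      using e c by simp
    then obtain b where b: "b \<in> elts M" "vnorm L (vdiff L x (ract L \<Omega> b)) < e / c"
      using x unfolding vclosure_def by blast
    have "vdiff L (ract L x a) (ract L \<Omega> (vn_mult M b a)) = ract L (vdiff L x (ract L \<Omega> b)) a"
      using x a b by (simp add: ract_mult[OF L_right] vdiff_def ract_plus[OF L_right] ract_scale[OF L_right])
    then have "vnorm L (vdiff L (ract L x a) (ract L \<Omega> (vn_mult M b a))) \<le> c * vnorm L (vdiff L x (ract L \<Omega> b))"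
      using c(2)[of "vdiff L x (ract L \<Omega> b)"] x b by simp
    also have "\<dots> < e"
      using b(2) c(1) by (simp add: field_simps)
    finally show "\<exists>d\<in>?D. vnorm L (vdiff L (ract L x a) d) < e"
      using mem[of "vn_mult M b a"] a b(1) by (intro bexI) auto
  qed (use x a in simp)
  have "\<exists>p\<in>?cl. \<forall>z\<in>?cl. vinner L p z = vinner L v z" if "v \<in> vecs L" for v
    using L.projection[OF D that] by metis
  then obtain p where pc [simp]: "\<And>v. v \<in> vecs L \<Longrightarrow> p v \<in> ?cl"
    and p: "\<And>v z. \<lbrakk>v \<in> vecs L; z \<in> ?cl\<rbrakk> \<Longrightarrow> vinner L (p v) z = vinner L v z"
    by metis
  let ?P = "restrict p (vecs L)"
  have "?P \<in> linear_op L L"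
  proof (rule linear_opI)
    show "?P (vplus L x y) = vplus L (?P x) (?P y)" if "x \<in> vecs L" "y \<in> vecs L" for x y
      using that by (simp, intro cl_eqI) (auto simp: p L.inner_simps)
    show "?P (vscale L c x) = vscale L c (?P x)" if "x \<in> vecs L" for c x
      using that by (simp, intro cl_eqI) (auto simp: p L.inner_simps)
  qed auto
  moreover have "vnorm L (?P x) \<le> 1 * vnorm L x" if x: "x \<in> vecs L" for x
  proof -
    have "vnorm L (p x) * vnorm L (p x) = Re (vinner L x (p x))"
      using L.norm_sq[of "p x"] p[of x "p x"] x by (simp add: power2_eq_square)
    also have "\<dots> \<le> vnorm L x * vnorm L (p x)"
      using L.cauchy_schwarz[of x "p x"] x complex_Re_le_cmod[of "vinner L x (p x)"] by simp
    finally have le: "vnorm L (p x) * vnorm L (p x) \<le> vnorm L x * vnorm L (p x)" .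
    have "0 \<le> vnorm L (p x)"
      using x by simp
    then consider "vnorm L (p x) = 0" | "vnorm L (p x) > 0"
      by linarith
    then have "vnorm L (p x) \<le> vnorm L x"
      using mult_right_le_imp_le[OF le] x by cases auto
    then show ?thesis
      using x by simp
  qed
  ultimately have Pb: "?P \<in> bounded_op L L"
    unfolding bounded_op_def by blast
  \<comment> \<open>The closure of \<Omega>M is invariant under the right action and M is closed
    under adjoints, so the projection onto it commutes with that action.\<close>
  have "right_linear M L L ?P"
    unfolding right_linear_def
  proof (intro ballI)
    fix x a assume x: "x \<in> vecs L" and a: "a \<in> elts M"
    have "vinner L (ract L (p x) a) z = vinner L (ract L x a) z" if "z \<in> ?cl" for z
      using p[of x "ract L z (vn_star M a)"] x a that
      by (simp add: ract_inner[OF L_right] star_star)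
    then show "?P (ract L x a) = ract L (?P x) a"
      using x a by (simp, intro cl_eqI) (auto simp: p)
  qed
  then obtain a where a: "a \<in> elts M" and Pa: "\<And>x. x \<in> vecs L \<Longrightarrow> ?P x = lact L a x"
    using End_L[OF Pb] by blast
  have "\<Omega> \<in> ?D"
    using mem[of "op_id (base M)"] by (simp add: ract_id[OF L_right])
  then have "\<Omega> \<in> ?cl"
    using D L.subset_vclosure[of ?D] unfolding vsubspace_def by blast
  then have "p \<Omega> = \<Omega>"
    by (intro cl_eqI) (auto simp: p)
  then have "a = op_id (base M)"
    using Pa[of \<Omega>] a by (intro \<Omega>_separating) (auto simp: lact_L_simps)
  then have "p x = x" if "x \<in> vecs L" for x
    using Pa[OF that] that by (simp add: lact_L_simps)
  then show ?thesis
    using pc by force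
qed

text \<open>The form \<langle>x, a y\<rangle> is an inner product equivalent to the given one. The
  Riesz vector of \<langle>y, _\<rangle> for this form solves a x = y with norm at most |y| / r. The
  solution operator commutes with the right action, so \<open>End_L\<close> puts it in M.\<close>

lemma inverse_exists:
  assumes a: "a \<in> elts M" and sa: "vn_star M a = a" and r: "r > 0"
    and pos: "\<And>x. x \<in> vecs L \<Longrightarrow> r * (vnorm L x)\<^sup>2 \<le> Re (vinner L x (lact L a x))"
  obtains b where "b \<in> elts M" and "vn_star M b = b"
    and "vn_mult M a b = op_id (base M)" and "vn_mult M b a = op_id (base M)"
proof -
  have sym: "vinner L x (lact L a y) = vinner L (lact L a x) y" if "x \<in> vecs L" "y \<in> vecs L" for x y
    using star_repD(5)[OF L_rep a that] sa by simp
  let ?W = "L\<lparr>vinner := \<lambda>x y. vinner L x (lact L a y)\<rparr>"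
  have [simp]: "vdiff ?W x y = vdiff L x y" for x y
    by (simp add: vdiff_def)
  have Im: "Im (vinner L x (lact L a x)) = 0" if "x \<in> vecs L" for x
    using arg_cong[OF L.inner_commute[of x "lact L a x"], of Im] sym[of x x] that a by simp
  obtain c where c: "c > 0" "\<And>x. x \<in> vecs L \<Longrightarrow> vnorm L (restrict (lact L a) (vecs L) x) \<le> c * vnorm L x"
    using bounded_opE[OF star_repD(1)[OF L_rep a] L.semi_inner_axioms L.semi_inner_axioms] by blast
  have nW: "(vnorm ?W x)\<^sup>2 = Re (vinner L x (lact L a x))" if x: "x \<in> vecs L" for x
  proof -
    have "0 \<le> r * (vnorm L x)\<^sup>2"
      using r by simp
    then show ?thesis
      using pos[OF x] by (simp add: vnorm_def)
  qed
  \<comment> \<open>The two norms are equivalent. \<open>lower\<close> turns Cauchy sequences of the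
    new norm into Cauchy sequences of \<open>L\<close>, and \<open>upper\<close> carries convergence
    back.\<close>
  have lower: "sqrt r * vnorm L x \<le> vnorm ?W x" if x: "x \<in> vecs L" for x
    using real_sqrt_le_mono[OF pos[OF x]] x by (simp add: vnorm_def[of ?W] real_sqrt_mult)
  have upper: "vnorm ?W x \<le> sqrt c * vnorm L x" if x: "x \<in> vecs L" for x
  proof -
    have "Re (vinner L x (lact L a x)) \<le> vnorm L x * vnorm L (lact L a x)"
      using L.cauchy_schwarz[of x "lact L a x"] complex_Re_le_cmod[of "vinner L x (lact L a x)"] x a by simp
    also have "\<dots> \<le> vnorm L x * (c * vnorm L x)"
      using c(2)[OF x] x by (intro mult_left_mono) auto
    finally have "Re (vinner L x (lact L a x)) \<le> c * (vnorm L x)\<^sup>2"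
      by (simp add: power2_eq_square mult_ac)
    from real_sqrt_le_mono[OF this] show ?thesis
      using x by (simp add: vnorm_def[of ?W] real_sqrt_mult)
  qed
  have W: "hilbert_space ?W"
    unfolding hilbert_space_iff
  proof (intro conjI allI impI)
    show "inner_prod ?W"
    proof
      fix x y assume "x \<in> vecs ?W" "y \<in> vecs ?W"
      then have x: "x \<in> vecs L" and y: "y \<in> vecs L"
        by simp_all
      show "vplus ?W x y = vplus ?W y x"
        using x y by (simp add: L.plus_commute)
      show "vinner ?W y x = cnj (vinner ?W x y)"
        using L.inner_commute[of "lact L a x" y] sym[of x y] x y a by simp
    next
      fix x assume "x \<in> vecs ?W"
      then have x: "x \<in> vecs L"
        by simp
      have "0 \<le> Re (vinner L x (lact L a x))"
        using nW[OF x] by (metis zero_le_power2)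
      then show "vinner ?W x x \<in> \<real>\<^sub>\<ge>\<^sub>0"
        using Im[OF x] by (simp add: complex_nonneg_Reals_iff)
      assume "vinner ?W x x = 0"
      then have "r * (vnorm L x)\<^sup>2 \<le> 0"
        using pos[OF x] by simp
      then have "vnorm L x = 0"
        using r by (simp add: mult_le_0_iff)
      then show "x = vzero ?W"
        using L.norm_le_0_imp[OF x] by simp
    qed (simp_all add: a L.plus_assoc L.plus_zero L.diff_self L.scale_plus L.plus_scale L.scale_scale
        L.scale_one L.inner_plus L.inner_scale lact_L_lin)
    fix X assume X: "vcauchy ?W X"
    have Xc: "X n \<in> vecs L" for n
      using X by (simp add: vcauchy_def)
    have "vcauchy L X"
      unfolding vcauchy_def
    proof (intro conjI allI impI Xc)
      fix e :: real assume e: "e > 0"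
      then have "sqrt r * e > 0"
        using r by simp
      then obtain N where N: "\<And>m n. \<lbrakk>m \<ge> N; n \<ge> N\<rbrakk> \<Longrightarrow> vnorm ?W (vdiff ?W (X m) (X n)) < sqrt r * e"
        using X unfolding vcauchy_def by blast
      have "vnorm L (vdiff L (X m) (X n)) < e" if "m \<ge> N" "n \<ge> N" for m n
      proof -
        have "sqrt r * vnorm L (vdiff L (X m) (X n)) < sqrt r * e"
          using N[OF that] lower[of "vdiff L (X m) (X n)"] Xc by simp
        then show ?thesis
          using r by simp
      qed
      then show "\<exists>N. \<forall>m\<ge>N. \<forall>n\<ge>N. vnorm L (vdiff L (X m) (X n)) < e"
        by blast
    qed
    then obtain x where x: "x \<in> vecs L" and lim: "(\<lambda>n. vnorm L (vdiff L (X n) x)) \<longlonglongrightarrow> 0"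
      using L.complete by blast
    have "(\<lambda>n. vnorm ?W (vdiff ?W (X n) x)) \<longlonglongrightarrow> 0"
    proof (rule null_bound[OF tendsto_mult_right_zero[OF lim, of "sqrt c"]])
      fix n
      have "sqrt r * vnorm L (vdiff L (X n) x) \<ge> 0"
        using r x Xc by simp
      then show "norm (vnorm ?W (vdiff ?W (X n) x)) \<le> sqrt c * vnorm L (vdiff L (X n) x)"
        using upper[of "vdiff L (X n) x"] lower[of "vdiff L (X n) x"] x Xc by simp
    qed
    then show "\<exists>x\<in>vecs ?W. (\<lambda>n. vnorm ?W (vdiff ?W (X n) x)) \<longlonglongrightarrow> 0"
      using x by auto
  qed
  interpret W: hilbert_space ?W
    by (rule W)
  have "\<exists>x\<in>vecs L. \<forall>z\<in>vecs L. vinner L x (lact L a z) = vinner L y z" if y: "y \<in> vecs L" for y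
  proof -
    have bd: "cmod (vinner L y z) \<le> (vnorm L y / sqrt r) * vnorm ?W z" if z: "z \<in> vecs ?W" for z
    proof -
      have "vnorm L z \<le> vnorm ?W z / sqrt r"
        using lower[of z] z r by (simp add: pos_le_divide_eq mult.commute)
      from mult_left_mono[OF this L.norm_nonneg[OF y]] show ?thesis
        using L.cauchy_schwarz[OF y, of z] z by simp
    qed
    have add: "vinner L y (vplus ?W u v) = vinner L y u + vinner L y v" if "u \<in> vecs ?W" "v \<in> vecs ?W" for u v
      using that y by (simp add: L.inner_plus)
    have scale: "vinner L y (vscale ?W k u) = k * vinner L y u" if "u \<in> vecs ?W" for k u
      using that y by (simp add: L.inner_scale)
    obtain x where "x \<in> vecs ?W" "\<And>z. z \<in> vecs ?W \<Longrightarrow> vinner ?W x z = vinner L y z"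
      using W.riesz[OF add scale bd] by blast
    then show ?thesis
      by auto
  qed
  then obtain f where fc [simp]: "\<And>y. y \<in> vecs L \<Longrightarrow> f y \<in> vecs L"
    and f: "\<And>y z. \<lbrakk>y \<in> vecs L; z \<in> vecs L\<rbrakk> \<Longrightarrow> vinner L (f y) (lact L a z) = vinner L y z"
    by metis
  have af: "lact L a (f y) = y" if y: "y \<in> vecs L" for y
  proof (rule L.vec_eqI)
    fix z assume z: "z \<in> vecs L"
    show "vinner L z (lact L a (f y)) = vinner L z y"
      using f[OF y z] sym[of "f y" z] L.inner_commute[of "lact L a (f y)" z] L.inner_commute[of y z] y z a by simp
  qed (use y a in auto)
  \<comment> \<open>Since a inverts \<open>f\<close> from the left, injectivity of a reduces
    linearity and right linearity of \<open>f\<close> to those of a.\<close>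
  have inj: "x = y" if "x \<in> vecs L" "y \<in> vecs L" "lact L a x = lact L a y" for x y
  proof (rule L.norm_diff_eq_0)
    have "lact L a (vdiff L x y) = vzero L"
      using that a by (simp add: vdiff_def lact_L_lin) (simp add: vdiff_def[symmetric] L.diff_self)
    then have "r * (vnorm L (vdiff L x y))\<^sup>2 \<le> 0"
      using pos[of "vdiff L x y"] that by (simp add: L.inner_zero)
    then show "vnorm L (vdiff L x y) = 0"
      using r by (simp add: mult_le_0_iff)
  qed (use that in auto)
  have "restrict f (vecs L) \<in> linear_op L L"
  proof (rule linear_opI)
    show "restrict f (vecs L) (vplus L x y) = vplus L (restrict f (vecs L) x) (restrict f (vecs L) y)"
      if "x \<in> vecs L" "y \<in> vecs L" for x y
      by (rule inj; use that a in \<open>simp add: af lact_L_lin\<close>)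
    show "restrict f (vecs L) (vscale L k x) = vscale L k (restrict f (vecs L) x)" if "x \<in> vecs L" for x k
      by (rule inj; use that a in \<open>simp add: af lact_L_lin\<close>)
  qed auto
  moreover have "vnorm L (restrict f (vecs L) x) \<le> (1 / r) * vnorm L x" if x: "x \<in> vecs L" for x
  proof -
    have "r * (vnorm L (f x))\<^sup>2 \<le> Re (vinner L (f x) x)"
      using pos[of "f x"] af x by simp
    also have "\<dots> \<le> vnorm L (f x) * vnorm L x"
      using L.cauchy_schwarz[of "f x" x] complex_Re_le_cmod[of "vinner L (f x) x"] x by simp
    finally have le: "(r * vnorm L (f x)) * vnorm L (f x) \<le> vnorm L x * vnorm L (f x)"
      by (simp add: power2_eq_square mult_ac)
    have "0 \<le> vnorm L (f x)"
      using x by simp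
    then consider "vnorm L (f x) = 0" | "vnorm L (f x) > 0"
      by linarith
    then have "r * vnorm L (f x) \<le> vnorm L x"
      using mult_right_le_imp_le[OF le] x by cases auto
    then show ?thesis
      using x r by (simp add: pos_le_divide_eq mult.commute)
  qed
  ultimately have fb: "restrict f (vecs L) \<in> bounded_op L L"
    unfolding bounded_op_def by blast
  have "right_linear M L L (restrict f (vecs L))"
    unfolding right_linear_def
  proof (intro ballI)
    fix x d assume x: "x \<in> vecs L" and d: "d \<in> elts M"
    have fx: "lact L a (ract L (f x) d) = ract L x d"
      using L_bimodule x d a af unfolding wstar_bimodule_def by (metis fc)
    show "restrict f (vecs L) (ract L x d) = ract L (restrict f (vecs L) x) d"
      by (rule inj; use x d fx in \<open>simp add: af\<close>)
  qed
  then obtain b where b: "b \<in> elts M" and fb: "\<And>x. x \<in> vecs L \<Longrightarrow> restrict f (vecs L) x = lact L b x"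
    using End_L[OF fb] by blast
  have ab: "lact L a (lact L b x) = x" if "x \<in> vecs L" for x
    using fb[OF that] af[OF that] that by simp
  have ba: "lact L b (lact L a x) = x" if "x \<in> vecs L" for x
    by (rule inj; use that a b ab in simp)
  show thesis
  proof (rule that[OF b])
    show "vn_mult M a b = op_id (base M)" "vn_mult M b a = op_id (base M)"
      using a b ab ba by (auto intro!: elts_ext simp: lact_L_simps)
    show "vn_star M b = b"
    proof (rule elts_extI)
      fix x y assume x: "x \<in> vecs L" and y: "y \<in> vecs L"
      have "vinner L y (lact L (vn_star M b) x) = vinner L (lact L b y) x"
        using star_rep_inner[OF L_rep L.semi_inner_axioms b y x] by simp
      also have "\<dots> = vinner L (lact L b y) (lact L a (lact L b x))"
        using ab x by simp
      also have "\<dots> = vinner L y (lact L b x)"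
        using sym[of "lact L b y" "lact L b x"] ab x y b by simp
      finally show "vinner L y (lact L (vn_star M b) x) = vinner L y (lact L b x)" .
    qed (use b in auto)
  qed
qed

text \<open>
  A bounded \<open>*\<close>-representation maps inverses to inverses. If \<open>-r\<close> with \<open>r > 0\<close> were the greatest
  lower bound of \<open>a\<close> on \<open>V\<close>, then the inverse of \<open>a + r\<close> in \<open>M\<close> would act on \<open>V\<close> and push this
  bound up.
\<close>

lemma positive_transfer:
  assumes V: "semi_inner V" and \<rho>: "star_rep M V \<rho>" and a: "a \<in> elts M" and sa: "vn_star M a = a"
    and pos: "\<And>x. x \<in> vecs L \<Longrightarrow> 0 \<le> Re (vinner L x (lact L a x))" and x: "x \<in> vecs V"
  shows "0 \<le> Re (vinner V x (\<rho> a x))"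
proof -
  interpret V: semi_inner V by fact
  note \<rho>c [simp] = star_rep_lin(1)[OF \<rho> _ V]
  \<comment> \<open>The condition r \<ge> 0 keeps the infimum finite, also when all vectors of V are
    null. The goal is that this infimum is 0.\<close>
  define S where "S = {r. r \<ge> 0 \<and> (\<forall>x\<in>vecs V. - r * (vnorm V x)\<^sup>2 \<le> Re (vinner V x (\<rho> a x)))}"
  define r0 where "r0 = Inf S"
  obtain c where c: "c > 0" "\<And>x. x \<in> vecs V \<Longrightarrow> vnorm V (restrict (\<rho> a) (vecs V) x) \<le> c * vnorm V x"
    using bounded_opE[OF star_repD(1)[OF \<rho> a] V V] by blast
  have "- c * (vnorm V x)\<^sup>2 \<le> Re (vinner V x (\<rho> a x))" if x: "x \<in> vecs V" for x
  proof -
    have "\<bar>Re (vinner V x (\<rho> a x))\<bar> \<le> vnorm V x * vnorm V (\<rho> a x)"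
      using V.cauchy_schwarz[of x "\<rho> a x"] abs_Re_le_cmod[of "vinner V x (\<rho> a x)"] x a by simp
    also have "\<dots> \<le> vnorm V x * (c * vnorm V x)"
      using c(2)[OF x] x by (intro mult_left_mono) auto
    finally have "\<bar>Re (vinner V x (\<rho> a x))\<bar> \<le> c * (vnorm V x)\<^sup>2"
      by (simp add: power2_eq_square mult_ac)
    then show ?thesis
      by linarith
  qed
  then have ne: "S \<noteq> {}"
    using c(1) by (auto simp: S_def intro!: exI[of _ c])
  have bdd: "bdd_below S"
    by (rule bdd_belowI[of _ 0]) (simp add: S_def)
  have r0: "r0 \<ge> 0"
    unfolding r0_def using ne by (intro cInf_greatest) (auto simp: S_def)
  have r0S: "- r0 * (vnorm V x)\<^sup>2 \<le> Re (vinner V x (\<rho> a x))" if x: "x \<in> vecs V" for x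
  proof -
    have "- Re (vinner V x (\<rho> a x)) - r0 * (vnorm V x)\<^sup>2 \<le> (vnorm V x)\<^sup>2 * e" if e: "e > 0" for e
    proof -
      obtain r where r: "r \<in> S" "r < r0 + e"
        using cInf_lessD[OF ne, of "r0 + e"] e by (auto simp: r0_def)
      have "- Re (vinner V x (\<rho> a x)) \<le> r * (vnorm V x)\<^sup>2"
        using r(1) x by (auto simp: S_def)
      also have "\<dots> \<le> (r0 + e) * (vnorm V x)\<^sup>2"
        using r(2) by (intro mult_right_mono) auto
      finally show ?thesis
        by (simp add: algebra_simps)
    qed
    then have "- Re (vinner V x (\<rho> a x)) - r0 * (vnorm V x)\<^sup>2 \<le> 0"
      by (rule le_zero_by_epsilon)
    then show ?thesis
      by simp
  qed
  have "r0 = 0"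
  proof (rule ccontr)
    assume "r0 \<noteq> 0"
    with r0 have r0p: "r0 > 0"
      by simp
    let ?p = "op_plus (base M) a (op_scale (base M) (of_real r0) (op_id (base M)))"
    have p: "?p \<in> elts M"
      using a by simp
    have lp: "lact L ?p x = vplus L (lact L a x) (vscale L (of_real r0) x)" if "x \<in> vecs L" for x
      using a that by (simp add: lact_L_simps)
    have sp: "vn_star M ?p = ?p"
    proof (rule elts_extI)
      fix x y assume x: "x \<in> vecs L" and y: "y \<in> vecs L"
      have "vinner L y (lact L (vn_star M ?p) x) = vinner L (lact L ?p y) x"
        using star_rep_inner[OF L_rep L.semi_inner_axioms p y x] by simp
      also have "\<dots> = vinner L y (lact L ?p x)"
        using x y a sa star_rep_inner[OF L_rep L.semi_inner_axioms a y x] by (simp add: lp L.inner_simps)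
      finally show "vinner L y (lact L (vn_star M ?p) x) = vinner L y (lact L ?p x)" .
    qed (use p in auto)
    have "r0 * (vnorm L x)\<^sup>2 \<le> Re (vinner L x (lact L ?p x))" if "x \<in> vecs L" for x
      using pos[OF that] that a by (simp add: lp L.inner_simps L.norm_sq)
    then obtain b where b: "b \<in> elts M" and sb: "vn_star M b = b"
      and pb: "vn_mult M ?p b = op_id (base M)" and bp: "vn_mult M b ?p = op_id (base M)"
      using inverse_exists[OF p sp r0p] by blast
    have pp: "\<rho> ?p x = vplus V (\<rho> a x) (vscale V (of_real r0) x)" if "x \<in> vecs V" for x
      using a that by (simp add: star_repD[OF \<rho>])
    have \<rho>pb: "\<rho> ?p (\<rho> b x) = x" if "x \<in> vecs V" for x
      using star_repD(6)[OF \<rho> p b that] pb star_repD(2)[OF \<rho> that] by simp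
    have \<rho>bp: "\<rho> b (\<rho> ?p x) = x" if "x \<in> vecs V" for x
      using star_repD(6)[OF \<rho> b p that] bp star_repD(2)[OF \<rho> that] by simp
    have symb: "vinner V (\<rho> b x) y = vinner V x (\<rho> b y)" if "x \<in> vecs V" "y \<in> vecs V" for x y
      using star_rep_inner[OF \<rho> V b that] sb by simp
    have symp: "vinner V (\<rho> ?p x) y = vinner V x (\<rho> ?p y)" if "x \<in> vecs V" "y \<in> vecs V" for x y
      using star_rep_inner[OF \<rho> V p that] sp by simp
    have ppos: "0 \<le> Re (vinner V x (\<rho> ?p x))" if "x \<in> vecs V" for x
      using r0S[OF that] that a by (simp add: pp V.inner_simps V.norm_sq)
    \<comment> \<open>Positivity of b comes from that of p = a + r0: since p b = 1 and b is
      symmetric, \<langle>x, b x\<rangle> = \<langle>b x, p b x\<rangle>.\<close>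
    have bpos: "0 \<le> Re (vinner V x (\<rho> b x))" if "x \<in> vecs V" for x
      using ppos[of "\<rho> b x"] that b by (simp add: \<rho>pb symb)
    obtain B where B: "B > 0" "\<And>x. x \<in> vecs V \<Longrightarrow> vnorm V (restrict (\<rho> b) (vecs V) x) \<le> B * vnorm V x"
      using bounded_opE[OF star_repD(1)[OF \<rho> b] V V] by blast
    \<comment> \<open>Positivity of b at y = (p - s) x expands to \<langle>x, p x\<rangle> - 2 s
      |x|^2 + s^2 \<langle>x, b x\<rangle> \<ge> 0. With s = 1 / B and \<langle>x, b x\<rangle>
      \<le> B |x|^2 this leaves p \<ge> 1 / B: the bound on the inverse becomes a lower bound on
      p.\<close>
    have gap: "(1 / B) * (vnorm V x)\<^sup>2 \<le> Re (vinner V x (\<rho> ?p x))" if x: "x \<in> vecs V" for x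
    proof -
      define s where "s = 1 / B"
      let ?y = "vdiff V (\<rho> ?p x) (vscale V (of_real s) x)"
      have px: "\<rho> ?p x \<in> vecs V"
        using p x by simp
      have y: "?y \<in> vecs V"
        using px x by simp
      have "vinner V ?y (\<rho> b ?y) = vinner V (\<rho> b ?y) ?y"
        using symb[OF y y] by simp
      have rb: "\<rho> b ?y = vdiff V x (vscale V (of_real s) (\<rho> b x))"
        using x px b by (simp add: vdiff_def star_rep_lin[OF \<rho> b V] \<rho>bp V.scale_scale mult.commute)
      have 1: "vinner V (\<rho> ?p x) (\<rho> b x) = vinner V x x"
        using symb[OF px x] \<rho>bp[OF x] by simp
      have "0 \<le> Re (vinner V ?y (\<rho> b ?y))"
        by (rule bpos[OF y])
      also have "\<dots> = Re (vinner V x (\<rho> ?p x)) - 2 * s * (vnorm V x)\<^sup>2 + s\<^sup>2 * Re (vinner V x (\<rho> b x))"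
        unfolding rb using x b px 1 symp[OF x x]
        by (simp add: V.inner_simps V.norm_sq[OF x, unfolded power2_eq_square] power2_eq_square algebra_simps)
      finally have "2 * s * (vnorm V x)\<^sup>2 - s\<^sup>2 * Re (vinner V x (\<rho> b x)) \<le> Re (vinner V x (\<rho> ?p x))"
        by simp
      moreover have "s\<^sup>2 * Re (vinner V x (\<rho> b x)) \<le> s * (vnorm V x)\<^sup>2"
      proof -
        have "Re (vinner V x (\<rho> b x)) \<le> vnorm V x * vnorm V (\<rho> b x)"
          using V.cauchy_schwarz[of x "\<rho> b x"] complex_Re_le_cmod[of "vinner V x (\<rho> b x)"] x b by simp
        also have "\<dots> \<le> vnorm V x * (B * vnorm V x)"
          using B(2)[OF x] x by (intro mult_left_mono) auto
        finally have "s\<^sup>2 * Re (vinner V x (\<rho> b x)) \<le> s\<^sup>2 * (vnorm V x * (B * vnorm V x))"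
          by (intro mult_left_mono) auto
        also have "\<dots> = s * (vnorm V x)\<^sup>2"
          using B(1) by (simp add: s_def power2_eq_square)
        finally show ?thesis .
      qed
      ultimately show ?thesis
        by (simp add: s_def)
    qed
    \<comment> \<open>The gap 1 / B may exceed r0; the minimum keeps r0 - d nonnegative, as
      membership in \<open>S\<close> demands.\<close>
    define d where "d = min r0 (1 / B)"
    have d: "d > 0" "d \<le> r0" "d \<le> 1 / B"
      using r0p B(1) by (auto simp: d_def)
    have "- (r0 - d) * (vnorm V x)\<^sup>2 \<le> Re (vinner V x (\<rho> a x))" if x: "x \<in> vecs V" for x
    proof -
      have "d * (vnorm V x)\<^sup>2 \<le> (1 / B) * (vnorm V x)\<^sup>2"
        using d by (intro mult_right_mono) auto
      also have "\<dots> \<le> Re (vinner V x (\<rho> a x)) + r0 * (vnorm V x)\<^sup>2"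
        using gap[OF x] x a by (simp add: pp V.inner_simps V.norm_sq)
      finally show ?thesis
        by (simp add: algebra_simps)
    qed
    then have "r0 - d \<in> S"
      unfolding S_def using d by (intro CollectI conjI ballI) (simp, blast)
    then have "r0 \<le> r0 - d"
      unfolding r0_def by (rule cInf_lower[OF _ bdd])
    then show False
      using d by simp
  qed
  then show ?thesis
    using r0S[OF x] by simp
qed

end

section \<open>Positive matrices over the algebra\<close>

definition mat_pos ::
    "('a, 'z) inner_space_scheme \<Rightarrow> ('m \<Rightarrow> 'a \<Rightarrow> 'a) \<Rightarrow> 'i set \<Rightarrow> ('i \<Rightarrow> 'i \<Rightarrow> 'm) \<Rightarrow> bool" where
  "mat_pos V \<rho> I T \<longleftrightarrow> (\<forall>x. (\<forall>i\<in>I. x i \<in> vecs V) \<longrightarrow>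
     0 \<le> Re (\<Sum>i\<in>I. \<Sum>j\<in>I. vinner V (x i) (\<rho> (T i j) (x j))))"

context standard_state
begin

lemma star_rep_inner_sa:
  assumes "star_rep M V \<rho>" and "semi_inner V" and "a \<in> elts M" and "vn_star M a = b"
    and "x \<in> vecs V" and "y \<in> vecs V"
  shows "vinner V (\<rho> a x) y = vinner V x (\<rho> b y)"
  using star_rep_inner[of V \<rho> a x y] assms by simp

lemma star_extI:
  assumes "a \<in> elts M" and "b \<in> elts M"
    and "\<And>x y. \<lbrakk>x \<in> vecs L; y \<in> vecs L\<rbrakk> \<Longrightarrow> vinner L (lact L a y) x = vinner L y (lact L b x)"
  shows "vn_star M a = b"
  using assms by (intro elts_extI) (simp_all add: star_rep_inner[OF L_rep L.semi_inner_axioms, symmetric])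

text \<open>Completing the square in the variable x n. With p = T n n + \<epsilon>, its inverse b
  and v standing for the sum of T n j x j, the form splits into the value of p at x n + b v and the
  form of the Schur complement \<open>S\<close>. The identity is algebraic and holds in every
  representation, which allows its use on L2 and on V alike; \<epsilon> is there to make p
  invertible.\<close>

lemma schur_identity:
  fixes V :: "('v, 'y) inner_space_scheme" and \<rho> :: "('b \<Rightarrow> 'b) \<Rightarrow> 'v \<Rightarrow> 'v"
    and T :: "'i \<Rightarrow> 'i \<Rightarrow> 'b \<Rightarrow> 'b" and \<epsilon> :: complex
  assumes V: "semi_inner V" and \<rho>: "star_rep M V \<rho>" and I: "finite I" "n \<notin> I"
    and T: "\<And>i j. \<lbrakk>i \<in> insert n I; j \<in> insert n I\<rbrakk> \<Longrightarrow> T i j \<in> elts M"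
    and sT: "\<And>i j. \<lbrakk>i \<in> insert n I; j \<in> insert n I\<rbrakk> \<Longrightarrow> vn_star M (T i j) = T j i"
    and p: "p = op_plus (base M) (T n n) (op_scale (base M) \<epsilon> (op_id (base M)))"
    and b: "b \<in> elts M" "vn_star M b = b"
    and pb: "vn_mult M p b = op_id (base M)" and bp: "vn_mult M b p = op_id (base M)"
    and S: "\<And>i j. S i j = op_plus (base M) (T i j)
      (op_scale (base M) (- 1) (vn_mult M (T i n) (vn_mult M b (T n j))))"
    and x: "\<And>i. i \<in> insert n I \<Longrightarrow> x i \<in> vecs V"
    and v: "v \<in> vecs V" "\<And>y. y \<in> vecs V \<Longrightarrow> vinner V y v = (\<Sum>j\<in>I. vinner V y (\<rho> (T n j) (x j)))"
  shows "(\<Sum>i\<in>insert n I. \<Sum>j\<in>insert n I. vinner V (x i) (\<rho> (T i j) (x j))) + \<epsilon> * vinner V (x n) (x n) =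
    vinner V (vplus V (x n) (\<rho> b v)) (\<rho> p (vplus V (x n) (\<rho> b v)))
    + (\<Sum>i\<in>I. \<Sum>j\<in>I. vinner V (x i) (\<rho> (S i j) (x j)))"
proof -
  interpret V: semi_inner V by fact
  note [simp] = star_rep_lin(1)[OF \<rho> _ V] b(1)
  have Tc [simp]: "T i j \<in> elts M" if "i = n \<or> i \<in> I" "j = n \<or> j \<in> I" for i j
    using T that by auto
  have xc [simp]: "x i \<in> vecs V" if "i = n \<or> i \<in> I" for i
    using x that by auto
  have pe [simp]: "p \<in> elts M"
    by (simp add: p)
  have \<rho>p: "\<rho> p y = vplus V (\<rho> (T n n) y) (vscale V \<epsilon> y)" if "y \<in> vecs V" for y
    using that by (simp add: p star_repD[OF \<rho>])
  have \<rho>pb: "\<rho> p (\<rho> b y) = y" if "y \<in> vecs V" for y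
    using star_repD(6)[OF \<rho> pe b(1) that] pb star_repD(2)[OF \<rho> that] by simp
  have \<rho>bp: "\<rho> b (\<rho> p y) = y" if "y \<in> vecs V" for y
    using star_repD(6)[OF \<rho> b(1) pe that] bp star_repD(2)[OF \<rho> that] by simp
  have symb: "vinner V (\<rho> b y) z = vinner V y (\<rho> b z)" if "y \<in> vecs V" "z \<in> vecs V" for y z
    using star_rep_inner_sa[OF \<rho> V b that] .
  have symT: "vinner V (\<rho> (T i j) y) z = vinner V y (\<rho> (T j i) z)"
    if "i = n \<or> i \<in> I" "j = n \<or> j \<in> I" "y \<in> vecs V" "z \<in> vecs V" for i j y z
  proof -
    have "T i j \<in> elts M" "vn_star M (T i j) = T j i"
      using T sT that by auto
    then show ?thesis
      using star_rep_inner_sa[OF \<rho> V _ _ that(3,4)] by blast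
  qed
  have v': "vinner V v y = (\<Sum>i\<in>I. vinner V (x i) (\<rho> (T i n) y))" if y: "y \<in> vecs V" for y
  proof -
    have "vinner V v y = cnj (vinner V y v)"
      using V.inner_commute[OF y v(1)] .
    also have "\<dots> = (\<Sum>i\<in>I. vinner V (\<rho> (T n i) (x i)) y)"
      unfolding v(2)[OF y] cnj_sum using y V.inner_commute[OF y] by (intro sum.cong) auto
    also have "\<dots> = (\<Sum>i\<in>I. vinner V (x i) (\<rho> (T i n) y))"
      using y by (intro sum.cong) (auto simp: symT)
    finally show ?thesis .
  qed
  have vbv: "vinner V v (\<rho> b v) = (\<Sum>i\<in>I. \<Sum>j\<in>I. vinner V (x i) (\<rho> (T i n) (\<rho> b (\<rho> (T n j) (x j)))))"
  proof -
    have "vinner V v (\<rho> b v) = vinner V (\<rho> b v) v"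
      using v(1) by (simp add: symb)
    also have "\<dots> = (\<Sum>j\<in>I. vinner V v (\<rho> b (\<rho> (T n j) (x j))))"
      using v(1) by (simp add: v(2) symb)
    also have "\<dots> = (\<Sum>j\<in>I. \<Sum>i\<in>I. vinner V (x i) (\<rho> (T i n) (\<rho> b (\<rho> (T n j) (x j)))))"
      by (intro sum.cong refl v') simp
    also have "\<dots> = (\<Sum>i\<in>I. \<Sum>j\<in>I. vinner V (x i) (\<rho> (T i n) (\<rho> b (\<rho> (T n j) (x j)))))"
      by (rule sum.swap)
    finally show ?thesis .
  qed
  have \<rho>S: "vinner V (x i) (\<rho> (S i j) (x j)) =
      vinner V (x i) (\<rho> (T i j) (x j)) - vinner V (x i) (\<rho> (T i n) (\<rho> b (\<rho> (T n j) (x j))))"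
    if "i \<in> I" "j \<in> I" for i j
    using that by (simp add: S star_repD[OF \<rho>] V.inner_simps)
  have "vinner V (vplus V (x n) (\<rho> b v)) (\<rho> p (vplus V (x n) (\<rho> b v))) =
      vinner V (vplus V (x n) (\<rho> b v)) (vplus V (\<rho> p (x n)) v)"
    using v(1) by (simp add: star_rep_lin(2)[OF \<rho> pe V] \<rho>pb)
  also have "\<dots> = vinner V (x n) (\<rho> p (x n)) + vinner V (x n) v + vinner V v (x n) + vinner V v (\<rho> b v)"
    using v(1) by (simp add: V.inner_simps symb \<rho>bp)
  also have "\<dots> = vinner V (x n) (\<rho> (T n n) (x n)) + \<epsilon> * vinner V (x n) (x n)
      + (\<Sum>j\<in>I. vinner V (x n) (\<rho> (T n j) (x j))) + (\<Sum>i\<in>I. vinner V (x i) (\<rho> (T i n) (x n)))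
      + (\<Sum>i\<in>I. \<Sum>j\<in>I. vinner V (x i) (\<rho> (T i n) (\<rho> b (\<rho> (T n j) (x j)))))"
    by (simp add: \<rho>p V.inner_simps v(2) v' vbv)
  finally show ?thesis
    using I by (simp add: \<rho>S sum_subtractf sum.distrib)
qed

text \<open>Induction on the index set with the matrix generalised, since the step replaces T by its
  Schur complement. On L2, minimising over x n shows the complement positive; on V, the complement
  is positive by induction and the corner by \<open>positive_transfer\<close>, so the identity read
  backwards bounds the form of T from below up to \<epsilon>.\<close>

lemma mat_pos_transfer:
  fixes V :: "('v, 'y) inner_space_scheme" and \<rho> :: "('b \<Rightarrow> 'b) \<Rightarrow> 'v \<Rightarrow> 'v"
  assumes V: "semi_inner V" and \<rho>: "star_rep M V \<rho>" and "finite I"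
    and "\<And>i j. \<lbrakk>i \<in> I; j \<in> I\<rbrakk> \<Longrightarrow> T i j \<in> elts M"
    and "\<And>i j. \<lbrakk>i \<in> I; j \<in> I\<rbrakk> \<Longrightarrow> vn_star M (T i j) = T j i"
    and "mat_pos L (lact L) I T"
  shows "mat_pos V \<rho> I T"
  using assms(3-)
proof (induction I arbitrary: T)
  case empty
  then show ?case
    by (simp add: mat_pos_def)
next
  case (insert n I T)
  interpret V: semi_inner V by fact
  note T = insert.prems(1) and sT = insert.prems(2) and pos = insert.prems(3)
  note [simp] = star_rep_lin(1)[OF \<rho> _ V]
  have Tc [simp]: "T i j \<in> elts M" if "i = n \<or> i \<in> I" "j = n \<or> j \<in> I" for i j
    using T that by auto
  have Tnn: "0 \<le> Re (vinner L z (lact L (T n n) z))" if z: "z \<in> vecs L" for z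
  proof -
    \<comment> \<open>A test vector supported at n isolates the diagonal entry.\<close>
    let ?x = "\<lambda>i. if i = n then z else vzero L"
    have zero: "vinner L (?x i) (lact L (T i j) (?x j)) = 0" if "i \<in> insert n I" "j \<in> I" for i j
    proof -
      have "j \<noteq> n"
        using insert.hyps that by blast
      moreover have "lact L (T i j) (vzero L) = vzero L"
        using that lact_L_lin(2)[of "T i j" "vzero L" 0] L.scale_zero[of "vzero L"]
          L.scale_zero[of "lact L (T i j) (vzero L)"] by auto
      ultimately show ?thesis
        using that z by (simp add: L.inner_zero)
    qed
    have "0 \<le> Re (\<Sum>i\<in>insert n I. \<Sum>j\<in>insert n I. vinner L (?x i) (lact L (T i j) (?x j)))"
      using pos z unfolding mat_pos_def by auto
    also have "(\<Sum>i\<in>insert n I. \<Sum>j\<in>insert n I. vinner L (?x i) (lact L (T i j) (?x j))) =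
        (\<Sum>i\<in>insert n I. vinner L (?x i) (lact L (T i n) z))"
      using insert.hyps zero by (intro sum.cong refl) (simp del: insert_iff)
    also have "\<dots> = vinner L z (lact L (T n n) z)"
      using insert.hyps z by (auto simp: L.inner_zero_left intro!: sum.neutral)
    finally show ?thesis .
  qed
  show ?case
    unfolding mat_pos_def
  proof (intro allI impI)
    fix x assume x: "\<forall>i\<in>insert n I. x i \<in> vecs V"
    let ?q = "\<Sum>i\<in>insert n I. \<Sum>j\<in>insert n I. vinner V (x i) (\<rho> (T i j) (x j))"
    have "- Re ?q \<le> (vnorm V (x n))\<^sup>2 * \<epsilon>" if \<epsilon>: "\<epsilon> > 0" for \<epsilon>
    proof -
      define p where "p = op_plus (base M) (T n n) (op_scale (base M) (of_real \<epsilon>) (op_id (base M)))"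
      have pe [simp]: "p \<in> elts M"
        by (simp add: p_def)
      have lp: "lact L p y = vplus L (lact L (T n n) y) (vscale L (of_real \<epsilon>) y)" if "y \<in> vecs L" for y
        using that by (simp add: p_def lact_L_simps)
      have sp: "vn_star M p = p"
        by (rule star_extI) (simp_all add: lp L.inner_simps
            star_rep_inner_sa[OF L_rep L.semi_inner_axioms _ sT[of n n]])
      have ppos: "\<epsilon> * (vnorm L y)\<^sup>2 \<le> Re (vinner L y (lact L p y))" if "y \<in> vecs L" for y
        using Tnn[OF that] that by (simp add: lp L.inner_simps L.norm_sq)
      then have ppos': "0 \<le> Re (vinner L y (lact L p y))" if "y \<in> vecs L" for y
        using order_trans[OF _ ppos[OF that], of 0] \<epsilon> by simp
      obtain b where b [simp]: "b \<in> elts M" and sb: "vn_star M b = b"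
        and pb: "vn_mult M p b = op_id (base M)" and bp: "vn_mult M b p = op_id (base M)"
        using inverse_exists[OF pe sp \<epsilon> ppos] by blast
      define S where "S i j = op_plus (base M) (T i j)
        (op_scale (base M) (- 1) (vn_mult M (T i n) (vn_mult M b (T n j))))" for i j
      note schur = schur_identity[where T = T and S = S and p = p and \<epsilon> = "of_real \<epsilon>" and b = b,
          OF _ _ insert.hyps T sT p_def b sb pb bp S_def]
      have Sc: "S i j \<in> elts M" if "i \<in> I" "j \<in> I" for i j
        using that by (simp add: S_def)
      have "mat_pos L (lact L) I S"
        unfolding mat_pos_def
      proof (intro allI impI)
        fix y assume y: "\<forall>i\<in>I. y i \<in> vecs L"
        obtain v where v: "v \<in> vecs L" "\<And>z. z \<in> vecs L \<Longrightarrow> vinner L z v = (\<Sum>j\<in>I. vinner L z (lact L (T n j) (y j)))"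
          using L.sum_vec_exists[OF insert.hyps(1), of "\<lambda>j. lact L (T n j) (y j)"] y by auto
        \<comment> \<open>This entry at n makes the completed square vanish, so the form of
          \<open>S\<close> at y equals that of T at the extended vector plus a nonnegative multiple
          of \<epsilon>.\<close>
        let ?y = "y(n := vscale L (- 1) (lact L b v))"
        let ?q' = "\<Sum>i\<in>insert n I. \<Sum>j\<in>insert n I. vinner L (?y i) (lact L (T i j) (?y j))"
        have yc: "?y i \<in> vecs L" if "i \<in> insert n I" for i
          using that y v(1) by auto
        have v2: "vinner L z v = (\<Sum>j\<in>I. vinner L z (lact L (T n j) (?y j)))" if "z \<in> vecs L" for z
          using insert.hyps v(2)[OF that] by (auto intro!: sum.cong)
        have "vplus L (?y n) (lact L b v) = vzero L"
          using v(1) L.diff_self[of "lact L b v"] L.plus_commute[of "lact L b v"] by (simp add: vdiff_def)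
        then have "vinner L (vplus L (?y n) (lact L b v)) (lact L p (vplus L (?y n) (lact L b v))) = 0"
          by (simp add: L.inner_zero_left)
        then have eq1: "?q' + of_real \<epsilon> * vinner L (?y n) (?y n) = (\<Sum>i\<in>I. \<Sum>j\<in>I. vinner L (?y i) (lact L (S i j) (?y j)))"
          using schur[where V = L and \<rho> = "lact L" and x = ?y and v = v, OF L.semi_inner_axioms L_rep] yc v(1) v2
          by simp
        have eq2: "(\<Sum>i\<in>I. \<Sum>j\<in>I. vinner L (?y i) (lact L (S i j) (?y j))) =
            (\<Sum>i\<in>I. \<Sum>j\<in>I. vinner L (y i) (lact L (S i j) (y j)))"
          using insert.hyps by (intro sum.cong refl) auto
        have "0 \<le> Re ?q'"
          using pos yc unfolding mat_pos_def by blast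
        moreover have "0 \<le> Re (of_real \<epsilon> * vinner L (?y n) (?y n))"
          using \<epsilon> L.Re_inner_self[OF yc, of n] by simp
        ultimately show "0 \<le> Re (\<Sum>i\<in>I. \<Sum>j\<in>I. vinner L (y i) (lact L (S i j) (y j)))"
          unfolding eq2[symmetric] eq1[symmetric] plus_complex.sel by (rule add_nonneg_nonneg)
      qed
      moreover have "vn_star M (S i j) = S j i" if ij: "i \<in> I" "j \<in> I" for i j
      proof (rule star_extI)
        fix y z assume y: "y \<in> vecs L" and z: "z \<in> vecs L"
        note sym = star_rep_inner_sa[OF L_rep L.semi_inner_axioms]
        show "vinner L (lact L (S i j) z) y = vinner L z (lact L (S j i) y)"
          using ij y z by (simp add: S_def lact_L_simps L.inner_simps sym[OF _ sb] sym[OF _ sT])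
      qed (use Sc ij in auto)
      ultimately have SV: "mat_pos V \<rho> I S"
        using Sc by (intro insert.IH) auto
      obtain v where v: "v \<in> vecs V" "\<And>y. y \<in> vecs V \<Longrightarrow> vinner V y v = (\<Sum>j\<in>I. vinner V y (\<rho> (T n j) (x j)))"
        using V.sum_vec_exists[OF insert.hyps(1), of "\<lambda>j. \<rho> (T n j) (x j)"] x by auto
      let ?u = "vplus V (x n) (\<rho> b v)"
      have eq: "?q + of_real \<epsilon> * vinner V (x n) (x n) = vinner V ?u (\<rho> p ?u)
          + (\<Sum>i\<in>I. \<Sum>j\<in>I. vinner V (x i) (\<rho> (S i j) (x j)))"
        using schur[where V = V and \<rho> = \<rho> and x = x and v = v, OF V \<rho>] x v by simp
      have "0 \<le> Re (\<Sum>i\<in>I. \<Sum>j\<in>I. vinner V (x i) (\<rho> (S i j) (x j)))"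
        using SV x unfolding mat_pos_def by auto
      moreover have "0 \<le> Re (vinner V ?u (\<rho> p ?u))"
        using positive_transfer[OF V \<rho> pe sp ppos'] v(1) x by simp
      ultimately have "0 \<le> Re (?q + of_real \<epsilon> * vinner V (x n) (x n))"
        unfolding eq by simp
      then show ?thesis
        using x V.norm_sq[of "x n"] by (simp add: mult.commute del: sum.insert)
    qed
    then have "- Re ?q \<le> 0"
      by (rule le_zero_by_epsilon)
    then show "0 \<le> Re ?q"
      by simp
  qed
qed

end

section \<open>Bounded vectors\<close>

lemma bdd_vecs_closed: "\<xi> \<in> bdd_vecs M \<Omega> H \<Longrightarrow> \<xi> \<in> vecs H"
  by (simp add: bdd_vecs_def)

lemma right_linearD: "\<lbrakk>right_linear M V W T; x \<in> vecs V; a \<in> elts M\<rbrakk> \<Longrightarrow> T (ract V x a) = ract W (T x) a"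
  by (simp add: right_linear_def)

lemma End_rightD:
  assumes "T \<in> End_right M V"
  shows "T \<in> bounded_op V V" and "right_linear M V V T"
  using assms by (simp_all add: End_right_def)

context standard_state
begin

lemma adj_right_linear:
  fixes V :: "('u, 'b \<Rightarrow> 'b, 'y) rmodule_scheme" and W :: "('v, 'b \<Rightarrow> 'b, 'z) rmodule_scheme"
  assumes V: "right_module M V" and W: "right_module M W" and T: "T \<in> bounded_op V W"
    and lin: "right_linear M V W T"
  shows "right_linear M W V (adj V W T)"
  unfolding right_linear_def
proof (intro ballI)
  interpret V: hilbert_space V
    by (rule right_module_hilbert[OF V])
  interpret W: hilbert_space W
    by (rule right_module_hilbert[OF W])
  note adj = adj_char[OF V.hilbert_space_axioms W.semi_inner_axioms T]
  fix y a assume y: "y \<in> vecs W" and a: "a \<in> elts M"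
  show "adj V W T (ract W y a) = ract V (adj V W T y) a"
  proof (rule adj_eqI[OF V.inner_prod_axioms])
    fix z assume z: "z \<in> vecs V"
    have za: "ract V z (vn_star M a) \<in> vecs V"
      using ract_closed[OF V _ z] a by simp
    have "vinner V z (ract V (adj V W T y) a) = vinner V (ract V z (vn_star M a)) (adj V W T y)"
      using ract_inner[OF V a z] adj(1)[OF y] by simp
    also have "\<dots> = vinner W (T (ract V z (vn_star M a))) y"
      by (rule adj(2)[OF y za])
    also have "\<dots> = vinner W (ract W (T z) (vn_star M a)) y"
      using right_linearD[OF lin z, of "vn_star M a"] a by simp
    also have "\<dots> = vinner W (T z) (ract W y a)"
      using ract_inner[OF W a bounded_opD(1)[OF T z] y] by simp
    finally show "vinner V z (ract V (adj V W T y) a) = vinner W (T z) (ract W y a)" .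
  qed (use ract_closed[OF W a y] ract_closed[OF V a] adj(1)[OF y] in auto)
qed

lemma pi_op_eqI:
  fixes H :: "('u, 'b \<Rightarrow> 'b, 'y) rmodule_scheme"
  assumes H: "right_module M H" and T: "T \<in> bounded_op L H"
    and eq: "\<And>a. a \<in> elts M \<Longrightarrow> T (ract L \<Omega> a) = ract H \<xi> a"
  shows "pi_op M \<Omega> H \<xi> = T"
  unfolding pi_op_def
proof (rule the_equality)
  interpret H: hilbert_space H
    by (rule right_module_hilbert[OF H])
  fix S assume "S \<in> bounded_op L H \<and> (\<forall>a\<in>elts M. S (ract L \<Omega> a) = ract H \<xi> a)"
  then show "S = T"
    using T eq by (intro dense_bounded_ext[OF _ _ L.semi_inner_axioms H.inner_prod_axioms _ ract_\<Omega>_dense]) auto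
qed (use T eq in auto)

text \<open>\<phi>-boundedness of \<xi> is exactly the estimate that extends \<Omega>a \<mapsto>
  \<xi>a from the dense set \<Omega>M to L2.\<close>

lemma pi_op_char:
  fixes H :: "('u, 'b \<Rightarrow> 'b, 'y) rmodule_scheme"
  assumes H: "right_module M H" and \<xi>: "\<xi> \<in> bdd_vecs M \<Omega> H"
  shows pi_op_bounded: "pi_op M \<Omega> H \<xi> \<in> bounded_op L H"
    and pi_op_ract: "a \<in> elts M \<Longrightarrow> pi_op M \<Omega> H \<xi> (ract L \<Omega> a) = ract H \<xi> a"
proof -
  interpret H: hilbert_space H
    by (rule right_module_hilbert[OF H])
  have \<xi>c: "\<xi> \<in> vecs H"
    using \<xi> by (rule bdd_vecs_closed)
  obtain c where c: "c > 0" "\<And>a. a \<in> elts M \<Longrightarrow> vnorm H (ract H \<xi> a) \<le> c * vnorm L (ract L \<Omega> a)"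
    using \<xi> by (auto simp: bdd_vecs_def)
  have lin: "\<exists>e\<in>elts M. ract L \<Omega> e = vplus L (ract L \<Omega> a) (vscale L k (ract L \<Omega> b)) \<and>
      ract H \<xi> e = vplus H (ract H \<xi> a) (vscale H k (ract H \<xi> b))" if "a \<in> elts M" "b \<in> elts M" for a b k
    using that \<xi>c by (intro bexI[of _ "op_plus (base M) a (op_scale (base M) k b)"])
      (simp_all add: ract_op_plus[OF L_right] ract_op_scale[OF L_right] ract_op_plus[OF H] ract_op_scale[OF H])
  obtain T where T: "T \<in> bounded_op L H" "\<And>a. a \<in> elts M \<Longrightarrow> T (ract L \<Omega> a) = ract H \<xi> a"
    by (rule bounded_extension[OF L.inner_prod_axioms H.hilbert_space_axioms _ _ lin c(2) _ ract_\<Omega>_dense])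
      (use \<xi>c c(1) ract_closed[OF H] in auto)
  have "pi_op M \<Omega> H \<xi> = T"
    by (rule pi_op_eqI[OF H T])
  with T show "pi_op M \<Omega> H \<xi> \<in> bounded_op L H"
    and "a \<in> elts M \<Longrightarrow> pi_op M \<Omega> H \<xi> (ract L \<Omega> a) = ract H \<xi> a"
    by auto
qed

lemma pi_op_\<Omega>:
  fixes H :: "('u, 'b \<Rightarrow> 'b, 'y) rmodule_scheme"
  assumes H: "right_module M H" and \<xi>: "\<xi> \<in> bdd_vecs M \<Omega> H"
  shows "pi_op M \<Omega> H \<xi> \<Omega> = \<xi>"
  using pi_op_ract[OF assms, of "op_id (base M)"] bdd_vecs_closed[OF \<xi>]
  by (simp add: ract_id[OF L_right] ract_id[OF H])

lemma pi_op_right_linear: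
  fixes H :: "('u, 'b \<Rightarrow> 'b, 'y) rmodule_scheme"
  assumes H: "right_module M H" and \<xi>: "\<xi> \<in> bdd_vecs M \<Omega> H"
  shows "right_linear M L H (pi_op M \<Omega> H \<xi>)"
  unfolding right_linear_def
proof (intro ballI)
  interpret H: hilbert_space H
    by (rule right_module_hilbert[OF H])
  note pib = pi_op_bounded[OF assms]
  fix x a assume x: "x \<in> vecs L" and a: "a \<in> elts M"
  let ?p = "pi_op M \<Omega> H \<xi>"
  have "compose (vecs L) ?p (\<lambda>x\<in>vecs L. ract L x a) = compose (vecs L) (\<lambda>y\<in>vecs H. ract H y a) ?p"
  proof (rule dense_bounded_ext[OF _ _ L.semi_inner_axioms H.inner_prod_axioms _ ract_\<Omega>_dense])
    show "compose (vecs L) ?p (\<lambda>x\<in>vecs L. ract L x a) \<in> bounded_op L H"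
      by (rule compose_bounded[OF pib ract_bounded[OF L_right a]]) unfold_locales
    show "compose (vecs L) (\<lambda>y\<in>vecs H. ract H y a) ?p \<in> bounded_op L H"
      by (rule compose_bounded[OF ract_bounded[OF H a] pib]) unfold_locales
    fix y assume "y \<in> ract L \<Omega> ` elts M"
    then obtain b where b: "b \<in> elts M" "y = ract L \<Omega> b"
      by blast
    have "?p (ract L (ract L \<Omega> b) a) = ract H (?p (ract L \<Omega> b)) a"
      using pi_op_ract[OF assms, of "vn_mult M b a"] pi_op_ract[OF assms b(1)] a b(1) bdd_vecs_closed[OF \<xi>]
      by (simp add: ract_mult[OF L_right] ract_mult[OF H])
    then show "compose (vecs L) ?p (\<lambda>x\<in>vecs L. ract L x a) y = compose (vecs L) (\<lambda>y\<in>vecs H. ract H y a) ?p y"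
      using b a bounded_opD(1)[OF pib] by (simp add: compose_def)
  qed (use ract_L in auto)
  from fun_cong[OF this, of x] show "?p (ract L x a) = ract H (?p x) a"
    using x a bounded_opD(1)[OF pib x] by (simp add: compose_def)
qed

text \<open>Together with \<open>pi_op_\<Omega>\<close> this makes T \<mapsto> T \<Omega> a
  bijection from the bounded right linear operators on L2 with values in H onto the \<phi>-bounded
  vectors. Membership of a vector and its \<pi> are obtained below by exhibiting such an
  operator.\<close>

lemma bdd_vecsI:
  fixes H :: "('u, 'b \<Rightarrow> 'b, 'y) rmodule_scheme"
  assumes H: "right_module M H" and T: "T \<in> bounded_op L H" and lin: "right_linear M L H T"
  shows "T \<Omega> \<in> bdd_vecs M \<Omega> H" and "pi_op M \<Omega> H (T \<Omega>) = T"
proof -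
  interpret H: hilbert_space H
    by (rule right_module_hilbert[OF H])
  obtain c where c: "c > 0" "\<And>x. x \<in> vecs L \<Longrightarrow> vnorm H (T x) \<le> c * vnorm L x"
    using bounded_opE[OF T L.semi_inner_axioms H.semi_inner_axioms] by blast
  have "vnorm H (ract H (T \<Omega>) a) \<le> c * vnorm L (ract L \<Omega> a)" if "a \<in> elts M" for a
    using c(2)[of "ract L \<Omega> a"] right_linearD[OF lin \<Omega>_closed that] that by simp
  then show "T \<Omega> \<in> bdd_vecs M \<Omega> H"
    using c(1) bounded_opD(1)[OF T \<Omega>_closed] by (auto simp: bdd_vecs_def)
  show "pi_op M \<Omega> H (T \<Omega>) = T"
    using right_linearD[OF lin \<Omega>_closed] by (intro pi_op_eqI[OF H T])
qed

lemma bdd_vecs_image: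
  fixes H :: "('u, 'b \<Rightarrow> 'b, 'y) rmodule_scheme" and K :: "('v, 'b \<Rightarrow> 'b, 'z) rmodule_scheme"
  assumes H: "right_module M H" and K: "right_module M K" and T: "T \<in> bounded_op H K"
    and lin: "right_linear M H K T" and \<xi>: "\<xi> \<in> bdd_vecs M \<Omega> H"
  shows "T \<xi> \<in> bdd_vecs M \<Omega> K" and "pi_op M \<Omega> K (T \<xi>) = compose (vecs L) T (pi_op M \<Omega> H \<xi>)"
proof -
  interpret H: hilbert_space H
    by (rule right_module_hilbert[OF H])
  interpret K: hilbert_space K
    by (rule right_module_hilbert[OF K])
  let ?S = "compose (vecs L) T (pi_op M \<Omega> H \<xi>)"
  note pib = pi_op_bounded[OF H \<xi>]
  have S: "?S \<in> bounded_op L K"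
    by (rule compose_bounded[OF T pib]) unfold_locales
  have "right_linear M L K ?S"
    unfolding right_linear_def
    using right_linearD[OF pi_op_right_linear[OF H \<xi>]] right_linearD[OF lin] bounded_opD(1)[OF pib]
    by (simp add: compose_def)
  note S' = bdd_vecsI[OF K S this]
  have "?S \<Omega> = T \<xi>"
    by (simp add: compose_def pi_op_\<Omega>[OF H \<xi>])
  with S' show "T \<xi> \<in> bdd_vecs M \<Omega> K" and "pi_op M \<Omega> K (T \<xi>) = ?S"
    by simp_all
qed

section \<open>The M-valued inner product of bounded vectors and its Gram matrices\<close>

context
  fixes H :: "('u, 'b \<Rightarrow> 'b, 'y) rmodule_scheme"
  assumes H: "right_module M H"
begin

lemma pi_prod_bounded:
  assumes "\<xi> \<in> bdd_vecs M \<Omega> H" and "\<eta> \<in> bdd_vecs M \<Omega> H"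
  shows "pi_prod M \<Omega> H \<xi> \<eta> \<in> bounded_op L L" and "right_linear M L L (pi_prod M \<Omega> H \<xi> \<eta>)"
proof -
  interpret H: hilbert_space H
    by (rule right_module_hilbert[OF H])
  note b = pi_op_bounded[OF H assms(1)] pi_op_bounded[OF H assms(2)]
  note ab = adj_bounded[OF L.hilbert_space_axioms H.semi_inner_axioms b(1)]
  show "pi_prod M \<Omega> H \<xi> \<eta> \<in> bounded_op L L"
    unfolding pi_prod_def by (rule compose_bounded[OF ab b(2)]) unfold_locales
  show "right_linear M L L (pi_prod M \<Omega> H \<xi> \<eta>)"
    unfolding pi_prod_def right_linear_def
    using right_linearD[OF pi_op_right_linear[OF H assms(2)]] bounded_opD(1)[OF b(2)]
      right_linearD[OF adj_right_linear[OF L_right H b(1) pi_op_right_linear[OF H assms(1)]]]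
    by (simp add: compose_def)
qed

text \<open>The operator \<open>pi_prod M \<Omega> H \<xi> \<eta>\<close> is bounded and right
  linear, so \<open>End_L\<close> supplies the element of M. It is unique because M acts faithfully
  on L2.\<close>

lemma m_inner_char:
  assumes \<xi>: "\<xi> \<in> bdd_vecs M \<Omega> H" and \<eta>: "\<eta> \<in> bdd_vecs M \<Omega> H"
  shows m_inner_closed: "m_inner M \<Omega> H \<xi> \<eta> \<in> elts M"
    and lact_m_inner: "x \<in> vecs L \<Longrightarrow> lact L (m_inner M \<Omega> H \<xi> \<eta>) x = pi_prod M \<Omega> H \<xi> \<eta> x"
proof -
  note b = pi_prod_bounded[OF assms]
  obtain a where a: "a \<in> elts M" "\<And>x. x \<in> vecs L \<Longrightarrow> pi_prod M \<Omega> H \<xi> \<eta> x = lact L a x"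
    using End_L[OF b] by blast
  have "m_inner M \<Omega> H \<xi> \<eta> = a"
    unfolding m_inner_def
  proof (rule the_equality)
    have "restrict (lact L a) (vecs L) x = pi_prod M \<Omega> H \<xi> \<eta> x" for x
      using a(2)[of x] bounded_opD(4)[OF b(1), of x] by (cases "x \<in> vecs L") simp_all
    then show "a \<in> elts M \<and> restrict (lact L a) (vecs L) = pi_prod M \<Omega> H \<xi> \<eta>"
      using a(1) by blast
    fix a' assume a': "a' \<in> elts M \<and> restrict (lact L a') (vecs L) = pi_prod M \<Omega> H \<xi> \<eta>"
    then have "lact L a' x = lact L a x" if "x \<in> vecs L" for x
      using a(2)[OF that] that by (metis restrict_apply')
    then show "a' = a"
      using a(1) a' by (intro elts_ext) auto
  qed
  with a show "m_inner M \<Omega> H \<xi> \<eta> \<in> elts M"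
    and "x \<in> vecs L \<Longrightarrow> lact L (m_inner M \<Omega> H \<xi> \<eta>) x = pi_prod M \<Omega> H \<xi> \<eta> x"
    by auto
qed

lemma m_inner_inner:
  assumes \<xi>: "\<xi> \<in> bdd_vecs M \<Omega> H" and \<eta>: "\<eta> \<in> bdd_vecs M \<Omega> H" and x: "x \<in> vecs L" and y: "y \<in> vecs L"
  shows "vinner L x (lact L (m_inner M \<Omega> H \<xi> \<eta>) y) = vinner H (pi_op M \<Omega> H \<xi> x) (pi_op M \<Omega> H \<eta> y)"
proof -
  interpret H: hilbert_space H
    by (rule right_module_hilbert[OF H])
  have "pi_op M \<Omega> H \<eta> y \<in> vecs H"
    by (rule bounded_opD(1)[OF pi_op_bounded[OF H \<eta>] y])
  then show ?thesis
    using adj_inner[OF L.hilbert_space_axioms H.semi_inner_axioms pi_op_bounded[OF H \<xi>] _ x] y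
    by (simp add: lact_m_inner[OF \<xi> \<eta>] pi_prod_def compose_def)
qed

lemma star_m_inner:
  assumes \<xi>: "\<xi> \<in> bdd_vecs M \<Omega> H" and \<eta>: "\<eta> \<in> bdd_vecs M \<Omega> H"
  shows "vn_star M (m_inner M \<Omega> H \<xi> \<eta>) = m_inner M \<Omega> H \<eta> \<xi>"
proof (rule star_extI[OF m_inner_closed[OF \<xi> \<eta>] m_inner_closed[OF \<eta> \<xi>]])
  interpret H: hilbert_space H
    by (rule right_module_hilbert[OF H])
  fix x y assume x: "x \<in> vecs L" and y: "y \<in> vecs L"
  note [simp] = m_inner_closed[OF \<xi> \<eta>] bounded_opD(1)[OF pi_op_bounded[OF H \<xi>]] bounded_opD(1)[OF pi_op_bounded[OF H \<eta>]]
  show "vinner L (lact L (m_inner M \<Omega> H \<xi> \<eta>) y) x = vinner L y (lact L (m_inner M \<Omega> H \<eta> \<xi>) x)"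
    using x y L.inner_commute[of x "lact L (m_inner M \<Omega> H \<xi> \<eta>) y"]
      H.inner_commute[of "pi_op M \<Omega> H \<xi> x" "pi_op M \<Omega> H \<eta> y"]
    by (simp add: m_inner_inner \<xi> \<eta>)
qed

text \<open>The vector w stands for the sum of \<pi>(\<xi> i) (x i), and \<pi>(S \<xi>) = S
  \<pi>(\<xi>), so the quadratic form of the Gram matrix is the square norm of S w. The identity S
  gives positivity of Gram matrices; a general S gives the estimate for S \<otimes> 1.\<close>

lemma m_inner_mat:
  assumes "finite I" and \<xi>: "\<And>i. i \<in> I \<Longrightarrow> \<xi> i \<in> bdd_vecs M \<Omega> H" and x: "\<And>i. i \<in> I \<Longrightarrow> x i \<in> vecs L"
    and S: "S \<in> End_right M H"
    and w: "w \<in> vecs H" "\<And>y. y \<in> vecs H \<Longrightarrow> vinner H y w = (\<Sum>i\<in>I. vinner H y (pi_op M \<Omega> H (\<xi> i) (x i)))"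
  shows "(\<Sum>i\<in>I. \<Sum>j\<in>I. vinner L (x i) (lact L (m_inner M \<Omega> H (S (\<xi> i)) (S (\<xi> j))) (x j))) = vinner H (S w) (S w)"
proof -
  interpret H: hilbert_space H
    by (rule right_module_hilbert[OF H])
  note Sb = End_rightD[OF S]
  note adj = adj_char[OF H.hilbert_space_axioms H.semi_inner_axioms Sb(1)]
  have pic [simp]: "pi_op M \<Omega> H (\<xi> i) (x i) \<in> vecs H" if "i \<in> I" for i
    using bounded_opD(1)[OF pi_op_bounded[OF H \<xi>]] x that by blast
  note [simp] = bounded_opD(1)[OF Sb(1)]
  \<comment> \<open>Since w is known only through inner products, S is first moved to the other side
    by its adjoint and then back, term by term.\<close>
  have Sw: "vinner H y (S w) = (\<Sum>i\<in>I. vinner H y (S (pi_op M \<Omega> H (\<xi> i) (x i))))" if y: "y \<in> vecs H" for y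
  proof -
    have "vinner H y (S w) = vinner H (adj H H S y) w"
      using adj(3)[OF y w(1)] by simp
    also have "\<dots> = (\<Sum>i\<in>I. vinner H (adj H H S y) (pi_op M \<Omega> H (\<xi> i) (x i)))"
      by (rule w(2)[OF adj(1)[OF y]])
    also have "\<dots> = (\<Sum>i\<in>I. vinner H y (S (pi_op M \<Omega> H (\<xi> i) (x i))))"
      by (intro sum.cong refl adj(3)[OF y]) simp
    finally show ?thesis .
  qed
  have Sw': "vinner H (S w) y = (\<Sum>i\<in>I. vinner H (S (pi_op M \<Omega> H (\<xi> i) (x i))) y)" if y: "y \<in> vecs H" for y
  proof -
    have "vinner H (S w) y = cnj (vinner H y (S w))"
      using H.inner_commute[OF y, of "S w"] w(1) by simp
    also have "\<dots> = (\<Sum>i\<in>I. vinner H (S (pi_op M \<Omega> H (\<xi> i) (x i))) y)"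
      unfolding Sw[OF y] cnj_sum using y
      by (intro sum.cong refl H.inner_commute[symmetric]) simp_all
    finally show ?thesis .
  qed
  have "vinner H (S w) (S w) = (\<Sum>i\<in>I. vinner H (S (pi_op M \<Omega> H (\<xi> i) (x i))) (S w))"
    using w(1) by (intro Sw') simp
  also have "\<dots> = (\<Sum>i\<in>I. \<Sum>j\<in>I. vinner H (S (pi_op M \<Omega> H (\<xi> i) (x i))) (S (pi_op M \<Omega> H (\<xi> j) (x j))))"
    by (intro sum.cong refl Sw) simp
  also have "\<dots> = (\<Sum>i\<in>I. \<Sum>j\<in>I. vinner L (x i) (lact L (m_inner M \<Omega> H (S (\<xi> i)) (S (\<xi> j))) (x j)))"
  proof (intro sum.cong refl)
    fix i j assume i: "i \<in> I" and j: "j \<in> I"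
    have im: "S (\<xi> i) \<in> bdd_vecs M \<Omega> H" "pi_op M \<Omega> H (S (\<xi> i)) (x i) = S (pi_op M \<Omega> H (\<xi> i) (x i))" if "i \<in> I" for i
      using bdd_vecs_image[OF H H Sb \<xi>[OF that]] x[OF that] by (simp_all add: compose_def)
    show "vinner H (S (pi_op M \<Omega> H (\<xi> i) (x i))) (S (pi_op M \<Omega> H (\<xi> j) (x j))) =
        vinner L (x i) (lact L (m_inner M \<Omega> H (S (\<xi> i)) (S (\<xi> j))) (x j))"
      using m_inner_inner[OF im(1)[OF i] im(1)[OF j] x[OF i] x[OF j]] im(2)[OF i] im(2)[OF j] by simp
  qed
  finally show ?thesis
    by simp
qed

lemma op_id_End_right: "op_id H \<in> End_right M H"
proof -
  interpret H: hilbert_space H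
    by (rule right_module_hilbert[OF H])
  show ?thesis
    using isometry_bounded[OF op_id_isometry[OF H.semi_inner_axioms]] ract_closed[OF H]
    by (auto simp: End_right_def right_linear_def op_id_def)
qed

lemma m_inner_mat_pos:
  assumes "finite I" and \<xi>: "\<And>i. i \<in> I \<Longrightarrow> \<xi> i \<in> bdd_vecs M \<Omega> H"
  shows "mat_pos L (lact L) I (\<lambda>i j. m_inner M \<Omega> H (\<xi> i) (\<xi> j))"
  unfolding mat_pos_def
proof (intro allI impI)
  interpret H: hilbert_space H
    by (rule right_module_hilbert[OF H])
  fix x assume x: "\<forall>i\<in>I. x i \<in> vecs L"
  have pic: "pi_op M \<Omega> H (\<xi> i) (x i) \<in> vecs H" if "i \<in> I" for i
    using bounded_opD(1)[OF pi_op_bounded[OF H \<xi>]] x that by blast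
  obtain w where w: "w \<in> vecs H" "\<And>y. y \<in> vecs H \<Longrightarrow> vinner H y w = (\<Sum>i\<in>I. vinner H y (pi_op M \<Omega> H (\<xi> i) (x i)))"
    using H.sum_vec_exists[OF assms(1), of "\<lambda>i. pi_op M \<Omega> H (\<xi> i) (x i)"] pic by auto
  have "(\<Sum>i\<in>I. \<Sum>j\<in>I. vinner L (x i) (lact L (m_inner M \<Omega> H (\<xi> i) (\<xi> j)) (x j))) = vinner H w w"
    using m_inner_mat[OF assms _ op_id_End_right w] x w(1) bdd_vecs_closed[OF \<xi>] by (simp add: op_id_def)
  then show "0 \<le> Re (\<Sum>i\<in>I. \<Sum>j\<in>I. vinner L (x i) (lact L (m_inner M \<Omega> H (\<xi> i) (\<xi> j)) (x j)))"
    using H.Re_inner_self[OF w(1)] by simp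
qed

text \<open>On L2 the form of this matrix is c^2 |w|^2 - |S w|^2. Transferred to a bimodule K, its
  positivity says that S \<otimes> 1 has norm at most c.\<close>

lemma m_inner_mat_pos_End:
  assumes I: "finite I" and \<xi>: "\<And>i. i \<in> I \<Longrightarrow> \<xi> i \<in> bdd_vecs M \<Omega> H" and S: "S \<in> End_right M H"
    and c: "\<And>x. x \<in> vecs H \<Longrightarrow> vnorm H (S x) \<le> c * vnorm H x"
  shows "mat_pos L (lact L) I (\<lambda>i j. op_plus (base M) (op_scale (base M) (of_real (c\<^sup>2)) (m_inner M \<Omega> H (\<xi> i) (\<xi> j)))
    (op_scale (base M) (- 1) (m_inner M \<Omega> H (S (\<xi> i)) (S (\<xi> j)))))"
    (is "mat_pos _ _ _ ?T")
  unfolding mat_pos_def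
proof (intro allI impI)
  interpret H: hilbert_space H
    by (rule right_module_hilbert[OF H])
  fix x assume x: "\<forall>i\<in>I. x i \<in> vecs L"
  note Sb = End_rightD[OF S]
  note mc [simp] = m_inner_closed[OF \<xi> \<xi>]
  note S\<xi> = bdd_vecs_image(1)[OF H H Sb \<xi>]
  note mc' [simp] = m_inner_closed[OF S\<xi> S\<xi>]
  have pic: "pi_op M \<Omega> H (\<xi> i) (x i) \<in> vecs H" if "i \<in> I" for i
    using bounded_opD(1)[OF pi_op_bounded[OF H \<xi>]] x that by blast
  obtain w where w: "w \<in> vecs H" "\<And>y. y \<in> vecs H \<Longrightarrow> vinner H y w = (\<Sum>i\<in>I. vinner H y (pi_op M \<Omega> H (\<xi> i) (x i)))"
    using H.sum_vec_exists[OF I, of "\<lambda>i. pi_op M \<Omega> H (\<xi> i) (x i)"] pic by auto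
  have 1: "(\<Sum>i\<in>I. \<Sum>j\<in>I. vinner L (x i) (lact L (m_inner M \<Omega> H (\<xi> i) (\<xi> j)) (x j))) = vinner H w w"
    using m_inner_mat[OF I \<xi> _ op_id_End_right w] x w(1) bdd_vecs_closed[OF \<xi>] by (simp add: op_id_def)
  have 2: "(\<Sum>i\<in>I. \<Sum>j\<in>I. vinner L (x i) (lact L (m_inner M \<Omega> H (S (\<xi> i)) (S (\<xi> j))) (x j))) = vinner H (S w) (S w)"
    using m_inner_mat[OF I \<xi> _ S w] x by simp
  have "(\<Sum>i\<in>I. \<Sum>j\<in>I. vinner L (x i) (lact L (?T i j) (x j))) =
    (\<Sum>i\<in>I. \<Sum>j\<in>I. of_real (c\<^sup>2) * vinner L (x i) (lact L (m_inner M \<Omega> H (\<xi> i) (\<xi> j)) (x j))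
      - vinner L (x i) (lact L (m_inner M \<Omega> H (S (\<xi> i)) (S (\<xi> j))) (x j)))"
    using x by (intro sum.cong refl) (simp add: lact_L_simps L.inner_simps)
  also have "\<dots> = of_real (c\<^sup>2) * vinner H w w - vinner H (S w) (S w)"
    unfolding sum_subtractf 2 sum_distrib_left[symmetric] 1 ..
  finally have eq: "Re (\<Sum>i\<in>I. \<Sum>j\<in>I. vinner L (x i) (lact L (?T i j) (x j))) = c\<^sup>2 * (vnorm H w)\<^sup>2 - (vnorm H (S w))\<^sup>2"
    using w(1) bounded_opD(1)[OF Sb(1) w(1)] by (simp add: H.norm_sq)
  have "(vnorm H (S w))\<^sup>2 \<le> (c * vnorm H w)\<^sup>2"
    using c[OF w(1)] bounded_opD(1)[OF Sb(1) w(1)] by (intro power_mono) auto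
  then show "0 \<le> Re (\<Sum>i\<in>I. \<Sum>j\<in>I. vinner L (x i) (lact L (?T i j) (x j)))"
    unfolding eq by (simp add: power_mult_distrib)
qed

end

end

section \<open>Relative tensor products\<close>

lemma lookup_map_mult: "Poly_Mapping.lookup (Poly_Mapping.map ((*) c) f) k = c * Poly_Mapping.lookup f k"
  for c :: complex
  by (simp add: Poly_Mapping.map.rep_eq when_def)

lemma keys_map_mult: "Poly_Mapping.keys (Poly_Mapping.map ((*) c) f) \<subseteq> Poly_Mapping.keys f" for c :: complex
  by (auto simp: in_keys_iff lookup_map_mult)

lemma single_map_mult: "Poly_Mapping.map ((*) c) (Poly_Mapping.single k d) = Poly_Mapping.single k (c * d)" for c :: complex
  by (rule poly_mapping_eqI) (simp add: lookup_map_mult lookup_single when_def)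

lemma sum_single_lookup:
  assumes "finite A" and "Poly_Mapping.keys f \<subseteq> A"
  shows "(\<Sum>k\<in>A. Poly_Mapping.single k (Poly_Mapping.lookup f k)) = f"
proof (rule poly_mapping_eqI)
  fix k
  have "(\<Sum>l\<in>A. Poly_Mapping.lookup (Poly_Mapping.single l (Poly_Mapping.lookup f l)) k) =
      (\<Sum>l\<in>A. if l = k then Poly_Mapping.lookup f k else 0)"
    by (intro sum.cong refl) (auto simp: lookup_single)
  then show "Poly_Mapping.lookup (\<Sum>k\<in>A. Poly_Mapping.single k (Poly_Mapping.lookup f k)) k = Poly_Mapping.lookup f k"
    using assms by (auto simp: lookup_sum in_keys_iff)
qed

lemma sum_map_mult: "Poly_Mapping.map ((*) c) (\<Sum>k\<in>A. F k) = (\<Sum>k\<in>A. Poly_Mapping.map ((*) c) (F k))"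
  for c :: complex
  by (rule poly_mapping_eqI) (simp add: lookup_map_mult lookup_sum sum_distrib_left)

text \<open>The linear map of free vector spaces induced by a map of generators. On
  \<open>pre_tensor\<close>, the operator S \<otimes> R is the push-forward along (\<xi>, \<eta>)
  \<mapsto> (S \<xi>, R \<eta>).\<close>

definition push_forward :: "('i \<Rightarrow> 'j) \<Rightarrow> ('i \<Rightarrow>\<^sub>0 complex) \<Rightarrow> 'j \<Rightarrow>\<^sub>0 complex" where
  "push_forward \<sigma> f = (\<Sum>k\<in>Poly_Mapping.keys f. Poly_Mapping.single (\<sigma> k) (Poly_Mapping.lookup f k))"

lemma push_forward_superset:
  assumes "finite A" and "Poly_Mapping.keys f \<subseteq> A"
  shows "push_forward \<sigma> f = (\<Sum>k\<in>A. Poly_Mapping.single (\<sigma> k) (Poly_Mapping.lookup f k))"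
  unfolding push_forward_def using assms by (intro sum.mono_neutral_left) (auto simp: in_keys_iff)

lemma push_forward_plus: "push_forward \<sigma> (f + g) = push_forward \<sigma> f + push_forward \<sigma> g"
  using push_forward_superset[of "Poly_Mapping.keys f \<union> Poly_Mapping.keys g" f \<sigma>]
    push_forward_superset[of "Poly_Mapping.keys f \<union> Poly_Mapping.keys g" g \<sigma>]
    push_forward_superset[of "Poly_Mapping.keys f \<union> Poly_Mapping.keys g" "f + g" \<sigma>] Poly_Mapping.keys_add[of f g]
  by (simp add: lookup_add single_add sum.distrib)

lemma push_forward_map: "push_forward \<sigma> (Poly_Mapping.map ((*) c) f) = Poly_Mapping.map ((*) c) (push_forward \<sigma> f)"
  using push_forward_superset[OF finite_keys keys_map_mult, of \<sigma> c f]
  by (simp add: push_forward_def lookup_map_mult single_map_mult sum_map_mult)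

lemma push_forward_single: "push_forward \<sigma> (Poly_Mapping.single k c) = Poly_Mapping.single (\<sigma> k) c"
  using push_forward_superset[of "{k}" "Poly_Mapping.single k c" \<sigma>] by simp

lemma keys_push_forward: "Poly_Mapping.keys (push_forward \<sigma> f) \<subseteq> \<sigma> ` Poly_Mapping.keys f"
proof -
  have "Poly_Mapping.keys (push_forward \<sigma> f) \<subseteq>
      (\<Union>k\<in>Poly_Mapping.keys f. Poly_Mapping.keys (Poly_Mapping.single (\<sigma> k) (Poly_Mapping.lookup f k)))"
    unfolding push_forward_def by (rule Poly_Mapping.keys_sum)
  then show ?thesis
    by (auto split: if_splits)
qed

definition tensor_kernel ::
    "('b, 'h) std_algebra \<Rightarrow> 'h \<Rightarrow> ('u, 'b \<Rightarrow> 'b, 'y) rmodule_scheme \<Rightarrow>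
     ('v, 'b \<Rightarrow> 'b, 'z) bimodule_scheme \<Rightarrow> 'u \<times> 'v \<Rightarrow> 'u \<times> 'v \<Rightarrow> complex" where
  "tensor_kernel M \<Omega> H K k l = vinner K (snd k) (lact K (m_inner M \<Omega> H (fst k) (fst l)) (snd l))"

text \<open>Additivity compares functions with different supports, which requires sums over common
  finite sets containing these supports.\<close>

lemma pre_tensor_inner_superset:
  assumes "finite A" "Poly_Mapping.keys f \<subseteq> A" "finite B" "Poly_Mapping.keys g \<subseteq> B"
  shows "vinner (pre_tensor M \<Omega> H K) f g =
    (\<Sum>k\<in>A. \<Sum>l\<in>B. cnj (Poly_Mapping.lookup f k) * Poly_Mapping.lookup g l * tensor_kernel M \<Omega> H K k l)"
proof -
  let ?F = "\<lambda>k l. cnj (Poly_Mapping.lookup f k) * Poly_Mapping.lookup g l * tensor_kernel M \<Omega> H K k l"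
  have "vinner (pre_tensor M \<Omega> H K) f g = (\<Sum>k\<in>Poly_Mapping.keys f. \<Sum>l\<in>Poly_Mapping.keys g. ?F k l)"
    by (simp add: pre_tensor_def tensor_kernel_def case_prod_beta)
  also have "\<dots> = (\<Sum>k\<in>A. \<Sum>l\<in>Poly_Mapping.keys g. ?F k l)"
    using assms by (intro sum.mono_neutral_left) (auto simp: in_keys_iff)
  also have "\<dots> = (\<Sum>k\<in>A. \<Sum>l\<in>B. ?F k l)"
    using assms by (intro sum.cong refl sum.mono_neutral_left) (auto simp: in_keys_iff)
  finally show ?thesis .
qed

lemmas pre_tensor_inner = pre_tensor_inner_superset[OF finite_keys order_refl finite_keys order_refl]

lemma pre_tensor_sel:
  "vecs (pre_tensor M \<Omega> H K) = {f. Poly_Mapping.keys f \<subseteq> bdd_vecs M \<Omega> H \<times> vecs K}"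
  "vzero (pre_tensor M \<Omega> H K) = 0" "vplus (pre_tensor M \<Omega> H K) = (+)"
  "vscale (pre_tensor M \<Omega> H K) c = Poly_Mapping.map ((*) c)"
  by (simp_all add: pre_tensor_def)

context standard_state
begin

context
  fixes H :: "('u, 'b \<Rightarrow> 'b, 'y) rmodule_scheme" and K :: "('v, 'b \<Rightarrow> 'b, 'z) bimodule_scheme"
  assumes H: "right_module M H" and K: "wstar_bimodule M K"
begin

abbreviation "PT \<equiv> pre_tensor M \<Omega> H K"
abbreviation "TS \<equiv> tensor_space M \<Omega> H K"
abbreviation "tv \<equiv> tensor_vec M \<Omega> H K"
abbreviation "TK \<equiv> tensor_kernel M \<Omega> H K"

lemma K_hilbert: "hilbert_space K"
  by (rule right_module_hilbert[OF wstar_bimodule_right[OF K]])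

interpretation K: hilbert_space K
  by (rule K_hilbert)

lemmas K_rep = wstar_bimodule_star_rep[OF K]
lemmas K_lact = star_rep_lin[OF K_rep _ K.semi_inner_axioms]

lemma tensor_kernel_commute:
  assumes "k \<in> bdd_vecs M \<Omega> H \<times> vecs K" and "l \<in> bdd_vecs M \<Omega> H \<times> vecs K"
  shows "TK l k = cnj (TK k l)"
proof -
  have f: "fst k \<in> bdd_vecs M \<Omega> H" "snd k \<in> vecs K" "fst l \<in> bdd_vecs M \<Omega> H" "snd l \<in> vecs K"
    using assms by auto
  note mc = m_inner_closed[OF H f(1,3)]
  show ?thesis
    using K.inner_commute[OF f(2) K_lact(1)[OF mc f(4)]]
      star_rep_inner_sa[OF K_rep K.semi_inner_axioms mc star_m_inner[OF H f(1,3)] f(4,2)]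
    by (simp add: tensor_kernel_def)
qed

text \<open>The Gram matrix of the first legs is positive on L2, hence also under the left action on
  K. Testing it there on the second legs, weighted by the coefficients of f, gives the form of f
  with itself.\<close>

lemma pre_tensor_pos:
  assumes f: "f \<in> vecs PT"
  shows "0 \<le> Re (vinner PT f f)"
proof -
  let ?I = "Poly_Mapping.keys f"
  have k: "fst k \<in> bdd_vecs M \<Omega> H" "snd k \<in> vecs K" if "k \<in> ?I" for k
    using f that by (auto simp: pre_tensor_sel)
  have "mat_pos K (lact K) ?I (\<lambda>i j. m_inner M \<Omega> H (fst i) (fst j))"
    using k by (intro mat_pos_transfer[OF K.semi_inner_axioms K_rep] m_inner_mat_pos[OF H] m_inner_closed[OF H]
        star_m_inner[OF H]) auto
  then have "0 \<le> Re (\<Sum>i\<in>?I. \<Sum>j\<in>?I. vinner K (vscale K (Poly_Mapping.lookup f i) (snd i))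
      (lact K (m_inner M \<Omega> H (fst i) (fst j)) (vscale K (Poly_Mapping.lookup f j) (snd j))))"
    using k unfolding mat_pos_def
    by (elim allE[of _ "\<lambda>i. vscale K (Poly_Mapping.lookup f i) (snd i)"]) simp
  also have "(\<Sum>i\<in>?I. \<Sum>j\<in>?I. vinner K (vscale K (Poly_Mapping.lookup f i) (snd i))
      (lact K (m_inner M \<Omega> H (fst i) (fst j)) (vscale K (Poly_Mapping.lookup f j) (snd j)))) = vinner PT f f"
    unfolding pre_tensor_inner using k
    by (intro sum.cong refl)
      (simp add: tensor_kernel_def K_lact m_inner_closed[OF H] K.inner_simps)
  finally show ?thesis .
qed

lemma semi_inner_pre_tensor: "semi_inner PT"
proof
  fix f g assume f: "f \<in> vecs PT" and g: "g \<in> vecs PT"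
  then have kf: "Poly_Mapping.keys f \<subseteq> bdd_vecs M \<Omega> H \<times> vecs K" and kg: "Poly_Mapping.keys g \<subseteq> bdd_vecs M \<Omega> H \<times> vecs K"
    by (auto simp: pre_tensor_sel)
  show "vplus PT f g \<in> vecs PT"
    using kf kg Poly_Mapping.keys_add[of f g] by (auto simp: pre_tensor_sel)
  show "vplus PT f g = vplus PT g f"
    by (simp add: pre_tensor_sel add.commute)
  show "vscale PT c (vplus PT f g) = vplus PT (vscale PT c f) (vscale PT c g)" for c
    by (rule poly_mapping_eqI) (simp add: pre_tensor_sel lookup_map_mult lookup_add algebra_simps)
  show "vinner PT f (vscale PT c g) = c * vinner PT f g" for c
    using pre_tensor_inner_superset[OF finite_keys order_refl finite_keys keys_map_mult, of M \<Omega> H K f c g]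
    by (simp add: pre_tensor_sel pre_tensor_inner[of M \<Omega> H K f g] lookup_map_mult sum_distrib_left mult_ac)
  show "vinner PT g f = cnj (vinner PT f g)"
    unfolding pre_tensor_inner cnj_sum
  proof (subst sum.swap, intro sum.cong refl)
    fix k l assume "k \<in> Poly_Mapping.keys f" "l \<in> Poly_Mapping.keys g"
    then show "cnj (Poly_Mapping.lookup g l) * Poly_Mapping.lookup f k * TK l k =
        cnj (cnj (Poly_Mapping.lookup f k) * Poly_Mapping.lookup g l * TK k l)"
      using tensor_kernel_commute[of k l] kf kg by (auto simp: mult_ac)
  qed
next
  fix f g h assume "f \<in> vecs PT" "g \<in> vecs PT" "h \<in> vecs PT"
  show "vplus PT (vplus PT f g) h = vplus PT f (vplus PT g h)"
    by (simp add: pre_tensor_sel add.assoc)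
  let ?B = "Poly_Mapping.keys g \<union> Poly_Mapping.keys h"
  have B: "finite ?B"
    by simp
  show "vinner PT f (vplus PT g h) = vinner PT f g + vinner PT f h"
    unfolding pre_tensor_inner_superset[OF finite_keys order_refl B Un_upper1] pre_tensor_sel
      pre_tensor_inner_superset[OF finite_keys order_refl B Un_upper2]
      pre_tensor_inner_superset[OF finite_keys order_refl B Poly_Mapping.keys_add]
    by (simp add: lookup_add sum.distrib algebra_simps)
next
  fix f assume f: "f \<in> vecs PT"
  show "vscale PT c f \<in> vecs PT" for c
    using f keys_map_mult[of c f] by (auto simp: pre_tensor_sel)
  show "vplus PT f (vzero PT) = f"
    by (simp add: pre_tensor_sel)
  show "vdiff PT f f = vzero PT"
    by (rule poly_mapping_eqI) (simp add: vdiff_def pre_tensor_sel lookup_map_mult lookup_add)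
  show "vscale PT (c + d) f = vplus PT (vscale PT c f) (vscale PT d f)" for c d
    by (rule poly_mapping_eqI) (simp add: pre_tensor_sel lookup_map_mult lookup_add algebra_simps)
  show "vscale PT c (vscale PT d f) = vscale PT (c * d) f" for c d
    by (rule poly_mapping_eqI) (simp add: pre_tensor_sel lookup_map_mult mult.assoc)
  show "vscale PT 1 f = f"
    by (rule poly_mapping_eqI) (simp add: pre_tensor_sel lookup_map_mult)
  have "vinner PT f f = cnj (vinner PT f f)"
    unfolding pre_tensor_inner cnj_sum
  proof (subst sum.swap, intro sum.cong refl)
    fix k l assume "k \<in> Poly_Mapping.keys f" "l \<in> Poly_Mapping.keys f"
    then show "cnj (Poly_Mapping.lookup f l) * Poly_Mapping.lookup f k * TK l k =
        cnj (cnj (Poly_Mapping.lookup f k) * Poly_Mapping.lookup f l * TK k l)"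
      using tensor_kernel_commute[of k l] f by (auto simp: mult_ac pre_tensor_sel)
  qed
  then have "Im (vinner PT f f) = 0"
    by (metis cnj.simps(2) neg_equal_zero)
  then show "vinner PT f f \<in> \<real>\<^sub>\<ge>\<^sub>0"
    using pre_tensor_pos[OF f] by (simp add: complex_nonneg_Reals_iff)
qed (simp add: pre_tensor_sel)

interpretation P: semi_inner PT
  by (rule semi_inner_pre_tensor)

lemma inner_prod_tensor: "inner_prod TS"
  unfolding tensor_space_def by (rule P.inner_prod_completion)

interpretation T: inner_prod TS
  by (rule inner_prod_tensor)

lemma single_closed: "\<lbrakk>\<xi> \<in> bdd_vecs M \<Omega> H; \<eta> \<in> vecs K\<rbrakk> \<Longrightarrow> Poly_Mapping.single (\<xi>, \<eta>) c \<in> vecs PT"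
  by (simp add: pre_tensor_sel)

lemma tensor_vec_closed [simp]: "\<lbrakk>\<xi> \<in> bdd_vecs M \<Omega> H; \<eta> \<in> vecs K\<rbrakk> \<Longrightarrow> tv \<xi> \<eta> \<in> vecs TS"
  unfolding tensor_vec_def tensor_space_def using P.completion_const(1)[OF single_closed single_closed] .

lemma tensor_vec_inner:
  assumes "\<xi> \<in> bdd_vecs M \<Omega> H" "\<eta> \<in> vecs K" "\<xi>' \<in> bdd_vecs M \<Omega> H" "\<eta>' \<in> vecs K"
  shows "vinner TS (tv \<xi> \<eta>) (tv \<xi>' \<eta>') = vinner K \<eta> (lact K (m_inner M \<Omega> H \<xi> \<xi>') \<eta>')"
  unfolding tensor_vec_def tensor_space_def
    P.completion_const(2)[OF single_closed[OF assms(1,2)] single_closed[OF assms(3,4)]]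
  by (simp add: pre_tensor_inner tensor_kernel_def)

text \<open>The classes of constant sequences are dense, and each is a finite linear combination of
  elementary tensors.\<close>

lemma tensor_space_ext:
  fixes W :: "('w, 'x) inner_space_scheme"
  assumes W: "inner_prod W" and R: "R \<in> bounded_op TS W" and S: "S \<in> bounded_op TS W"
    and eq: "\<And>\<xi> \<eta>. \<lbrakk>\<xi> \<in> bdd_vecs M \<Omega> H; \<eta> \<in> vecs K\<rbrakk> \<Longrightarrow> R (tv \<xi> \<eta>) = S (tv \<xi> \<eta>)"
  shows "R = S"
proof (rule dense_bounded_ext[OF R S T.semi_inner_axioms W])
  let ?e = "\<lambda>f. cauchy_class PT (\<lambda>n. f)"
  show "vecs TS \<subseteq> vclosure TS (?e ` vecs PT)"
    unfolding tensor_space_def by (rule P.completion_dense)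
  show "?e ` vecs PT \<subseteq> vecs TS"
    unfolding tensor_space_def using P.completion_const(1) by blast
  fix x assume "x \<in> ?e ` vecs PT"
  then obtain f where f: "f \<in> vecs PT" "x = ?e f"
    by blast
  \<comment> \<open>The induction runs over a finite set of generators with arbitrary coefficients,
    so that f itself need not change; membership is carried along because additivity of the class
    map depends on it.\<close>
  have gen: "(\<Sum>k\<in>A. Poly_Mapping.single k (c k)) \<in> vecs PT \<and>
      R (?e (\<Sum>k\<in>A. Poly_Mapping.single k (c k))) = S (?e (\<Sum>k\<in>A. Poly_Mapping.single k (c k)))"
    if "finite A" "A \<subseteq> bdd_vecs M \<Omega> H \<times> vecs K" for A c
    using that
  proof (induction A)
    case empty
    have z: "?e 0 = vzero TS"
      by (simp add: tensor_space_def completion_def pre_tensor_sel)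
    have Qz: "Q (vzero TS) = vzero W" if "Q \<in> bounded_op TS W" for Q
      using bounded_opD(3)[OF that, of "vzero TS" 0] T.scale_zero[of "vzero TS"]
        semi_inner.scale_zero[of W "Q (vzero TS)"] W bounded_opD(1)[OF that T.zero_closed]
      by (simp add: inner_prod_def)
    then show ?case
      using Qz[OF R] Qz[OF S] P.zero_closed by (simp add: z pre_tensor_sel)
  next
    case (insert k A)
    obtain \<xi> \<eta> where k: "k = (\<xi>, \<eta>)" "\<xi> \<in> bdd_vecs M \<Omega> H" "\<eta> \<in> vecs K"
      using insert.prems by auto
    let ?g = "\<Sum>k\<in>A. Poly_Mapping.single k (c k)"
    have g: "?g \<in> vecs PT" "R (?e ?g) = S (?e ?g)"
      using insert by auto
    have sc: "Poly_Mapping.single k 1 \<in> vecs PT"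
      unfolding k by (rule single_closed[OF k(2,3)])
    have sum: "(\<Sum>k\<in>insert k A. Poly_Mapping.single k (c k)) = vplus PT (vscale PT (c k) (Poly_Mapping.single k 1)) ?g"
      using insert.hyps by (simp add: pre_tensor_sel single_map_mult)
    have "?e (\<Sum>k\<in>insert k A. Poly_Mapping.single k (c k)) = vplus TS (vscale TS (c k) (tv \<xi> \<eta>)) (?e ?g)"
      unfolding sum tensor_vec_def tensor_space_def k(1)[symmetric]
      using P.completion_const(4)[OF sc sc] P.completion_const(3)[OF P.scale_closed[OF sc] g(1)] by simp
    moreover have "?e ?g \<in> vecs TS"
      unfolding tensor_space_def by (rule P.completion_const(1)[OF g(1) g(1)])
    ultimately show ?case
      using g(2) eq[OF k(2,3)] tensor_vec_closed[OF k(2,3)] P.plus_closed[OF P.scale_closed[OF sc] g(1)]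
      unfolding sum by (simp add: bounded_opD[OF R] bounded_opD[OF S])
  qed
  show "R x = S x"
    using gen[of "Poly_Mapping.keys f" "Poly_Mapping.lookup f"] f sum_single_lookup[of "Poly_Mapping.keys f" f]
    by (simp add: pre_tensor_sel)
qed

text \<open>\<open>\<sigma>\<close> may identify indices, so the support of the push-forward need
  not correspond to A. The expansion therefore goes through bilinearity and not through
  keys.\<close>

lemma pre_tensor_push_inner:
  assumes A: "finite A" and B: "finite B" and \<sigma>: "\<And>k. k \<in> A \<union> B \<Longrightarrow> \<sigma> k \<in> bdd_vecs M \<Omega> H \<times> vecs K"
  shows "(\<Sum>l\<in>B. Poly_Mapping.single (\<sigma> l) (d l)) \<in> vecs PT \<and>
    vinner PT (\<Sum>k\<in>A. Poly_Mapping.single (\<sigma> k) (c k)) (\<Sum>l\<in>B. Poly_Mapping.single (\<sigma> l) (d l)) =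
    (\<Sum>k\<in>A. \<Sum>l\<in>B. cnj (c k) * d l * TK (\<sigma> k) (\<sigma> l))"
proof -
  have sc: "Poly_Mapping.single (\<sigma> k) z \<in> vecs PT" if "k \<in> A \<union> B" for k z
    using \<sigma>[OF that] by (cases "\<sigma> k") (auto intro: single_closed)
  have closed: "(\<Sum>l\<in>C. Poly_Mapping.single (\<sigma> l) (d l)) \<in> vecs PT" if "finite C" "C \<subseteq> A \<union> B" for C d
    using that
  proof (induction C)
    case empty
    then show ?case
      using P.zero_closed by (simp add: pre_tensor_sel)
  next
    case (insert k C)
    then show ?case
      using P.plus_closed[OF sc[of k "d k"], of "\<Sum>l\<in>C. Poly_Mapping.single (\<sigma> l) (d l)"]
      by (simp add: pre_tensor_sel(3))
  qed
  have one: "vinner PT (Poly_Mapping.single (\<sigma> k) u) (Poly_Mapping.single (\<sigma> l) v) = cnj u * v * TK (\<sigma> k) (\<sigma> l)"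
    for k l u v
    using pre_tensor_inner_superset[of "{\<sigma> k}" "Poly_Mapping.single (\<sigma> k) u" "{\<sigma> l}" "Poly_Mapping.single (\<sigma> l) v" M \<Omega> H K]
    by simp
  have right: "vinner PT f (\<Sum>l\<in>C. Poly_Mapping.single (\<sigma> l) (d l)) = (\<Sum>l\<in>C. vinner PT f (Poly_Mapping.single (\<sigma> l) (d l)))"
    if "finite C" "C \<subseteq> A \<union> B" and f: "f \<in> vecs PT" for C d f
    using that(1,2)
  proof (induction C)
    case empty
    then show ?case
      using P.inner_zero[OF f] by (simp add: pre_tensor_sel(2))
  next
    case (insert k C)
    then show ?case
      using P.inner_plus[OF f sc[of k "d k"] closed[of C d]] by (simp add: pre_tensor_sel(3))
  qed
  have left: "vinner PT (\<Sum>l\<in>C. Poly_Mapping.single (\<sigma> l) (d l)) f = (\<Sum>l\<in>C. vinner PT (Poly_Mapping.single (\<sigma> l) (d l)) f)"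
    if C: "finite C" "C \<subseteq> A \<union> B" and f: "f \<in> vecs PT" for C d f
    unfolding P.inner_commute[OF f closed[OF C]] right[OF C f] cnj_sum
    using C(2) by (intro sum.cong refl P.inner_commute[OF f sc, symmetric]) auto
  have "vinner PT (\<Sum>k\<in>A. Poly_Mapping.single (\<sigma> k) (c k)) (\<Sum>l\<in>B. Poly_Mapping.single (\<sigma> l) (d l)) =
      (\<Sum>k\<in>A. \<Sum>l\<in>B. vinner PT (Poly_Mapping.single (\<sigma> k) (c k)) (Poly_Mapping.single (\<sigma> l) (d l)))"
    unfolding left[OF A Un_upper1 closed[OF B Un_upper2]]
    by (intro sum.cong refl right[OF B Un_upper2] sc) auto
  then show ?thesis
    using closed[OF B] by (simp add: one)
qed

text \<open>\<open>bound\<close> is the inequality |(S \<otimes> R) f| \<le> c |f| on the free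
  vector space, in squared form. It respects null vectors, so it gives the operator on classes as
  well as its extension to the completion, where completeness of the target enters.\<close>

lemma tensor_op_char:
  assumes T: "hilbert_space TS" and S: "\<And>\<xi>. \<xi> \<in> bdd_vecs M \<Omega> H \<Longrightarrow> S \<xi> \<in> bdd_vecs M \<Omega> H"
    and R: "\<And>\<eta>. \<eta> \<in> vecs K \<Longrightarrow> R \<eta> \<in> vecs K" and c: "c \<ge> 0"
    and bound: "\<And>I f. \<lbrakk>finite I; I \<subseteq> bdd_vecs M \<Omega> H \<times> vecs K\<rbrakk> \<Longrightarrow>
      Re (\<Sum>k\<in>I. \<Sum>l\<in>I. cnj (f k) * f l * TK (S (fst k), R (snd k)) (S (fst l), R (snd l)))
      \<le> c\<^sup>2 * Re (\<Sum>k\<in>I. \<Sum>l\<in>I. cnj (f k) * f l * TK k l)"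
  shows tensor_op_bounded: "tensor_op M \<Omega> H K S R \<in> bounded_op TS TS"
    and tensor_op_vec: "\<lbrakk>\<xi> \<in> bdd_vecs M \<Omega> H; \<eta> \<in> vecs K\<rbrakk> \<Longrightarrow> tensor_op M \<Omega> H K S R (tv \<xi> \<eta>) = tv (S \<xi>) (R \<eta>)"
proof -
  let ?e = "\<lambda>f. cauchy_class PT (\<lambda>n. f)"
  let ?\<sigma> = "\<lambda>k. (S (fst k), R (snd k))"
  let ?g = "\<lambda>f. ?e (push_forward ?\<sigma> f)"
  have \<sigma>: "?\<sigma> k \<in> bdd_vecs M \<Omega> H \<times> vecs K" if "k \<in> bdd_vecs M \<Omega> H \<times> vecs K" for k
    using that S R by auto
  have pc: "push_forward ?\<sigma> f \<in> vecs PT" if "f \<in> vecs PT" for f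
    using that keys_push_forward[of ?\<sigma> f] \<sigma> by (force simp: pre_tensor_sel)
  have ec: "?e f \<in> vecs TS" if "f \<in> vecs PT" for f
    unfolding tensor_space_def by (rule P.completion_const(1)[OF that that])
  have en: "vnorm TS (?e f) = vnorm PT f" if "f \<in> vecs PT" for f
    unfolding tensor_space_def vnorm_def using P.completion_const(2)[OF that that] by simp
  have lin: "\<exists>h\<in>vecs PT. ?e h = vplus TS (?e f) (vscale TS k (?e g)) \<and>
      ?g h = vplus TS (?g f) (vscale TS k (?g g))" if f: "f \<in> vecs PT" and g: "g \<in> vecs PT" for f g k
  proof (intro bexI conjI)
    let ?h = "vplus PT f (vscale PT k g)"
    have push: "push_forward ?\<sigma> ?h = vplus PT (push_forward ?\<sigma> f) (vscale PT k (push_forward ?\<sigma> g))"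
      by (simp add: pre_tensor_sel push_forward_plus push_forward_map)
    have comb: "?e (vplus PT u (vscale PT k v)) = vplus TS (?e u) (vscale TS k (?e v))"
      if "u \<in> vecs PT" "v \<in> vecs PT" for u v
      unfolding tensor_space_def
      using P.completion_const(4)[OF that(2,2)] P.completion_const(3)[OF that(1) P.scale_closed[OF that(2)]] by simp
    show "?e ?h = vplus TS (?e f) (vscale TS k (?e g))"
      by (rule comb[OF f g])
    show "?g ?h = vplus TS (?g f) (vscale TS k (?g g))"
      unfolding push by (rule comb[OF pc[OF f] pc[OF g]])
    show "?h \<in> vecs PT"
      using f g by simp
  qed
  have norm: "vnorm TS (?g f) \<le> c * vnorm TS (?e f)" if f: "f \<in> vecs PT" for f
  proof -
    let ?I = "Poly_Mapping.keys f"
    have I: "?I \<subseteq> bdd_vecs M \<Omega> H \<times> vecs K"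
      using f by (simp add: pre_tensor_sel)
    have "?\<sigma> k \<in> bdd_vecs M \<Omega> H \<times> vecs K" if "k \<in> ?I \<union> ?I" for k
      using that I \<sigma> by blast
    from pre_tensor_push_inner[of ?I ?I ?\<sigma>, OF finite_keys finite_keys this]
    have "Re (vinner PT (push_forward ?\<sigma> f) (push_forward ?\<sigma> f)) =
        Re (\<Sum>k\<in>?I. \<Sum>l\<in>?I. cnj (Poly_Mapping.lookup f k) * Poly_Mapping.lookup f l * TK (?\<sigma> k) (?\<sigma> l))"
      unfolding push_forward_def by simp
    also have "\<dots> \<le> c\<^sup>2 * Re (vinner PT f f)"
      using bound[OF finite_keys I, of "Poly_Mapping.lookup f"] by (simp add: pre_tensor_inner)
    finally have "(vnorm PT (push_forward ?\<sigma> f))\<^sup>2 \<le> (c * vnorm PT f)\<^sup>2"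
      using f pc[OF f] by (simp add: P.norm_sq power_mult_distrib)
    then have "vnorm PT (push_forward ?\<sigma> f) \<le> c * vnorm PT f"
      using c f by (simp add: power2_le_iff_abs_le)
    then show ?thesis
      using f pc[OF f] by (simp add: en)
  qed
  have dense: "vecs TS \<subseteq> vclosure TS (?e ` vecs PT)"
    unfolding tensor_space_def by (rule P.completion_dense)
  obtain Q where Q: "Q \<in> bounded_op TS TS" "\<And>f. f \<in> vecs PT \<Longrightarrow> Q (?e f) = ?g f"
    by (rule bounded_extension[OF inner_prod_tensor T ec ec[OF pc] lin norm c dense]) (assumption | rule that)+
  have Qv: "Q (tv \<xi> \<eta>) = tv (S \<xi>) (R \<eta>)" if "\<xi> \<in> bdd_vecs M \<Omega> H" "\<eta> \<in> vecs K" for \<xi> \<eta>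
    using Q(2)[OF single_closed[OF that, of 1]] by (simp add: tensor_vec_def push_forward_single)
  have "tensor_op M \<Omega> H K S R = Q"
    unfolding tensor_op_def
  proof (rule the_equality)
    fix Q' assume "Q' \<in> bounded_op TS TS \<and> (\<forall>\<xi>\<in>bdd_vecs M \<Omega> H. \<forall>\<eta>\<in>vecs K. Q' (tv \<xi> \<eta>) = tv (S \<xi>) (R \<eta>))"
    then show "Q' = Q"
      using Q(1) Qv by (intro tensor_space_ext[OF inner_prod_tensor]) auto
  qed (use Q(1) Qv in blast)
  with Q(1) Qv show "tensor_op M \<Omega> H K S R \<in> bounded_op TS TS"
    and "\<lbrakk>\<xi> \<in> bdd_vecs M \<Omega> H; \<eta> \<in> vecs K\<rbrakk> \<Longrightarrow> tensor_op M \<Omega> H K S R (tv \<xi> \<eta>) = tv (S \<xi>) (R \<eta>)"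
    by auto
qed

text \<open>The matrix with entries c^2 (\<xi> i, \<xi> j) - (S \<xi> i, S \<xi> j), with M-valued
  inner products, is positive on L2. Its positivity on K is the norm estimate asked for by
  \<open>tensor_op_char\<close>.\<close>

lemma tensor_op_left:
  assumes T: "hilbert_space TS" and S: "S \<in> End_right M H"
  shows "tensor_op M \<Omega> H K S (op_id K) \<in> bounded_op TS TS"
    and "\<lbrakk>\<xi> \<in> bdd_vecs M \<Omega> H; \<eta> \<in> vecs K\<rbrakk> \<Longrightarrow> tensor_op M \<Omega> H K S (op_id K) (tv \<xi> \<eta>) = tv (S \<xi>) \<eta>"
proof -
  interpret H: hilbert_space H
    by (rule right_module_hilbert[OF H])
  note Sb = End_rightD[OF S]
  note Sc = bdd_vecs_image(1)[OF H H Sb]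
  obtain c where c: "c > 0" "\<And>x. x \<in> vecs H \<Longrightarrow> vnorm H (S x) \<le> c * vnorm H x"
    using bounded_opE[OF Sb(1) H.semi_inner_axioms H.semi_inner_axioms] by blast
  have bound: "Re (\<Sum>k\<in>I. \<Sum>l\<in>I. cnj (f k) * f l * TK (S (fst k), op_id K (snd k)) (S (fst l), op_id K (snd l)))
      \<le> c\<^sup>2 * Re (\<Sum>k\<in>I. \<Sum>l\<in>I. cnj (f k) * f l * TK k l)"
    if I: "finite I" "I \<subseteq> bdd_vecs M \<Omega> H \<times> vecs K" for I f
  proof -
    have k: "fst k \<in> bdd_vecs M \<Omega> H" "snd k \<in> vecs K" if "k \<in> I" for k
      using I that by auto
    note mc = m_inner_closed[OF H] star_m_inner[OF H]
    let ?T = "\<lambda>i j. op_plus (base M) (op_scale (base M) (of_real (c\<^sup>2)) (m_inner M \<Omega> H (fst i) (fst j)))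
        (op_scale (base M) (- 1) (m_inner M \<Omega> H (S (fst i)) (S (fst j))))"
    have Tc: "?T i j \<in> elts M" if "i \<in> I" "j \<in> I" for i j
      using k that Sc by (simp add: mc)
    have sT: "vn_star M (?T i j) = ?T j i" if i: "i \<in> I" and j: "j \<in> I" for i j
    proof (rule star_extI[OF Tc[OF i j] Tc[OF j i]])
      fix x y assume x: "x \<in> vecs L" and y: "y \<in> vecs L"
      note sym = star_rep_inner_sa[OF L_rep L.semi_inner_axioms]
      have "vinner L (lact L (m_inner M \<Omega> H (fst i) (fst j)) y) x = vinner L y (lact L (m_inner M \<Omega> H (fst j) (fst i)) x)"
        "vinner L (lact L (m_inner M \<Omega> H (S (fst i)) (S (fst j))) y) x = vinner L y (lact L (m_inner M \<Omega> H (S (fst j)) (S (fst i))) x)"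
        using k i j x y Sc by (simp_all add: sym mc)
      then show "vinner L (lact L (?T i j) y) x = vinner L y (lact L (?T j i) x)"
        using k i j x y Sc by (simp add: mc lact_L_simps L.inner_simps)
    qed
    have "mat_pos K (lact K) I ?T"
    proof (rule mat_pos_transfer[OF K.semi_inner_axioms K_rep I(1) Tc sT])
      show "mat_pos L (lact L) I ?T"
        using m_inner_mat_pos_End[OF H I(1) k(1) S c(2)] .
    qed
    then have "0 \<le> Re (\<Sum>i\<in>I. \<Sum>j\<in>I. vinner K (vscale K (f i) (snd i)) (lact K (?T i j) (vscale K (f j) (snd j))))"
      using k unfolding mat_pos_def by (elim allE[of _ "\<lambda>i. vscale K (f i) (snd i)"]) simp
    also have "(\<Sum>i\<in>I. \<Sum>j\<in>I. vinner K (vscale K (f i) (snd i)) (lact K (?T i j) (vscale K (f j) (snd j)))) =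
        (\<Sum>i\<in>I. \<Sum>j\<in>I. of_real (c\<^sup>2) * (cnj (f i) * f j * TK i j)
          - cnj (f i) * f j * TK (S (fst i), op_id K (snd i)) (S (fst j), op_id K (snd j)))"
      using k Sc by (intro sum.cong refl)
        (simp add: tensor_kernel_def op_id_def mc star_repD(3,4)[OF K_rep] K_lact K.inner_simps right_diff_distrib mult_ac)
    also have "\<dots> = of_real (c\<^sup>2) * (\<Sum>i\<in>I. \<Sum>j\<in>I. cnj (f i) * f j * TK i j)
        - (\<Sum>i\<in>I. \<Sum>j\<in>I. cnj (f i) * f j * TK (S (fst i), op_id K (snd i)) (S (fst j), op_id K (snd j)))"
      by (simp add: sum_subtractf sum_distrib_left)
    finally show ?thesis
      by simp
  qed
  note op = tensor_op_char[OF T Sc _ less_imp_le[OF c(1)] bound]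
  show "tensor_op M \<Omega> H K S (op_id K) \<in> bounded_op TS TS"
    by (rule op(1)) (simp_all add: op_id_def)
  assume \<xi>: "\<xi> \<in> bdd_vecs M \<Omega> H" and \<eta>: "\<eta> \<in> vecs K"
  have "tensor_op M \<Omega> H K S (op_id K) (tv \<xi> \<eta>) = tv (S \<xi>) (op_id K \<eta>)"
    by (rule op(2)) (use \<xi> \<eta> in \<open>simp_all add: op_id_def\<close>)
  then show "tensor_op M \<Omega> H K S (op_id K) (tv \<xi> \<eta>) = tv (S \<xi>) \<eta>"
    using \<eta> by (simp add: op_id_def)
qed

text \<open>
  The norm estimate for \<open>1 \<otimes> R\<close> is the positivity of the matrix of inner products, represented on
  \<open>K\<close> with the inner product \<open>(c\<^sup>2 + 1)\<langle>x, y\<rangle> - \<langle>Rx, Ry\<rangle>\<close>.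
\<close>

lemma tensor_op_right:
  assumes T: "hilbert_space TS" and R: "R \<in> bounded_op K K" and lin: "left_linear M K K R"
  shows "tensor_op M \<Omega> H K (op_id H) R \<in> bounded_op TS TS"
    and "\<lbrakk>\<xi> \<in> bdd_vecs M \<Omega> H; \<eta> \<in> vecs K\<rbrakk> \<Longrightarrow> tensor_op M \<Omega> H K (op_id H) R (tv \<xi> \<eta>) = tv \<xi> (R \<eta>)"
proof -
  note [simp] = bounded_opD[OF R]
  have Rl: "R (lact K a x) = lact K a (R x)" if "a \<in> elts M" "x \<in> vecs K" for a x
    using lin that by (simp add: left_linear_def)
  obtain c where c: "c > 0" "\<And>x. x \<in> vecs K \<Longrightarrow> vnorm K (R x) \<le> c * vnorm K x"
    using bounded_opE[OF R K.semi_inner_axioms K.semi_inner_axioms] by blast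
  \<comment> \<open>The extra 1 makes the new square norm dominate the old one. With c alone the
    left action need not be bounded for the new norm.\<close>
  define d where "d = sqrt (c\<^sup>2 + 1)"
  have d: "d > 0" "d\<^sup>2 = c\<^sup>2 + 1"
    by (simp_all add: d_def add_nonneg_pos)
  let ?K = "K\<lparr>vinner := \<lambda>x y. (of_real d)\<^sup>2 * vinner K x y - vinner K (R x) (R y)\<rparr>"
  have [simp]: "vdiff ?K x y = vdiff K x y" for x y
    by (simp add: vdiff_def)
  have Rn: "(vnorm K (R x))\<^sup>2 \<le> c\<^sup>2 * (vnorm K x)\<^sup>2" if "x \<in> vecs K" for x
    using power_mono[OF c(2)[OF that], of 2] that by (simp add: power_mult_distrib)
  have self: "vinner ?K x x = of_real (d\<^sup>2 * (vnorm K x)\<^sup>2 - (vnorm K (R x))\<^sup>2)" if "x \<in> vecs K" for x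
    using that K.inner_self[of x] K.inner_self[of "R x"] by simp
  have ge: "(vnorm K x)\<^sup>2 \<le> d\<^sup>2 * (vnorm K x)\<^sup>2 - (vnorm K (R x))\<^sup>2" if "x \<in> vecs K" for x
    using Rn[OF that] unfolding d by (simp add: algebra_simps)
  have K': "semi_inner ?K"
  proof
    fix x y assume "x \<in> vecs ?K" "y \<in> vecs ?K"
    then have x: "x \<in> vecs K" and y: "y \<in> vecs K"
      by simp_all
    show "vplus ?K x y = vplus ?K y x"
      using x y by (simp add: K.plus_commute)
    show "vinner ?K y x = cnj (vinner ?K x y)"
      using K.inner_commute[OF x y] K.inner_commute[of "R x" "R y"] x y by simp
  next
    fix x assume "x \<in> vecs ?K"
    then have x: "x \<in> vecs K"
      by simp
    have "0 \<le> d\<^sup>2 * (vnorm K x)\<^sup>2 - (vnorm K (R x))\<^sup>2"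
      using ge[OF x] by (rule order_trans[rotated]) simp
    then show "vinner ?K x x \<in> \<real>\<^sub>\<ge>\<^sub>0"
      unfolding self[OF x] by (simp only: nonneg_Reals_of_real_iff)
  qed (simp_all add: K.plus_assoc K.plus_zero K.diff_self K.scale_plus K.plus_scale K.scale_scale
      K.scale_one K.inner_plus K.inner_scale, simp_all add: algebra_simps)
  interpret K': semi_inner ?K
    by (rule K')
  have nK: "(vnorm ?K x)\<^sup>2 = d\<^sup>2 * (vnorm K x)\<^sup>2 - (vnorm K (R x))\<^sup>2" if "x \<in> vecs K" for x
    using K'.norm_sq[of x] that by (simp add: K.norm_sq)
  \<comment> \<open>Left linearity of R makes the subtracted form \<langle>R x, R y\<rangle>
    compatible with adjoints in M; boundedness follows from comparison with the old norm in both
    directions.\<close>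
  have rep: "star_rep M ?K (lact K)"
    unfolding star_rep_def
  proof (intro conjI ballI)
    fix a assume a: "a \<in> elts M"
    note ab = star_repD(1)[OF K_rep a]
    obtain e where e: "e > 0" "\<And>x. x \<in> vecs K \<Longrightarrow> vnorm K (restrict (lact K a) (vecs K) x) \<le> e * vnorm K x"
      using bounded_opE[OF ab K.semi_inner_axioms K.semi_inner_axioms] by blast
    have "vnorm ?K (lact K a x) \<le> (d * e) * vnorm ?K x" if x: "x \<in> vecs K" for x
    proof -
      have ax: "lact K a x \<in> vecs K"
        using K_lact(1)[OF a x] .
      have "(vnorm ?K (lact K a x))\<^sup>2 \<le> d\<^sup>2 * (vnorm K (lact K a x))\<^sup>2"
        unfolding nK[OF ax] by simp
      also have "\<dots> \<le> d\<^sup>2 * (e * vnorm K x)\<^sup>2"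
        using e(2)[OF x] x ax by (intro mult_left_mono power_mono) auto
      also have "\<dots> \<le> d\<^sup>2 * (e\<^sup>2 * (vnorm ?K x)\<^sup>2)"
        unfolding power_mult_distrib[of e] nK[OF x] using ge[OF x] by (intro mult_left_mono) auto
      finally have "(vnorm ?K (lact K a x))\<^sup>2 \<le> ((d * e) * vnorm ?K x)\<^sup>2"
        by (simp add: power_mult_distrib)
      then show ?thesis
        by (rule power2_le_imp_le) (use x d(1) e(1) in simp)
    qed
    moreover have "restrict (lact K a) (vecs K) \<in> linear_op ?K ?K"
      using bounded_op_linear[OF ab] by (simp add: linear_op_def)
    ultimately show "restrict (lact K a) (vecs ?K) \<in> bounded_op ?K ?K"
      unfolding bounded_op_def by auto
  next
    fix a x y assume a: "a \<in> elts M" and "x \<in> vecs ?K" "y \<in> vecs ?K"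
    then show "vinner ?K x (lact K a y) = vinner ?K (lact K (vn_star M a) x) y"
      using star_repD(5)[OF K_rep a, of x y] star_repD(5)[OF K_rep a, of "R x" "R y"] by (simp add: Rl)
  qed (use star_repD[OF K_rep] in auto)
  have bound: "Re (\<Sum>k\<in>I. \<Sum>l\<in>I. cnj (f k) * f l * TK (op_id H (fst k), R (snd k)) (op_id H (fst l), R (snd l)))
      \<le> d\<^sup>2 * Re (\<Sum>k\<in>I. \<Sum>l\<in>I. cnj (f k) * f l * TK k l)"
    if I: "finite I" "I \<subseteq> bdd_vecs M \<Omega> H \<times> vecs K" for I f
  proof -
    have k: "fst k \<in> bdd_vecs M \<Omega> H" "snd k \<in> vecs K" if "k \<in> I" for k
      using I that by auto
    note kc = bdd_vecs_closed[OF k(1)]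
    note mc = m_inner_closed[OF H] star_m_inner[OF H]
    have "mat_pos ?K (lact K) I (\<lambda>i j. m_inner M \<Omega> H (fst i) (fst j))"
      using k by (intro mat_pos_transfer[OF K' rep I(1)] m_inner_mat_pos[OF H I(1)] mc) auto
    then have "0 \<le> Re (\<Sum>i\<in>I. \<Sum>j\<in>I. vinner ?K (vscale K (f i) (snd i)) (lact K (m_inner M \<Omega> H (fst i) (fst j)) (vscale K (f j) (snd j))))"
      using k unfolding mat_pos_def by (elim allE[of _ "\<lambda>i. vscale K (f i) (snd i)"]) simp
    also have "(\<Sum>i\<in>I. \<Sum>j\<in>I. vinner ?K (vscale K (f i) (snd i)) (lact K (m_inner M \<Omega> H (fst i) (fst j)) (vscale K (f j) (snd j)))) =
        (\<Sum>i\<in>I. \<Sum>j\<in>I. of_real (d\<^sup>2) * (cnj (f i) * f j * TK i j)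
          - cnj (f i) * f j * TK (op_id H (fst i), R (snd i)) (op_id H (fst j), R (snd j)))"
      using k kc by (intro sum.cong refl)
        (simp add: tensor_kernel_def op_id_def mc K_lact K.inner_simps Rl right_diff_distrib mult_ac)
    also have "\<dots> = of_real (d\<^sup>2) * (\<Sum>i\<in>I. \<Sum>j\<in>I. cnj (f i) * f j * TK i j)
        - (\<Sum>i\<in>I. \<Sum>j\<in>I. cnj (f i) * f j * TK (op_id H (fst i), R (snd i)) (op_id H (fst j), R (snd j)))"
      by (simp add: sum_subtractf sum_distrib_left)
    finally show ?thesis
      by simp
  qed
  note op = tensor_op_char[OF T _ _ less_imp_le[OF d(1)] bound]
  show "tensor_op M \<Omega> H K (op_id H) R \<in> bounded_op TS TS"
    by (rule op(1)) (simp_all add: op_id_def bdd_vecs_closed)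
  assume \<xi>: "\<xi> \<in> bdd_vecs M \<Omega> H" and \<eta>: "\<eta> \<in> vecs K"
  have "tensor_op M \<Omega> H K (op_id H) R (tv \<xi> \<eta>) = tv (op_id H \<xi>) (R \<eta>)"
    by (rule op(2)) (use \<xi> \<eta> in \<open>simp_all add: op_id_def bdd_vecs_closed\<close>)
  then show "tensor_op M \<Omega> H K (op_id H) R (tv \<xi> \<eta>) = tv \<xi> (R \<eta>)"
    using bdd_vecs_closed[OF \<xi>] by (simp add: op_id_def)
qed

end

end

section \<open>The correspondence\<close>

lemma unitary_op_isometry: "T \<in> unitary_op V W \<Longrightarrow> T \<in> isometry_op V W"
  by (simp add: unitary_op_def)

lemma tensor_right_sel:
  "vecs (tensor_right M \<Omega> H K) = vecs (tensor_space M \<Omega> H K)"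
  "vzero (tensor_right M \<Omega> H K) = vzero (tensor_space M \<Omega> H K)"
  "vplus (tensor_right M \<Omega> H K) = vplus (tensor_space M \<Omega> H K)"
  "vscale (tensor_right M \<Omega> H K) = vscale (tensor_space M \<Omega> H K)"
  "vinner (tensor_right M \<Omega> H K) = vinner (tensor_space M \<Omega> H K)"
  by (simp_all add: tensor_right_def inner_space.extend_def)

lemma tensor_bi_sel:
  "vecs (tensor_bi M \<Omega> H K) = vecs (tensor_space M \<Omega> H K)"
  "vzero (tensor_bi M \<Omega> H K) = vzero (tensor_space M \<Omega> H K)"
  "vplus (tensor_bi M \<Omega> H K) = vplus (tensor_space M \<Omega> H K)"
  "vscale (tensor_bi M \<Omega> H K) = vscale (tensor_space M \<Omega> H K)"
  "vinner (tensor_bi M \<Omega> H K) = vinner (tensor_space M \<Omega> H K)"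
  "ract (tensor_bi M \<Omega> H K) v a = tensor_op M \<Omega> H K (op_id H) (\<lambda>\<eta>\<in>vecs K. ract K \<eta> a) v"
  by (simp_all add: tensor_bi_def rmodule.extend_def tensor_right_sel)
    (simp add: tensor_right_def inner_space.extend_def rmodule.fields_def)

lemma unitary_op_tensor_right: "unitary_op (tensor_right M \<Omega> H K) W = unitary_op (tensor_space M \<Omega> H K) W"
  by (simp add: unitary_op_def isometry_op_def linear_op_def tensor_right_sel)

lemma unitary_op_tensor_bi: "unitary_op (tensor_bi M \<Omega> H K) W = unitary_op (tensor_space M \<Omega> H K) W"
  by (simp add: unitary_op_def isometry_op_def linear_op_def tensor_bi_sel)

lemma adj_tensor_right: "adj (tensor_right M \<Omega> H K) W T = adj (tensor_space M \<Omega> H K) W T"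
  by (simp add: adj_def tensor_right_sel)

text \<open>The rank one operator x \<mapsto> \<langle>A, x\<rangle> A vanishes on elementary
  tensors, so it is the zero operator by \<open>tensor_space_ext\<close>. Its value at A then gives
  A = 0.\<close>

lemma (in standard_state) tensor_space_total:
  fixes H :: "('u, 'b \<Rightarrow> 'b, 'y) rmodule_scheme" and K :: "('v, 'b \<Rightarrow> 'b, 'z) bimodule_scheme"
  assumes H: "right_module M H" and K: "wstar_bimodule M K" and A: "A \<in> vecs (tensor_space M \<Omega> H K)"
    and orth: "\<And>\<xi> \<eta>. \<lbrakk>\<xi> \<in> bdd_vecs M \<Omega> H; \<eta> \<in> vecs K\<rbrakk> \<Longrightarrow>
      vinner (tensor_space M \<Omega> H K) (tensor_vec M \<Omega> H K \<xi> \<eta>) A = 0"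
  shows "A = vzero (tensor_space M \<Omega> H K)"
proof -
  let ?T = "tensor_space M \<Omega> H K"
  interpret T: inner_prod ?T
    by (rule inner_prod_tensor[OF H K])
  let ?R = "\<lambda>x\<in>vecs ?T. vscale ?T (vinner ?T A x) A" and ?S = "\<lambda>x\<in>vecs ?T. vzero ?T"
  have "?R \<in> linear_op ?T ?T"
    by (rule linear_opI) (simp_all add: A T.inner_simps T.plus_scale T.scale_scale)
  moreover have "vnorm ?T (?R x) \<le> (vnorm ?T A * vnorm ?T A) * vnorm ?T x" if "x \<in> vecs ?T" for x
    using that A mult_right_mono[OF T.cauchy_schwarz[OF A that] T.norm_nonneg[OF A]]
    by (simp add: T.norm_scale mult_ac)
  ultimately have R: "?R \<in> bounded_op ?T ?T"
    unfolding bounded_op_def by blast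
  have z: "vplus ?T (vzero ?T) (vzero ?T) = vzero ?T" "vscale ?T c (vzero ?T) = vzero ?T" for c
    using T.scale_scale[of "vzero ?T" c 0] T.scale_zero[of "vzero ?T"] by (simp_all add: T.plus_zero)
  have "?S \<in> linear_op ?T ?T"
    by (rule linear_opI) (simp_all add: z)
  moreover have "vnorm ?T (?S x) \<le> 1 * vnorm ?T x" if "x \<in> vecs ?T" for x
    using that by simp
  ultimately have S: "?S \<in> bounded_op ?T ?T"
    unfolding bounded_op_def by blast
  have "?R = ?S"
  proof (rule tensor_space_ext[OF H K T.inner_prod_axioms R S])
    fix \<xi> \<eta> assume v: "\<xi> \<in> bdd_vecs M \<Omega> H" "\<eta> \<in> vecs K"
    note vc = tensor_vec_closed[OF H K v]
    have "vinner ?T A (tensor_vec M \<Omega> H K \<xi> \<eta>) = 0"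
      using T.inner_commute[OF vc A] orth[OF v] by simp
    then show "?R (tensor_vec M \<Omega> H K \<xi> \<eta>) = ?S (tensor_vec M \<Omega> H K \<xi> \<eta>)"
      using vc A by (simp add: T.scale_zero)
  qed
  from fun_cong[OF this, of A] have "vscale ?T (vinner ?T A A) A = vzero ?T"
    using A by simp
  from arg_cong[OF this, of "vinner ?T A"] have "vinner ?T A A = 0"
    using A by (simp add: T.inner_simps)
  then show ?thesis
    by (rule T.inner_definite[OF A])
qed

section \<open>The dilation of a product system with a unital unit\<close>

locale dilation_setting = standard_state M \<phi> \<Omega>
  for M :: "('b, 'h) std_algebra" and \<phi> :: "('b \<Rightarrow> 'b) \<Rightarrow> complex" and \<Omega> :: 'h +
  fixes H :: "real \<Rightarrow> ('h, 'b \<Rightarrow> 'b) bimodule"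
    and U :: "real \<Rightarrow> real \<Rightarrow> ('h, 'h) tens \<Rightarrow> 'h"
    and \<Xi> :: "real \<Rightarrow> 'h"
    and E :: "('k, 'b \<Rightarrow> 'b) rmodule"
    and \<kappa> :: "real \<Rightarrow> 'h \<Rightarrow> 'k"
    and V :: "real \<Rightarrow> ('k, 'h) tens \<Rightarrow> 'k"
  assumes product: "product_system M \<Omega> H U"
    and unital: "unital_unit M \<Omega> H U \<Xi>"
    and limit: "inductive_limit M \<Omega> H U \<Xi> E \<kappa>"
    and unitaries: "dilation_unitaries M \<Omega> H U E \<kappa> V"
begin

lemma H_bimodule: "t \<ge> 0 \<Longrightarrow> wstar_bimodule M (H t)" and H_0: "H 0 = L"
  using product by (auto simp: product_system_def)

lemma H_right: "t \<ge> 0 \<Longrightarrow> right_module M (H t)"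
  by (rule wstar_bimodule_right[OF H_bimodule])

lemma H_hilbert: "t \<ge> 0 \<Longrightarrow> hilbert_space (H t)"
  by (rule right_module_hilbert[OF H_right])

lemma H_inner_prod: "t \<ge> 0 \<Longrightarrow> inner_prod (H t)"
  using H_hilbert by (simp add: hilbert_space_iff)

lemma H_semi_inner: "t \<ge> 0 \<Longrightarrow> semi_inner (H t)"
  using H_inner_prod by (simp add: inner_prod_def)

lemma E_right: "right_module M E"
  using limit by (simp add: inductive_limit_def)

sublocale E: hilbert_space E
  by (rule right_module_hilbert[OF E_right])

lemma U_unitary: "\<lbrakk>s \<ge> 0; t \<ge> 0\<rbrakk> \<Longrightarrow> U s t \<in> unitary_op (tensor_space M \<Omega> (H s) (H t)) (H (s + t))"
  using product by (simp add: product_system_def unitary_op_tensor_bi)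

lemma V_unitary: "t \<ge> 0 \<Longrightarrow> V t \<in> unitary_op (tensor_space M \<Omega> E (H t)) E"
  using unitaries by (simp add: dilation_unitaries_def unitary_op_tensor_right)

lemma V_\<kappa>: "\<lbrakk>s \<ge> 0; t \<ge> 0; \<xi> \<in> bdd_vecs M \<Omega> (H s); \<eta> \<in> vecs (H t)\<rbrakk> \<Longrightarrow>
    V t (tensor_vec M \<Omega> E (H t) (\<kappa> s \<xi>) \<eta>) = \<kappa> (s + t) (U s t (tensor_vec M \<Omega> (H s) (H t) \<xi> \<eta>))"
  using unitaries by (simp add: dilation_unitaries_def)

lemma U_closed: "\<lbrakk>s \<ge> 0; t \<ge> 0; \<xi> \<in> bdd_vecs M \<Omega> (H s); \<eta> \<in> vecs (H t)\<rbrakk> \<Longrightarrow>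
    U s t (tensor_vec M \<Omega> (H s) (H t) \<xi> \<eta>) \<in> vecs (H (s + t))"
  by (rule bounded_opD(1)[OF isometry_bounded[OF unitary_op_isometry[OF U_unitary]]])
    (simp_all add: tensor_vec_closed[OF H_right H_bimodule])

lemma E_tensor_inner_prod: "t \<ge> 0 \<Longrightarrow> inner_prod (tensor_space M \<Omega> E (H t))"
  by (rule inner_prod_tensor[OF E_right H_bimodule])

lemma E_tensor_hilbert: "t \<ge> 0 \<Longrightarrow> hilbert_space (tensor_space M \<Omega> E (H t))"
  by (rule hilbert_unitary[OF E_tensor_inner_prod E.hilbert_space_axioms V_unitary])

lemma H_tensor_hilbert: "\<lbrakk>s \<ge> 0; t \<ge> 0\<rbrakk> \<Longrightarrow> hilbert_space (tensor_space M \<Omega> (H s) (H t))"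
  by (rule hilbert_unitary[OF inner_prod_tensor[OF H_right H_bimodule] H_hilbert U_unitary]) simp_all

lemma \<kappa>_isometry: "t \<ge> 0 \<Longrightarrow> \<kappa> t \<in> isometry_op (H t) E"
  and \<kappa>_right_linear: "t \<ge> 0 \<Longrightarrow> right_linear M (H t) E (\<kappa> t)"
  using limit by (auto simp: inductive_limit_def)

lemmas \<kappa>_bounded = isometry_bounded[OF \<kappa>_isometry]

lemma \<kappa>_closed [simp]: "\<lbrakk>t \<ge> 0; x \<in> vecs (H t)\<rbrakk> \<Longrightarrow> \<kappa> t x \<in> vecs E"
  by (rule bounded_opD(1)[OF \<kappa>_bounded])

lemma \<kappa>0_isometry: "\<kappa> 0 \<in> isometry_op L E" and \<kappa>0_right_linear: "right_linear M L E (\<kappa> 0)"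
  using \<kappa>_isometry[of 0] \<kappa>_right_linear[of 0] by (simp_all add: H_0)

lemmas \<kappa>0_bounded = isometry_bounded[OF \<kappa>0_isometry]

lemma \<kappa>0_closed [simp]: "x \<in> vecs L \<Longrightarrow> \<kappa> 0 x \<in> vecs E"
  by (rule bounded_opD(1)[OF \<kappa>0_bounded])

lemma \<kappa>_inj: "\<lbrakk>t \<ge> 0; x \<in> vecs (H t); y \<in> vecs (H t); \<kappa> t x = \<kappa> t y\<rbrakk> \<Longrightarrow> x = y"
  using adj_isometry[OF H_inner_prod \<kappa>_isometry] by metis

lemma adj_\<kappa>_closed [simp]: "\<lbrakk>t \<ge> 0; v \<in> vecs E\<rbrakk> \<Longrightarrow> adj (H t) E (\<kappa> t) v \<in> vecs (H t)"
  by (rule adj_closed[OF H_hilbert E.semi_inner_axioms \<kappa>_bounded])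

lemma adj_\<kappa>0_closed [simp]: "v \<in> vecs E \<Longrightarrow> adj L E (\<kappa> 0) v \<in> vecs L"
  by (rule adj_closed[OF L.hilbert_space_axioms E.semi_inner_axioms \<kappa>0_bounded])

lemma \<kappa>_bdd: "\<lbrakk>t \<ge> 0; \<xi> \<in> bdd_vecs M \<Omega> (H t)\<rbrakk> \<Longrightarrow> \<kappa> t \<xi> \<in> bdd_vecs M \<Omega> E"
  and pi_op_\<kappa>: "\<lbrakk>t \<ge> 0; \<xi> \<in> bdd_vecs M \<Omega> (H t)\<rbrakk> \<Longrightarrow>
    pi_op M \<Omega> E (\<kappa> t \<xi>) = compose (vecs L) (\<kappa> t) (pi_op M \<Omega> (H t) \<xi>)"
  using bdd_vecs_image[OF H_right E_right \<kappa>_bounded \<kappa>_right_linear] by blast+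

lemma \<kappa>0_\<Omega>_bdd: "\<kappa> 0 \<Omega> \<in> bdd_vecs M \<Omega> E" and pi_op_\<kappa>0: "pi_op M \<Omega> E (\<kappa> 0 \<Omega>) = \<kappa> 0"
  using bdd_vecsI[OF E_right \<kappa>0_bounded \<kappa>0_right_linear] by auto

lemma \<Omega>_bdd: "\<Omega> \<in> bdd_vecs M \<Omega> L" and pi_op_\<Omega>_L: "pi_op M \<Omega> L \<Omega> = op_id L"
  using bdd_vecsI[OF L_right, of "op_id L"] End_rightD[OF op_id_End_right[OF L_right]]
  by (simp_all add: op_id_def)

text \<open>For s = 0, the defining property of \<open>V t\<close> reduces this to the
  identification of the tensor product of L2 and \<open>H t\<close> with \<open>H t\<close>, taken
  at the identity of M.\<close>

lemma V_\<kappa>0: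
  assumes t: "t \<ge> 0" and \<eta>: "\<eta> \<in> vecs (H t)"
  shows "V t (tensor_vec M \<Omega> E (H t) (\<kappa> 0 \<Omega>) \<eta>) = \<kappa> t \<eta>"
proof -
  have "\<forall>t\<ge>0. \<forall>a\<in>elts M. \<forall>\<eta>\<in>vecs (H t). U 0 t (tensor_vec M \<Omega> (H 0) (H t) (lact L a \<Omega>) \<eta>) = lact (H t) a \<eta>"
    using product unfolding product_system_def by (elim conjE)
  then have "U 0 t (tensor_vec M \<Omega> (H 0) (H t) (lact L (op_id (base M)) \<Omega>) \<eta>) = lact (H t) (op_id (base M)) \<eta>"
    using t \<eta> elts_closed(1) by blast
  then have "U 0 t (tensor_vec M \<Omega> (H 0) (H t) \<Omega> \<eta>) = \<eta>"
    using star_repD(2)[OF wstar_bimodule_star_rep[OF H_bimodule[OF t]] \<eta>] by (simp add: lact_L_simps)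
  then show ?thesis
    using V_\<kappa>[of 0 t \<Omega> \<eta>] t \<eta> \<Omega>_bdd by (simp add: H_0)
qed

abbreviation \<theta> :: "real \<Rightarrow> ('k \<Rightarrow> 'k) \<Rightarrow> 'k \<Rightarrow> 'k" where "\<theta> \<equiv> dilation M \<Omega> H E V"

lemma dilation_bounded:
  assumes t: "t \<ge> 0" and a: "a \<in> End_right M E"
  shows "\<theta> t a \<in> bounded_op E E"
proof -
  interpret T: hilbert_space "tensor_space M \<Omega> E (H t)"
    by (rule E_tensor_hilbert[OF t])
  note Vb = isometry_bounded[OF unitary_op_isometry[OF V_unitary[OF t]]]
  show ?thesis
    unfolding dilation_def adj_tensor_right
    by (rule compose_bounded[OF Vb compose_bounded[OF tensor_op_left(1)[OF E_right H_bimodule[OF t] T.hilbert_space_axioms a]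
          adj_bounded[OF T.hilbert_space_axioms E.semi_inner_axioms Vb]]]) unfold_locales
qed

lemma dilation_tensor_vec:
  assumes t: "t \<ge> 0" and a: "a \<in> End_right M E" and z: "z \<in> bdd_vecs M \<Omega> E" and \<eta>: "\<eta> \<in> vecs (H t)"
  shows "\<theta> t a (V t (tensor_vec M \<Omega> E (H t) z \<eta>)) = V t (tensor_vec M \<Omega> E (H t) (a z) \<eta>)"
proof -
  let ?v = "tensor_vec M \<Omega> E (H t) z \<eta>"
  note iso = unitary_op_isometry[OF V_unitary[OF t]]
  have v: "?v \<in> vecs (tensor_space M \<Omega> E (H t))"
    by (rule tensor_vec_closed[OF E_right H_bimodule[OF t] z \<eta>])
  have "V t ?v \<in> vecs E"
    by (rule bounded_opD(1)[OF isometry_bounded[OF iso] v])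
  then show ?thesis
    using adj_isometry[OF E_tensor_inner_prod[OF t] iso v]
      tensor_op_left(2)[OF E_right H_bimodule[OF t] E_tensor_hilbert[OF t] a z \<eta>]
    by (simp add: dilation_def compose_def adj_tensor_right)
qed

lemma dilation_\<kappa>:
  assumes t: "t \<ge> 0" and a: "a \<in> End_right M E" and \<eta>: "\<eta> \<in> vecs (H t)"
  shows "\<theta> t a (\<kappa> t \<eta>) = V t (tensor_vec M \<Omega> E (H t) (a (\<kappa> 0 \<Omega>)) \<eta>)"
  using dilation_tensor_vec[OF t a \<kappa>0_\<Omega>_bdd \<eta>] V_\<kappa>0[OF t \<eta>] by simp

lemma U_pi_op:
  assumes "s \<ge> 0" and "\<xi> \<in> bdd_vecs M \<Omega> (H s)" and "\<zeta> \<in> vecs L"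
  shows "U s 0 (tensor_vec M \<Omega> (H s) (H 0) \<xi> \<zeta>) = pi_op M \<Omega> (H s) \<xi> \<zeta>"
proof -
  have "\<forall>s\<ge>0. \<forall>\<xi>\<in>bdd_vecs M \<Omega> (H s). \<forall>\<zeta>\<in>vecs L.
      U s 0 (tensor_vec M \<Omega> (H s) (H 0) \<xi> \<zeta>) = pi_op M \<Omega> (H s) \<xi> \<zeta>"
    using product unfolding product_system_def by (elim conjE)
  then show ?thesis
    using assms by blast
qed

text \<open>
  The vectors \<open>\<pi>\<^sub>\<phi>(\<xi>)\<zeta>\<close> are total in \<open>H s\<close> because \<open>U s 0\<close> maps \<open>\<xi>\<phi>\<^sup>-\<^sup>1\<^sup>/\<^sup>2\<zeta>\<close> to them and is onto.
\<close>

lemma pi_op_total: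
  assumes v: "v \<in> vecs E" and orth: "\<And>s \<xi> \<zeta>. \<lbrakk>s \<ge> 0; \<xi> \<in> bdd_vecs M \<Omega> (H s); \<zeta> \<in> vecs L\<rbrakk> \<Longrightarrow>
    vinner E (\<kappa> s (pi_op M \<Omega> (H s) \<xi> \<zeta>)) v = 0"
  shows "v = vzero E"
proof -
  have \<kappa>_orth: "vinner E (\<kappa> s x) v = 0" if s: "s \<ge> 0" and x: "x \<in> vecs (H s)" for s x
  proof -
    interpret Hs: hilbert_space "H s"
      by (rule H_hilbert[OF s])
    let ?T = "tensor_space M \<Omega> (H s) (H 0)"
    let ?u = "adj (H s) E (\<kappa> s) v"
    have uni: "U s 0 \<in> unitary_op ?T (H s)"
      using U_unitary[OF s order_refl] by simp
    note iso = unitary_op_isometry[OF uni]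
    have "?u \<in> U s 0 ` vecs ?T"
      using uni s v by (simp add: unitary_op_def)
    then obtain A where A: "A \<in> vecs ?T" "?u = U s 0 A"
      by blast
    have "A = vzero ?T"
    proof (rule tensor_space_total[OF H_right[OF s] H_bimodule A(1)])
      fix \<xi> \<zeta> assume \<xi>: "\<xi> \<in> bdd_vecs M \<Omega> (H s)" and \<zeta>: "\<zeta> \<in> vecs (H 0)"
      have \<zeta>L: "\<zeta> \<in> vecs L"
        using \<zeta> by (simp add: H_0)
      have tvc: "tensor_vec M \<Omega> (H s) (H 0) \<xi> \<zeta> \<in> vecs ?T"
        by (rule tensor_vec_closed[OF H_right[OF s] H_bimodule \<xi> \<zeta>]) simp
      have pc: "pi_op M \<Omega> (H s) \<xi> \<zeta> \<in> vecs (H s)"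
        by (rule bounded_opD(1)[OF pi_op_bounded[OF H_right[OF s] \<xi>] \<zeta>L])
      have "vinner ?T (tensor_vec M \<Omega> (H s) (H 0) \<xi> \<zeta>) A = vinner (H s) (pi_op M \<Omega> (H s) \<xi> \<zeta>) ?u"
        using isometry_inner[OF iso tvc A(1)] A(2) U_pi_op[OF s \<xi> \<zeta>L] by simp
      also have "\<dots> = 0"
        using adj_inner[OF H_hilbert[OF s] E.semi_inner_axioms \<kappa>_bounded[OF s] v pc] orth[OF s \<xi> \<zeta>L] by simp
      finally show "vinner ?T (tensor_vec M \<Omega> (H s) (H 0) \<xi> \<zeta>) A = 0" .
    qed simp
    then have "vinner (H s) ?u ?u = 0"
      using isometry_inner[OF iso A(1) A(1)] A semi_inner.inner_zero[of ?T A] inner_prod_tensor[OF H_right[OF s] H_bimodule[of 0]]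
      by (simp add: inner_prod_def)
    then have "?u = vzero (H s)"
      using s v by (intro Hs.inner_definite) auto
    then show ?thesis
      using adj_inner[OF H_hilbert[OF s] E.semi_inner_axioms \<kappa>_bounded[OF s] v x] x by (simp add: Hs.inner_zero)
  qed
  \<comment> \<open>A vector orthogonal to the ranges of all \<open>\<kappa> t\<close> is 0, because
    these ranges approximate v itself.\<close>
  have "(vnorm E v)\<^sup>2 \<le> vnorm E v * e" if "e > 0" for e
  proof -
    obtain t x where tx: "t \<ge> 0" "x \<in> vecs (H t)" "vnorm E (vdiff E v (\<kappa> t x)) < e"
      using limit v \<open>e > 0\<close> unfolding inductive_limit_def by blast
    have "(vnorm E v)\<^sup>2 = Re (vinner E (vdiff E v (\<kappa> t x)) v)"
      using tx v \<kappa>_orth[OF tx(1,2)] by (simp add: E.norm_sq E.inner_simps)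
    also have "\<dots> \<le> vnorm E (vdiff E v (\<kappa> t x)) * vnorm E v"
      using E.cauchy_schwarz[of "vdiff E v (\<kappa> t x)" v] complex_Re_le_cmod[of "vinner E (vdiff E v (\<kappa> t x)) v"] tx v
      by simp
    also have "\<dots> \<le> e * vnorm E v"
      using tx v by (intro mult_right_mono) auto
    finally show ?thesis
      by (simp add: mult.commute)
  qed
  then have "(vnorm E v)\<^sup>2 \<le> 0"
    by (rule le_zero_by_epsilon)
  then have "vnorm E v = 0"
    by simp
  then show ?thesis
    using v by (intro E.norm_le_0_imp) auto
qed

text \<open>On tensors with first leg \<open>\<kappa> s \<xi>\<close> the claim holds by the
  prescription of \<open>V 0\<close>, and such values are total. Against each of them both sides
  have inner product \<langle>\<zeta>', m \<zeta>\<rangle> for the M-valued inner product m of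
  \<open>\<kappa> s \<xi>\<close> and z: on the left because \<open>V 0\<close> is isometric, on the
  right by \<open>m_inner_inner\<close>.\<close>

lemma V_0:
  assumes z: "z \<in> bdd_vecs M \<Omega> E" and \<zeta>: "\<zeta> \<in> vecs L"
  shows "V 0 (tensor_vec M \<Omega> E (H 0) z \<zeta>) = pi_op M \<Omega> E z \<zeta>"
proof -
  have H0b: "wstar_bimodule M (H 0)" and \<zeta>0: "\<zeta> \<in> vecs (H 0)"
    using H_bimodule[of 0] \<zeta> by (simp_all add: H_0)
  note iso = unitary_op_isometry[OF V_unitary[OF order_refl]]
  have tvc: "tensor_vec M \<Omega> E (H 0) z \<zeta> \<in> vecs (tensor_space M \<Omega> E (H 0))"
    by (rule tensor_vec_closed[OF E_right H0b z \<zeta>0])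
  have Vc: "V 0 (tensor_vec M \<Omega> E (H 0) z \<zeta>) \<in> vecs E"
    by (rule bounded_opD(1)[OF isometry_bounded[OF iso] tvc])
  have pc: "pi_op M \<Omega> E z \<zeta> \<in> vecs E"
    by (rule bounded_opD(1)[OF pi_op_bounded[OF E_right z] \<zeta>])
  have "vdiff E (V 0 (tensor_vec M \<Omega> E (H 0) z \<zeta>)) (pi_op M \<Omega> E z \<zeta>) = vzero E"
  proof (rule pi_op_total)
    fix s \<xi> \<zeta>' assume s: "s \<ge> 0" and \<xi>: "\<xi> \<in> bdd_vecs M \<Omega> (H s)" and \<zeta>': "\<zeta>' \<in> vecs L"
    then have \<zeta>'0: "\<zeta>' \<in> vecs (H 0)"
      by (simp add: H_0)
    let ?y = "\<kappa> s (pi_op M \<Omega> (H s) \<xi> \<zeta>')"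
    have yc: "?y \<in> vecs E"
      using s bounded_opD(1)[OF pi_op_bounded[OF H_right[OF s] \<xi>] \<zeta>'] by simp
    have y1: "?y = V 0 (tensor_vec M \<Omega> E (H 0) (\<kappa> s \<xi>) \<zeta>')"
      using V_\<kappa>[OF s order_refl \<xi> \<zeta>'0] U_pi_op[OF s \<xi> \<zeta>'] by simp
    have y2: "?y = pi_op M \<Omega> E (\<kappa> s \<xi>) \<zeta>'"
      using pi_op_\<kappa>[OF s \<xi>] \<zeta>' by (simp add: compose_def)
    note b = \<kappa>_bdd[OF s \<xi>]
    have "vinner E ?y (V 0 (tensor_vec M \<Omega> E (H 0) z \<zeta>)) =
        vinner (H 0) \<zeta>' (lact (H 0) (m_inner M \<Omega> E (\<kappa> s \<xi>) z) \<zeta>)"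
      unfolding y1 isometry_inner[OF iso tensor_vec_closed[OF E_right H0b b \<zeta>'0] tvc]
      by (rule tensor_vec_inner[OF E_right H0b b \<zeta>'0 z \<zeta>0])
    also have "\<dots> = vinner E ?y (pi_op M \<Omega> E z \<zeta>)"
      unfolding y2 H_0 by (rule m_inner_inner[OF E_right b z \<zeta>' \<zeta>])
    finally show "vinner E ?y (vdiff E (V 0 (tensor_vec M \<Omega> E (H 0) z \<zeta>)) (pi_op M \<Omega> E z \<zeta>)) = 0"
      using yc Vc pc by (simp add: E.inner_diff)
  qed (use Vc pc in simp)
  then show ?thesis
    by (rule E.diff_zero_imp_eq[OF Vc pc])
qed

text \<open>Stated on the range of \<open>\<kappa> 0\<close>, which contains the range of
  \<open>w 0\<close> for a normalised cocycle; the cocycle identity at time 0 applies \<theta>_0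
  exactly there.\<close>

lemma dilation_0:
  assumes a: "a \<in> End_right M E" and \<zeta>: "\<zeta> \<in> vecs L"
  shows "\<theta> 0 a (\<kappa> 0 \<zeta>) = a (\<kappa> 0 \<zeta>)"
proof -
  note im = bdd_vecs_image[OF E_right E_right End_rightD[OF a] \<kappa>0_\<Omega>_bdd]
  have "\<theta> 0 a (\<kappa> 0 \<zeta>) = V 0 (tensor_vec M \<Omega> E (H 0) (a (\<kappa> 0 \<Omega>)) \<zeta>)"
    using dilation_\<kappa>[OF order_refl a] \<zeta> by (simp add: H_0)
  also have "\<dots> = a (\<kappa> 0 \<zeta>)"
    using V_0[OF im(1) \<zeta>] im(2) \<zeta> by (simp add: pi_op_\<kappa>0 compose_def)
  finally show ?thesis .
qed

definition adapted_cocycle :: "(real \<Rightarrow> 'k \<Rightarrow> 'k) \<Rightarrow> bool" where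
  "adapted_cocycle w \<longleftrightarrow>
    right_cocycle M E \<theta> w \<and> contractive_family E w \<and> adapted H E \<kappa> w \<and> normalized_at_0 H E \<kappa> w"

text \<open>The cut-off to t \<ge> 0 makes the family extensional, so that the two constructions are
  inverse to each other as functions on all reals.\<close>

definition unit_of_cocycle :: "(real \<Rightarrow> 'k \<Rightarrow> 'k) \<Rightarrow> real \<Rightarrow> 'h" where
  "unit_of_cocycle w = (\<lambda>t\<in>{0..}. adj (H t) E (\<kappa> t) (w t (\<kappa> 0 \<Omega>)))"

definition cocycle_of_unit :: "(real \<Rightarrow> 'h) \<Rightarrow> real \<Rightarrow> 'k \<Rightarrow> 'k" where
  "cocycle_of_unit \<Lambda> = (\<lambda>t\<in>{0..}. compose (vecs E) (pi_op M \<Omega> E (\<kappa> t (\<Lambda> t)))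
    (adj L E (pi_op M \<Omega> E (\<kappa> 0 \<Omega>))))"

section \<open>From cocycles to units\<close>

context
  fixes w assumes w: "adapted_cocycle w"
begin

lemma w_End: "t \<ge> 0 \<Longrightarrow> w t \<in> End_right M E"
  using w by (simp add: adapted_cocycle_def right_cocycle_def)

lemma w_contraction: "t \<ge> 0 \<Longrightarrow> w t \<in> contraction_op E E"
  using w by (simp add: adapted_cocycle_def contractive_family_def)

lemma w_closed [simp]: "\<lbrakk>t \<ge> 0; v \<in> vecs E\<rbrakk> \<Longrightarrow> w t v \<in> vecs E"
  using bounded_opD(1)[OF End_rightD(1)[OF w_End]] .

lemma w_cocycle: "\<lbrakk>s \<ge> 0; t \<ge> 0; v \<in> vecs E\<rbrakk> \<Longrightarrow> w (s + t) v = \<theta> t (w s) (w t v)"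
  using w by (simp add: adapted_cocycle_def right_cocycle_def compose_def)

lemma w_0: "v \<in> vecs E \<Longrightarrow> w 0 v = \<kappa> 0 (adj L E (\<kappa> 0) v)"
  using w by (simp add: adapted_cocycle_def normalized_at_0_def range_proj_def compose_def H_0)

lemma w_range:
  assumes t: "t \<ge> 0" and v: "v \<in> vecs E"
  shows "\<kappa> t (adj (H t) E (\<kappa> t) (w t v)) = w t v"
proof -
  have "compose (vecs E) (range_proj H E \<kappa> t) (compose (vecs E) (w t) (range_proj H E \<kappa> t)) v = w t v"
    using w t by (simp add: adapted_cocycle_def adapted_def)
  then obtain y where "y \<in> vecs (H t)" "w t v = \<kappa> t y"
    using t v by (simp add: compose_def range_proj_def) (metis adj_\<kappa>_closed w_closed \<kappa>_closed)
  then show ?thesis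
    using adj_isometry[OF H_inner_prod[OF t] \<kappa>_isometry[OF t]] by simp
qed

lemma w_support:
  assumes t: "t \<ge> 0" and v: "v \<in> vecs E"
  shows "w t v = w t (\<kappa> 0 (adj L E (\<kappa> 0) v))"
  using w_cocycle[OF t order_refl v] dilation_0[OF w_End[OF t] adj_\<kappa>0_closed[OF v]] by (simp add: w_0[OF v])

text \<open>The operator obtained from \<open>\<kappa> 0\<close>, \<open>w t\<close> and the adjoint
  of \<open>\<kappa> t\<close> is a right linear contraction on L2 whose value at \<Omega> is
  \<lambda>(t). By \<open>bdd_vecsI\<close> it is \<pi>(\<lambda>(t)), so boundedness and
  contractivity come together.\<close>

lemma pi_op_w:
  assumes t: "t \<ge> 0"
  shows "unit_of_cocycle w t \<in> bdd_vecs M \<Omega> (H t)"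
    and "pi_op M \<Omega> (H t) (unit_of_cocycle w t) \<in> contraction_op L (H t)"
proof -
  interpret Ht: hilbert_space "H t"
    by (rule H_hilbert[OF t])
  let ?T = "compose (vecs L) (adj (H t) E (\<kappa> t)) (compose (vecs L) (w t) (\<kappa> 0))"
  have T: "?T \<in> contraction_op L (H t)"
    by (rule compose_contraction[OF adj_contraction[OF Ht.hilbert_space_axioms E.semi_inner_axioms
            isometry_contraction[OF \<kappa>_isometry[OF t]]]
          compose_contraction[OF w_contraction[OF t] isometry_contraction[OF \<kappa>0_isometry]]]) unfold_locales
  have "right_linear M L (H t) ?T"
    unfolding right_linear_def
    using t right_linearD[OF \<kappa>0_right_linear] right_linearD[OF End_rightD(2)[OF w_End[OF t]]]
      right_linearD[OF adj_right_linear[OF H_right[OF t] E_right \<kappa>_bounded[OF t] \<kappa>_right_linear[OF t]]]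
    by (simp add: compose_def)
  note T' = bdd_vecsI[OF H_right[OF t] contraction_bounded[OF T] this]
  have "?T \<Omega> = unit_of_cocycle w t"
    using t by (simp add: compose_def unit_of_cocycle_def)
  with T T' show "unit_of_cocycle w t \<in> bdd_vecs M \<Omega> (H t)"
    and "pi_op M \<Omega> (H t) (unit_of_cocycle w t) \<in> contraction_op L (H t)"
    by simp_all
qed

lemma \<kappa>_unit_of_cocycle: "t \<ge> 0 \<Longrightarrow> \<kappa> t (unit_of_cocycle w t) = w t (\<kappa> 0 \<Omega>)"
  by (simp add: unit_of_cocycle_def w_range)

lemma contractive_unit_of_cocycle: "contractive_unit M \<Omega> H U (unit_of_cocycle w)"
  unfolding contractive_unit_def ps_unit_def
proof (intro conjI allI impI)
  show "unit_of_cocycle w \<in> extensional {0..}"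
    by (simp add: unit_of_cocycle_def)
  show "unit_of_cocycle w t \<in> bdd_vecs M \<Omega> (H t)" if "t \<ge> 0" for t
    by (rule pi_op_w(1)[OF that])
  show "unit_of_cocycle w 0 = \<Omega>"
    using adj_isometry[OF L.inner_prod_axioms \<kappa>0_isometry \<Omega>_closed]
    by (simp add: unit_of_cocycle_def w_0 H_0)
  show "U s t (tensor_vec M \<Omega> (H s) (H t) (unit_of_cocycle w s) (unit_of_cocycle w t)) = unit_of_cocycle w (s + t)"
    if s: "s \<ge> 0" and t: "t \<ge> 0" for s t
  \<comment> \<open>The identity is verified after the injective map
    \<open>\<kappa> (s + t)\<close>. There \<open>V_\<kappa>\<close> moves the product into E, where
    it is \<theta>_t(w_s) applied to w_t \<kappa>_0 \<Omega>, and the cocycle identity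
    applies.\<close>
  proof (rule \<kappa>_inj)
    note ut = bdd_vecs_closed[OF pi_op_w(1)[OF t]]
    have "\<kappa> (s + t) (U s t (tensor_vec M \<Omega> (H s) (H t) (unit_of_cocycle w s) (unit_of_cocycle w t)))
        = V t (tensor_vec M \<Omega> E (H t) (w s (\<kappa> 0 \<Omega>)) (unit_of_cocycle w t))"
      using V_\<kappa>[OF s t pi_op_w(1)[OF s] ut] by (simp add: \<kappa>_unit_of_cocycle[OF s])
    also have "\<dots> = \<theta> t (w s) (w t (\<kappa> 0 \<Omega>))"
      using dilation_\<kappa>[OF t w_End[OF s] ut] by (simp add: \<kappa>_unit_of_cocycle[OF t])
    also have "\<dots> = \<kappa> (s + t) (unit_of_cocycle w (s + t))"
      using s t by (simp add: w_cocycle \<kappa>_unit_of_cocycle)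
    finally show "\<kappa> (s + t) (U s t (tensor_vec M \<Omega> (H s) (H t) (unit_of_cocycle w s) (unit_of_cocycle w t)))
        = \<kappa> (s + t) (unit_of_cocycle w (s + t))" .
    show "unit_of_cocycle w (s + t) \<in> vecs (H (s + t))"
      using s t by (intro bdd_vecs_closed[OF pi_op_w(1)]) simp
  qed (use s t in \<open>auto intro: U_closed pi_op_w(1) bdd_vecs_closed[OF pi_op_w(1)]\<close>)
  show "pi_prod M \<Omega> (H t) (unit_of_cocycle w t) (unit_of_cocycle w t) \<in> contraction_op L L" if t: "t \<ge> 0" for t
    unfolding pi_prod_def
    by (rule compose_contraction[OF adj_contraction[OF L.hilbert_space_axioms H_semi_inner[OF t] pi_op_w(2)[OF t]]
          pi_op_w(2)[OF t] L.semi_inner_axioms])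
qed

lemma cocycle_of_unit_of_cocycle: "cocycle_of_unit (unit_of_cocycle w) = w"
proof
  fix t
  show "cocycle_of_unit (unit_of_cocycle w) t = w t"
  proof (cases "t \<ge> 0")
    case t: True
    note im = bdd_vecs_image[OF E_right E_right End_rightD[OF w_End[OF t]] \<kappa>0_\<Omega>_bdd]
    have "compose (vecs E) (pi_op M \<Omega> E (\<kappa> t (unit_of_cocycle w t))) (adj L E (pi_op M \<Omega> E (\<kappa> 0 \<Omega>))) v = w t v" for v
    proof (cases "v \<in> vecs E")
      case True
      then show ?thesis
        using w_support[OF t True] by (simp add: compose_def \<kappa>_unit_of_cocycle[OF t] im(2) pi_op_\<kappa>0)
    next
      case False
      then show ?thesis
        using bounded_opD(4)[OF End_rightD(1)[OF w_End[OF t]] False] by (simp add: compose_def)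
    qed
    then show ?thesis
      using t by (auto simp: cocycle_of_unit_def)
  next
    case False
    then show ?thesis
      using w by (auto simp: cocycle_of_unit_def adapted_cocycle_def right_cocycle_def extensional_def)
  qed
qed

end

section \<open>From units to cocycles\<close>

context
  fixes \<Lambda> assumes \<Lambda>: "contractive_unit M \<Omega> H U \<Lambda>"
begin

lemma \<Lambda>_bdd: "t \<ge> 0 \<Longrightarrow> \<Lambda> t \<in> bdd_vecs M \<Omega> (H t)" and \<Lambda>_0: "\<Lambda> 0 = \<Omega>"
  and \<Lambda>_unit: "\<lbrakk>s \<ge> 0; t \<ge> 0\<rbrakk> \<Longrightarrow> U s t (tensor_vec M \<Omega> (H s) (H t) (\<Lambda> s) (\<Lambda> t)) = \<Lambda> (s + t)"
  using \<Lambda> by (auto simp: contractive_unit_def ps_unit_def)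

text \<open>Contractivity of a unit is imposed on the product of \<pi> with its adjoint. Writing
  |\<pi> x|^2 as the inner product of x with the image of x under that product gives |\<pi> x| \<le>
  |x|.\<close>

lemma pi_op_\<Lambda>:
  assumes t: "t \<ge> 0"
  shows "pi_op M \<Omega> (H t) (\<Lambda> t) \<in> contraction_op L (H t)"
proof -
  interpret Ht: hilbert_space "H t"
    by (rule H_hilbert[OF t])
  let ?p = "pi_op M \<Omega> (H t) (\<Lambda> t)"
  note pb = pi_op_bounded[OF H_right[OF t] \<Lambda>_bdd[OF t]]
  have pp: "pi_prod M \<Omega> (H t) (\<Lambda> t) (\<Lambda> t) \<in> contraction_op L L"
    using \<Lambda> t by (simp add: contractive_unit_def)
  have "vnorm (H t) (?p x) \<le> vnorm L x" if x: "x \<in> vecs L" for x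
  proof -
    note px = bounded_opD(1)[OF pb x]
    note ax = adj_closed[OF L.hilbert_space_axioms Ht.semi_inner_axioms pb px]
    have "(vnorm (H t) (?p x))\<^sup>2 = Re (vinner L x (adj L (H t) ?p (?p x)))"
      using adj_inner[OF L.hilbert_space_axioms Ht.semi_inner_axioms pb px x] px by (simp add: Ht.norm_sq)
    also have "\<dots> \<le> vnorm L x * vnorm L (adj L (H t) ?p (?p x))"
      using L.cauchy_schwarz[OF x ax] complex_Re_le_cmod order_trans by blast
    also have "\<dots> \<le> vnorm L x * vnorm L x"
      using pp x by (intro mult_left_mono) (auto simp: contraction_op_def pi_prod_def compose_def)
    finally have "(vnorm (H t) (?p x))\<^sup>2 \<le> (vnorm L x)\<^sup>2"
      by (simp add: power2_eq_square)
    then show ?thesis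
      by (rule power2_le_imp_le) (simp add: x)
  qed
  then show ?thesis
    using bounded_op_linear[OF pb] by (simp add: contraction_op_def)
qed

lemma cocycle_of_unit_eq:
  "t \<ge> 0 \<Longrightarrow> cocycle_of_unit \<Lambda> t =
    compose (vecs E) (compose (vecs L) (\<kappa> t) (pi_op M \<Omega> (H t) (\<Lambda> t))) (adj L E (\<kappa> 0))"
  by (simp add: cocycle_of_unit_def pi_op_\<kappa> \<Lambda>_bdd pi_op_\<kappa>0)

lemma pi_op_\<Lambda>_closed [simp]: "\<lbrakk>t \<ge> 0; x \<in> vecs L\<rbrakk> \<Longrightarrow> pi_op M \<Omega> (H t) (\<Lambda> t) x \<in> vecs (H t)"
  using bounded_opD(1)[OF contraction_bounded[OF pi_op_\<Lambda>]] .

lemma cocycle_of_unit_apply: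
  "\<lbrakk>t \<ge> 0; v \<in> vecs E\<rbrakk> \<Longrightarrow> cocycle_of_unit \<Lambda> t v = \<kappa> t (pi_op M \<Omega> (H t) (\<Lambda> t) (adj L E (\<kappa> 0) v))"
  by (simp add: cocycle_of_unit_eq compose_def)

lemma cocycle_of_unit_\<Omega>: "t \<ge> 0 \<Longrightarrow> cocycle_of_unit \<Lambda> t (\<kappa> 0 \<Omega>) = \<kappa> t (\<Lambda> t)"
  using adj_isometry[OF L.inner_prod_axioms \<kappa>0_isometry \<Omega>_closed] pi_op_\<Omega>[OF H_right \<Lambda>_bdd]
  by (simp add: cocycle_of_unit_apply)

lemma cocycle_of_unit_contraction:
  assumes t: "t \<ge> 0"
  shows "cocycle_of_unit \<Lambda> t \<in> contraction_op E E"
  unfolding cocycle_of_unit_eq[OF t]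
  by (rule compose_contraction[OF compose_contraction[OF isometry_contraction[OF \<kappa>_isometry[OF t]] pi_op_\<Lambda>[OF t]
          L.semi_inner_axioms] adj_contraction[OF L.hilbert_space_axioms E.semi_inner_axioms
          isometry_contraction[OF \<kappa>0_isometry]] E.semi_inner_axioms])

lemma cocycle_of_unit_End:
  assumes t: "t \<ge> 0"
  shows "cocycle_of_unit \<Lambda> t \<in> End_right M E"
proof -
  have "right_linear M E E (cocycle_of_unit \<Lambda> t)"
    unfolding right_linear_def
    using t ract_closed[OF E_right] right_linearD[OF adj_right_linear[OF L_right E_right \<kappa>0_bounded \<kappa>0_right_linear]]
      right_linearD[OF pi_op_right_linear[OF H_right[OF t] \<Lambda>_bdd[OF t]]] right_linearD[OF \<kappa>_right_linear[OF t]]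
    by (simp add: cocycle_of_unit_apply)
  then show ?thesis
    using contraction_bounded[OF cocycle_of_unit_contraction[OF t]] by (simp add: End_right_def)
qed

text \<open>The unit identity multiplied by a from the right. The right action on the tensor product
  is 1 \<otimes> a by definition, so \<open>tensor_op_right\<close> is what evaluates it on an
  elementary tensor before right linearity of \<open>U s t\<close> applies.\<close>

lemma \<Lambda>_unit_ract:
  assumes s: "s \<ge> 0" and t: "t \<ge> 0" and a: "a \<in> elts M"
  shows "U s t (tensor_vec M \<Omega> (H s) (H t) (\<Lambda> s) (ract (H t) (\<Lambda> t) a)) = ract (H (s + t)) (\<Lambda> (s + t)) a"
proof -
  let ?R = "\<lambda>\<eta>\<in>vecs (H t). ract (H t) \<eta> a"
  note \<Lambda>t = bdd_vecs_closed[OF \<Lambda>_bdd[OF t]]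
  have "left_linear M (H t) (H t) ?R"
    unfolding left_linear_def
    using H_bimodule[OF t] a star_rep_lin(1)[OF wstar_bimodule_star_rep[OF H_bimodule[OF t]] _ H_semi_inner[OF t]]
    by (simp add: wstar_bimodule_def)
  note R = tensor_op_right(2)[OF H_right[OF s] H_bimodule[OF t] H_tensor_hilbert[OF s t]
      ract_bounded[OF H_right[OF t] a] this \<Lambda>_bdd[OF s] \<Lambda>t]
  have "right_linear M (tensor_bi M \<Omega> (H s) (H t)) (H (s + t)) (U s t)"
    using product s t by (simp add: product_system_def)
  from right_linearD[OF this _ a, of "tensor_vec M \<Omega> (H s) (H t) (\<Lambda> s) (\<Lambda> t)"] show ?thesis
    using R \<Lambda>t tensor_vec_closed[OF H_right[OF s] H_bimodule[OF t] \<Lambda>_bdd[OF s] \<Lambda>t]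
    by (simp add: tensor_bi_sel \<Lambda>_unit[OF s t])
qed

text \<open>Both sides factor through the adjoint of \<open>\<kappa> 0\<close>, so they are compared
  as operators from L2 to E. On a vector \<Omega>a both give the image of \<Lambda>(s + t) a under
  \<open>\<kappa> (s + t)\<close>, and these vectors are dense.\<close>

lemma cocycle_of_unit_cocycle:
  assumes s: "s \<ge> 0" and t: "t \<ge> 0"
  shows "cocycle_of_unit \<Lambda> (s + t) = compose (vecs E) (\<theta> t (cocycle_of_unit \<Lambda> s)) (cocycle_of_unit \<Lambda> t)"
proof -
  let ?p = "\<lambda>t. pi_op M \<Omega> (H t) (\<Lambda> t)"
  have st: "s + t \<ge> 0"
    using s t by simp
  note \<theta>b = dilation_bounded[OF t cocycle_of_unit_End[OF s]]
  note pb = contraction_bounded[OF pi_op_\<Lambda>]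
  have eq: "compose (vecs L) (\<theta> t (cocycle_of_unit \<Lambda> s)) (compose (vecs L) (\<kappa> t) (?p t)) = compose (vecs L) (\<kappa> (s + t)) (?p (s + t))"
  proof (rule dense_bounded_ext[OF _ _ L.semi_inner_axioms E.inner_prod_axioms _ ract_\<Omega>_dense])
    show "compose (vecs L) (\<theta> t (cocycle_of_unit \<Lambda> s)) (compose (vecs L) (\<kappa> t) (?p t)) \<in> bounded_op L E"
      by (rule compose_bounded[OF \<theta>b compose_bounded[OF \<kappa>_bounded[OF t] pb[OF t] L.semi_inner_axioms
              H_semi_inner[OF t] E.semi_inner_axioms] L.semi_inner_axioms E.semi_inner_axioms E.semi_inner_axioms])
    show "compose (vecs L) (\<kappa> (s + t)) (?p (s + t)) \<in> bounded_op L E"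
      by (rule compose_bounded[OF \<kappa>_bounded[OF st] pb[OF st] L.semi_inner_axioms H_semi_inner[OF st]
            E.semi_inner_axioms])
    fix x assume "x \<in> ract L \<Omega> ` elts M"
    then obtain a where a: "a \<in> elts M" "x = ract L \<Omega> a"
      by blast
    have \<Lambda>a: "ract (H t) (\<Lambda> t) a \<in> vecs (H t)"
      by (rule ract_closed[OF H_right[OF t] a(1) bdd_vecs_closed[OF \<Lambda>_bdd[OF t]]])
    have "\<theta> t (cocycle_of_unit \<Lambda> s) (\<kappa> t (ract (H t) (\<Lambda> t) a)) =
        V t (tensor_vec M \<Omega> E (H t) (\<kappa> s (\<Lambda> s)) (ract (H t) (\<Lambda> t) a))"
      using dilation_\<kappa>[OF t cocycle_of_unit_End[OF s] \<Lambda>a] by (simp add: cocycle_of_unit_\<Omega>[OF s])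
    also have "\<dots> = \<kappa> (s + t) (ract (H (s + t)) (\<Lambda> (s + t)) a)"
      by (simp add: V_\<kappa>[OF s t \<Lambda>_bdd[OF s] \<Lambda>a] \<Lambda>_unit_ract[OF s t a(1)])
    finally show "compose (vecs L) (\<theta> t (cocycle_of_unit \<Lambda> s)) (compose (vecs L) (\<kappa> t) (?p t)) x =
        compose (vecs L) (\<kappa> (s + t)) (?p (s + t)) x"
      using a pi_op_ract[OF H_right[OF t] \<Lambda>_bdd[OF t] a(1)] pi_op_ract[OF H_right[OF st] \<Lambda>_bdd[OF st] a(1)]
      by (simp add: compose_def)
  qed auto
  have "cocycle_of_unit \<Lambda> (s + t) v = \<theta> t (cocycle_of_unit \<Lambda> s) (cocycle_of_unit \<Lambda> t v)" if v: "v \<in> vecs E" for v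
    using fun_cong[OF eq, of "adj L E (\<kappa> 0) v"] v by (simp add: cocycle_of_unit_apply s t compose_def)
  then show ?thesis
    using bounded_opD(4)[OF contraction_bounded[OF cocycle_of_unit_contraction[OF st]]]
    by (auto simp: compose_def)
qed

text \<open>The embedding \<open>\<kappa> 0\<close> equals \<open>\<kappa> t\<close> after b_{t,0},
  so its range lies in that of \<open>\<kappa> t\<close>. Hence the projection onto the latter may
  be inserted before the adjoint of \<open>\<kappa> 0\<close>, which is the right half of
  adaptedness.\<close>

lemma adj_\<kappa>0_range_proj:
  assumes t: "t \<ge> 0" and v: "v \<in> vecs E"
  shows "adj L E (\<kappa> 0) (\<kappa> t (adj (H t) E (\<kappa> t) v)) = adj L E (\<kappa> 0) v"
proof (rule adj_eqI[OF L.inner_prod_axioms])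
  fix z assume z: "z \<in> vecs L"
  have z0: "z \<in> vecs (H 0)"
    using z by (simp add: H_0)
  let ?b = "unit_embed M \<Omega> H U \<Xi> t 0 z"
  have \<Xi>: "\<Xi> t \<in> bdd_vecs M \<Omega> (H t)"
    using unital t by (simp add: unital_unit_def ps_unit_def)
  have b: "?b \<in> vecs (H t)"
    using U_closed[OF t order_refl \<Xi> z0] z0 by (simp add: unit_embed_def)
  have "compose (vecs (H 0)) (\<kappa> t) (unit_embed M \<Omega> H U \<Xi> t 0) = \<kappa> 0"
    using limit t by (simp add: inductive_limit_def)
  from fun_cong[OF this, of z] have \<kappa>0: "\<kappa> 0 z = \<kappa> t ?b"
    using z0 by (simp add: compose_def)
  have "vinner E (\<kappa> t ?b) (\<kappa> t (adj (H t) E (\<kappa> t) v)) = vinner (H t) ?b (adj (H t) E (\<kappa> t) v)"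
    using t v b by (intro isometry_inner[OF \<kappa>_isometry]) auto
  also have "\<dots> = vinner E (\<kappa> t ?b) v"
    by (rule adj_inner[OF H_hilbert[OF t] E.semi_inner_axioms \<kappa>_bounded[OF t] v b])
  also have "\<dots> = vinner L z (adj L E (\<kappa> 0) v)"
    using adj_inner[OF L.hilbert_space_axioms E.semi_inner_axioms \<kappa>0_bounded v z] by (simp add: \<kappa>0)
  finally show "vinner L z (adj L E (\<kappa> 0) v) = vinner E (\<kappa> 0 z) (\<kappa> t (adj (H t) E (\<kappa> t) v))"
    by (simp add: \<kappa>0)
qed (use t v in auto)

lemma adapted_cocycle_of_unit: "adapted_cocycle (cocycle_of_unit \<Lambda>)"
  unfolding adapted_cocycle_def right_cocycle_def contractive_family_def adapted_def normalized_at_0_def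
proof (intro conjI allI impI)
  show "cocycle_of_unit \<Lambda> \<in> extensional {0..}"
    by (simp add: cocycle_of_unit_def)
  show "compose (vecs E) (range_proj H E \<kappa> t) (compose (vecs E) (cocycle_of_unit \<Lambda> t) (range_proj H E \<kappa> t))
      = cocycle_of_unit \<Lambda> t" if t: "t \<ge> 0" for t
  proof
    fix v
    show "compose (vecs E) (range_proj H E \<kappa> t) (compose (vecs E) (cocycle_of_unit \<Lambda> t) (range_proj H E \<kappa> t)) v
        = cocycle_of_unit \<Lambda> t v"
    proof (cases "v \<in> vecs E")
      case True
      have "\<kappa> t (adj (H t) E (\<kappa> t) (\<kappa> t y)) = \<kappa> t y" if "y \<in> vecs (H t)" for y
        using adj_isometry[OF H_inner_prod[OF t] \<kappa>_isometry[OF t] that] by simp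
      then show ?thesis
        using True t by (simp add: compose_def range_proj_def cocycle_of_unit_apply adj_\<kappa>0_range_proj)
    next
      case False
      then show ?thesis
        using bounded_opD(4)[OF End_rightD(1)[OF cocycle_of_unit_End[OF t]] False] by (simp add: compose_def)
    qed
  qed
  \<comment> \<open>At time 0 the unit is \<Omega> and \<pi>(\<Omega>) is the identity of L2, so the
    constructed operator is \<open>\<kappa> 0\<close> followed after its own adjoint, the range
    projection.\<close>
  have "compose (vecs L) (\<kappa> 0) (op_id L) = \<kappa> 0"
    using bounded_opD(4)[OF \<kappa>0_bounded] by (auto simp: compose_def op_id_def)
  then show "cocycle_of_unit \<Lambda> 0 = range_proj H E \<kappa> 0"
    by (simp add: cocycle_of_unit_eq range_proj_def H_0 \<Lambda>_0 pi_op_\<Omega>_L)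
qed (auto intro: cocycle_of_unit_End cocycle_of_unit_cocycle cocycle_of_unit_contraction)

lemma unit_of_cocycle_of_unit: "unit_of_cocycle (cocycle_of_unit \<Lambda>) = \<Lambda>"
proof
  fix t
  show "unit_of_cocycle (cocycle_of_unit \<Lambda>) t = \<Lambda> t"
  proof (cases "t \<ge> 0")
    case t: True
    then show ?thesis
      using adj_isometry[OF H_inner_prod[OF t] \<kappa>_isometry[OF t] bdd_vecs_closed[OF \<Lambda>_bdd[OF t]]]
      by (simp add: unit_of_cocycle_def cocycle_of_unit_\<Omega>)
  next
    case False
    then show ?thesis
      using \<Lambda> by (auto simp: unit_of_cocycle_def contractive_unit_def ps_unit_def extensional_def)
  qed
qed

end

end

theorem theorem3p11:
  fixes M :: "('b, 'h) std_algebra"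
    and \<phi> :: "('b \<Rightarrow> 'b) \<Rightarrow> complex"
    and \<Omega> :: 'h
    and H :: "real \<Rightarrow> ('h, 'b \<Rightarrow> 'b) bimodule"
    and U :: "real \<Rightarrow> real \<Rightarrow> ('h, 'h) tens \<Rightarrow> 'h"
    and \<Xi> :: "real \<Rightarrow> 'h"
    and E :: "('k, 'b \<Rightarrow> 'b) rmodule"
    and \<kappa> :: "real \<Rightarrow> 'h \<Rightarrow> 'k"
    and V :: "real \<Rightarrow> ('k, 'h) tens \<Rightarrow> 'k"
    and \<theta> :: "real \<Rightarrow> ('k \<Rightarrow> 'k) \<Rightarrow> 'k \<Rightarrow> 'k"
  assumes "standard_form M"
    and "faithful_normal_state M \<phi>"
    and "represents_state M \<phi> \<Omega>"
    and "product_system M \<Omega> H U"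
    and "spatial M \<Omega> H U"
    and "unital_unit M \<Omega> H U \<Xi>"
    and "inductive_limit M \<Omega> H U \<Xi> E \<kappa>"
    and "dilation_unitaries M \<Omega> H U E \<kappa> V"
    and "\<theta> = dilation M \<Omega> H E V"
    and "continuous_unit M \<Omega> H E V \<Xi>"
  shows "\<exists>F. bij_betw F
      {w. right_cocycle M E \<theta> w \<and> contractive_family E w \<and> adapted H E \<kappa> w \<and> normalized_at_0 H E \<kappa> w}
      {\<Lambda>. contractive_unit M \<Omega> H U \<Lambda>} \<and>
    (\<forall>w. right_cocycle M E \<theta> w \<and> contractive_family E w \<and> adapted H E \<kappa> w \<and> normalized_at_0 H E \<kappa> w
      \<longrightarrow> (\<forall>t\<ge>0.
        F w t = adj (H t) E (\<kappa> t) (w t (\<kappa> 0 \<Omega>)) \<and>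
        w t = compose (vecs E) (pi_op M \<Omega> E (\<kappa> t (F w t)))
                (adj (L2 M) E (pi_op M \<Omega> E (\<kappa> 0 \<Omega>)))))"
proof -
  interpret dilation_setting M \<phi> \<Omega> H U \<Xi> E \<kappa> V
    using assms by unfold_locales
  \<comment> \<open>The second relation is the round trip from w to its unit and back, evaluated at
    t.\<close>
  have formula: "w t = compose (vecs E) (pi_op M \<Omega> E (\<kappa> t (unit_of_cocycle w t))) (adj L E (pi_op M \<Omega> E (\<kappa> 0 \<Omega>)))"
    if "adapted_cocycle w" "t \<ge> 0" for w t
    using fun_cong[OF cocycle_of_unit_of_cocycle[OF that(1)], of t] that(2) by (simp add: cocycle_of_unit_def)
  have bij: "bij_betw unit_of_cocycle {w. adapted_cocycle w} {\<Lambda>. contractive_unit M \<Omega> H U \<Lambda>}"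
    by (rule bij_betw_byWitness[where f' = cocycle_of_unit])
      (auto simp: cocycle_of_unit_of_cocycle unit_of_cocycle_of_unit contractive_unit_of_cocycle adapted_cocycle_of_unit)
  show ?thesis
    unfolding assms(9) adapted_cocycle_def[symmetric]
    by (intro exI[of _ unit_of_cocycle] conjI allI impI bij formula) (simp_all add: unit_of_cocycle_def)
qed

end
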